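(* $\mathsf{SPT}^2_2 \not\le_{\rm sc} \mathsf{SIPT}^2_2$.
   Context: A 2-coloring of pairs is $f:[\omega]^2\to 2$, with $f(x,y)$ meaning $f(\{x,y\})$ for $x<y$; it is stable if $\lim_u f(x,u)$ exists for all $x$. $A\oplus B=\{2x:x\in A\}\cup\{2y+1:y\in B\}$. A set $H=H_L\oplus H_R$ with $H_L,H_R$ infinite is p-homogeneous for $f$ if $f(\{x,y\})$ is constant over $x\in H_L$, $y\in H_R$, $x\neq y$; it is increasing p-homogeneous for $f$ if $f(x,y)$ is constant over $x\in H_L$, $y\in H_R$, $x<y$. $\mathsf{SPT}^2_2$ (resp. $\mathsf{SIPT}^2_2$) is the problem whose instances are stable 2-colorings of pairs $f$ and whose solutions are sets p-homogeneous (resp. increasing p-homogeneous) for $f$. $\mathsf P\le_{\rm sc}\mathsf Q$ if every instance $X$ of $\mathsf P$ computes an instance $\widehat X$ of $\mathsf Q$ such that every solution $\widehat Y$ of $\widehat X$ computes some solution of $X$. *)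

theory Defs
  imports Main "HOL-Library.Nat_Bijection"
begin

datatype recf = Zr | Sc | Id nat | Cn recf "recf list" | Pr recf recf | Mn recf | Orc

inductive reval :: "(nat \<Rightarrow> nat) \<Rightarrow> recf \<Rightarrow> nat list \<Rightarrow> nat \<Rightarrow> bool"
  for g :: "nat \<Rightarrow> nat" where
  zero: "reval g Zr xs 0"
| suc: "reval g Sc (x # xs) (Suc x)"
| ident: "i < length xs \<Longrightarrow> reval g (Id i) xs (xs ! i)"
| comp: "list_all2 (\<lambda>h y. reval g h xs y) hs ys \<Longrightarrow> reval g f ys z \<Longrightarrow> reval g (Cn f hs) xs z"
| pr0: "reval g f xs y \<Longrightarrow> reval g (Pr f h) (0 # xs) y"
| prS: "reval g (Pr f h) (n # xs) y \<Longrightarrow> reval g h (n # y # xs) z \<Longrightarrow> reval g (Pr f h) (Suc n # xs) z"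
| mn: "reval g f (n # xs) 0 \<Longrightarrow> (\<forall>m<n. \<exists>y. reval g f (m # xs) y \<and> y \<noteq> 0) \<Longrightarrow> reval g (Mn f) xs n"
| orc: "reval g Orc (x # xs) (g x)"
  monos list_all2_mono

definition turing_le :: "(nat \<Rightarrow> nat) \<Rightarrow> (nat \<Rightarrow> nat) \<Rightarrow> bool" where
  "turing_le h g \<longleftrightarrow> (\<exists>p. \<forall>x. reval g p [x] (h x))"

definition chr :: "nat set \<Rightarrow> nat \<Rightarrow> nat" where
  "chr A x = (if x \<in> A then 1 else 0)"

text \<open>A problem: instance predicate, solution relation (solutions are sets of naturals),
  and the coding of instances as oracles.\<close>
definition sc_le ::
  "('a \<Rightarrow> bool) \<Rightarrow> ('a \<Rightarrow> nat set \<Rightarrow> bool) \<Rightarrow> ('a \<Rightarrow> nat \<Rightarrow> nat) \<Rightarrow>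
   ('b \<Rightarrow> bool) \<Rightarrow> ('b \<Rightarrow> nat set \<Rightarrow> bool) \<Rightarrow> ('b \<Rightarrow> nat \<Rightarrow> nat) \<Rightarrow> bool" where
  "sc_le PI PS Penc QI QS Qenc \<longleftrightarrow>
     (\<forall>X. PI X \<longrightarrow> (\<exists>Xh. QI Xh \<and> turing_le (Qenc Xh) (Penc X) \<and>
        (\<forall>Yh. QS Xh Yh \<longrightarrow> (\<exists>Y. PS X Y \<and> turing_le (chr Y) (chr Yh)))))"

text \<open>A 2-coloring of pairs is given by c with c x y the color of {x,y} for x < y;
  values of c x y for x >= y are irrelevant (ignored by all notions below).\<close>
definition col_code :: "(nat \<Rightarrow> nat \<Rightarrow> bool) \<Rightarrow> nat \<Rightarrow> nat" where
  "col_code c n = (case prod_decode n of (x, y) \<Rightarrow> if x < y \<and> c x y then 1 else 0)"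

definition stable :: "(nat \<Rightarrow> nat \<Rightarrow> bool) \<Rightarrow> bool" where
  "stable c \<longleftrightarrow> (\<forall>x. \<exists>b N. \<forall>u>N. c x u = b)"

definition join :: "nat set \<Rightarrow> nat set \<Rightarrow> nat set" where
  "join A B = (\<lambda>x. 2 * x) ` A \<union> (\<lambda>y. 2 * y + 1) ` B"

definition p_hom :: "(nat \<Rightarrow> nat \<Rightarrow> bool) \<Rightarrow> nat set \<Rightarrow> bool" where
  "p_hom c H \<longleftrightarrow> (\<exists>A B b. H = join A B \<and> infinite A \<and> infinite B \<and>
     (\<forall>x\<in>A. \<forall>y\<in>B. x \<noteq> y \<longrightarrow> c (min x y) (max x y) = b))"

definition inc_p_hom :: "(nat \<Rightarrow> nat \<Rightarrow> bool) \<Rightarrow> nat set \<Rightarrow> bool" where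
  "inc_p_hom c H \<longleftrightarrow> (\<exists>A B b. H = join A B \<and> infinite A \<and> infinite B \<and>
     (\<forall>x\<in>A. \<forall>y\<in>B. x < y \<longrightarrow> c x y = b))"

end

theory Submission
  imports Defs "HOL-Library.Countable_Set"
begin

text \<open>
  Let f be generic for conditions that fix finitely many rows of a stable coloring, and let g be a
  stable coloring computed from f. A solution of g is built from a left side on which g has a fixed
  limit color and a sparse right side. To keep a computation from producing a p-homogeneous set of f,
  one makes it commit to a on the left and y on the right such that f(a,y), lim f(a,.) and lim f(y,.)
  are not all equal.

  Call y persistent if every further thinning of the reservoirs still leads to y being enumerated.
  If y becomes persistent while row y of f is still free, row y can be chosen to make (a,y) bad.
  The critical case is that y becomes persistent only after x has been added and x receives its
  color only together with row y. Then the single entry f(a,y) is flipped instead, and a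
  density argument over finite pieces of f (sets that are dense below a finite condition) lets f
  return to the limits and the colors under g that were already secured. Treating both colors at once,
  the color that x finally gets decides which of the two computations has been defeated. If no new
  elements become persistent, the reservoirs can be thinned until nothing new is enumerated.
\<close>

subsection \<open>Oracle computations and generic colorings\<close>

text \<open>The two ways of making (a,y) bad live in different topologies. Row conditions keep the
  limit coloring stable and leave late rows free, but rewriting row y may take away the color that x
  received together with it. A flipped entry is finite information and alters no limit, yet finite
  information alone secures neither a limit nor a color. Hence the notion \<open>world\<close>: a
  list of refinements that a family of row-open sets must admit, satisfied by all nonempty ones
  inside \<open>C\<close> and also by those dense below a finite square. The bridge is
  \<open>hit_free\<close>, which is proved in the first world but speaks of single colorings, so
  that it applies to a coloring found in the second.

  For colorings other than f the computation of g may be partial. Color requirements are therefore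
  negative: no computation yields the wrong color, throughout a cone.

  The color of the extension that genericity provides cannot be prescribed. One task per color is
  posed at a time; a task on which one color is stuck is paired with every task of the other color,
  which then is always the one served.\<close>

instance recf :: countable
  by countable_datatype

inductive_cases reval_ZrE: "reval g Zr xs y"
inductive_cases reval_ScE: "reval g Sc xs y"
inductive_cases reval_IdE: "reval g (Id i) xs y"
inductive_cases reval_CnE: "reval g (Cn f hs) xs y"
inductive_cases reval_PrE: "reval g (Pr f h) xs y"
inductive_cases reval_MnE: "reval g (Mn f) xs y"
inductive_cases reval_OrcE: "reval g Orc xs y"

lemma reval_det: "reval g p xs y \<Longrightarrow> reval g p xs z \<Longrightarrow> y = z"
proof (induction arbitrary: z rule: reval.induct)
  case (comp xs hs ys f y)
  from comp.prems obtain zs where zs: "list_all2 (\<lambda>h y. reval g h xs y) hs zs" "reval g f zs z"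
    by (rule reval_CnE)
  have "zs = ys"
  proof (rule nth_equalityI)
    show len: "length zs = length ys"
      using list_all2_lengthD[OF comp.IH(1)] list_all2_lengthD[OF zs(1)] by simp
    fix i assume "i < length zs"
    then show "zs ! i = ys ! i"
      using list_all2_nthD2[OF comp.IH(1), of i] list_all2_nthD2[OF zs(1), of i] len by simp
  qed
  with comp.IH(2)[of z] zs(2) show ?case by simp
next
  case (prS f h n xs y z')
  from prS.prems obtain y' where y': "reval g (Pr f h) (n # xs) y'" "reval g h (n # y' # xs) z"
    by (rule reval_PrE) simp_all
  with prS.IH(1) have "y = y'" by simp
  with prS.IH(2) y'(2) show ?case by simp
next
  case (pr0 f xs y h)
  from pr0.prems have "reval g f xs z" by (rule reval_PrE) simp_all
  with pr0.IH show ?case by simp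
next
  case (mn f n xs)
  from mn.prems have z: "reval g f (z # xs) 0" "\<forall>m<z. \<exists>y. reval g f (m # xs) y \<and> y \<noteq> 0"
    by (rule reval_MnE, simp)+
  show ?case
  proof (cases n z rule: linorder_cases)
    case less
    with z(2) obtain y where "reval g f (n # xs) y" "y \<noteq> 0" by blast
    with mn.IH(1)[of y] show ?thesis by simp
  next
    case greater
    with mn.IH(2) obtain y where "\<forall>w. reval g f (z # xs) w \<longrightarrow> y = w" "y \<noteq> 0" by blast
    with z(1) show ?thesis by simp
  next
    case equal
    then show ?thesis by simp
  qed
next
  case (zero xs)
  then show ?case by (rule reval_ZrE) simp
next
  case (suc x xs)
  then show ?case by (rule reval_ScE) simp
next
  case (ident i xs)
  from ident.prems show ?case by (rule reval_IdE) simp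
next
  case (orc x xs)
  then show ?case by (rule reval_OrcE) simp
qed

lemma reval_use:
  "reval g p xs y \<Longrightarrow> \<exists>N. \<forall>g'. (\<forall>i<N. g' i = g i) \<longrightarrow> reval g' p xs y"
proof (induction rule: reval.induct)
  case (comp xs hs ys f z)
  from comp.IH(1) have "\<exists>N. \<forall>g'. (\<forall>i<N. g' i = g i) \<longrightarrow> list_all2 (\<lambda>h y. reval g' h xs y) hs ys"
  proof (induction rule: list_all2_induct)
    case (Cons h hs y ys)
    then obtain N1 N2 where
      "\<forall>g'. (\<forall>i<N1. g' i = g i) \<longrightarrow> reval g' h xs y"
      "\<forall>g'. (\<forall>i<N2. g' i = g i) \<longrightarrow> list_all2 (\<lambda>h y. reval g' h xs y) hs ys" by blast
    then show ?case by (intro exI[of _ "max N1 N2"]) auto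
  qed auto
  moreover from comp.IH(2) obtain N2 where "\<forall>g'. (\<forall>i<N2. g' i = g i) \<longrightarrow> reval g' f ys z" by blast
  ultimately obtain N1 where "\<forall>g'. (\<forall>i<N1. g' i = g i) \<longrightarrow> list_all2 (\<lambda>h y. reval g' h xs y) hs ys" 
    and "\<forall>g'. (\<forall>i<N2. g' i = g i) \<longrightarrow> reval g' f ys z" by blast
  then have "\<forall>g'. (\<forall>i<max N1 N2. g' i = g i) \<longrightarrow> reval g' (Cn f hs) xs z"
    by (metis reval.comp less_max_iff_disj)
  then show ?case by blast
next
  case (prS f h n xs y z)
  then obtain N1 N2 where
    "\<forall>g'. (\<forall>i<N1. g' i = g i) \<longrightarrow> reval g' (Pr f h) (n # xs) y"
    "\<forall>g'. (\<forall>i<N2. g' i = g i) \<longrightarrow> reval g' h (n # y # xs) z" by blast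
  then have "\<forall>g'. (\<forall>i<max N1 N2. g' i = g i) \<longrightarrow> reval g' (Pr f h) (Suc n # xs) z"
    by (metis reval.prS less_max_iff_disj)
  then show ?case by blast
next
  case (mn f n xs)
  then obtain N0 where N0: "\<forall>g'. (\<forall>i<N0. g' i = g i) \<longrightarrow> reval g' f (n # xs) 0" by blast
  have "\<forall>m. \<exists>N. m < n \<longrightarrow> (\<exists>y. (\<forall>g'. (\<forall>i<N. g' i = g i) \<longrightarrow> reval g' f (m # xs) y) \<and> y \<noteq> 0)"
    using mn.IH(2) by blast
  then obtain N where N: "\<And>m. m < n \<Longrightarrow> \<exists>y. (\<forall>g'. (\<forall>i<N m. g' i = g i) \<longrightarrow> reval g' f (m # xs) y) \<and> y \<noteq> 0"
    by metis
  \<comment> \<open>The sum merely serves as a common upper bound for the finitely many uses below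
    n.\<close>
  have le: "N m \<le> (\<Sum>m<n. N m)" if "m < n" for m
    using that by (intro member_le_sum) auto
  have "reval g' (Mn f) xs n" if "\<forall>i<max N0 (\<Sum>m<n. N m). g' i = g i" for g'
  proof (rule reval.mn)
    show "reval g' f (n # xs) 0" using that N0 by auto
    show "\<forall>m<n. \<exists>y. reval g' f (m # xs) y \<and> y \<noteq> 0"
    proof (intro allI impI)
      fix m assume m: "m < n"
      then obtain y where "\<forall>g'. (\<forall>i<N m. g' i = g i) \<longrightarrow> reval g' f (m # xs) y" "y \<noteq> 0"
        using N by blast
      moreover have "\<forall>i<N m. g' i = g i" using that le[OF m] by auto
      ultimately show "\<exists>y. reval g' f (m # xs) y \<and> y \<noteq> 0" by blast
    qed
  qed
  then show ?case by blast
next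
  case (orc x xs)
  have "\<forall>g'. (\<forall>i<Suc x. g' i = g i) \<longrightarrow> reval g' Orc (x # xs) (g x)"
    by (metis lessI reval.orc)
  then show ?case by blast
next
  case (pr0 f xs y h)
  then show ?case by (meson reval.pr0)
next
  case (zero xs)
  show ?case by (blast intro: reval.zero)
next
  case (suc x xs)
  show ?case by (blast intro: reval.suc)
next
  case (ident i xs)
  then show ?case by (meson reval.ident)
qed

section \<open>Stable colorings with finitely many rows fixed, and genericity for such
  conditions\<close>

type_synonym coloring = "nat \<Rightarrow> nat \<Rightarrow> bool"

definition cone :: "coloring \<Rightarrow> nat \<Rightarrow> coloring set" where
  "cone h N = {h'. stable h' \<and> (\<forall>x<N. h' x = h x)}"

lemma cone_self: "stable h \<Longrightarrow> h \<in> cone h N"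
  by (simp add: cone_def)

lemma cone_trans: "h' \<in> cone h N \<Longrightarrow> N \<le> M \<Longrightarrow> cone h' M \<subseteq> cone h N"
  by (auto simp: cone_def)

lemma cone_stable: "h' \<in> cone h N \<Longrightarrow> stable h'"
  by (simp add: cone_def)

text \<open>The limit of a descending sequence of cones is stable because every row is settled at
  a finite stage; this is why locking whole rows is the right notion of condition.\<close>
lemma generic_exists:
  fixes W :: "nat \<Rightarrow> coloring set"
  shows "\<exists>f. stable f \<and> (\<forall>i. (\<exists>N. cone f N \<subseteq> W i) \<or>
            (\<exists>N. \<forall>h\<in>cone f N. \<forall>M. \<not> cone h M \<subseteq> W i))"
proof -
  let ?Q = "\<lambda>i h N h' N'. h' \<in> cone h N \<and> N < N' \<and>
      (cone h' N' \<subseteq> W i \<or> (\<forall>k\<in>cone h' N'. \<forall>M. \<not> cone k M \<subseteq> W i))"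
  have "\<exists>s. \<forall>i. stable (fst (s i)) \<and> ?Q i (fst (s i)) (snd (s i)) (fst (s (Suc i))) (snd (s (Suc i)))"
  proof (rule dependent_nat_choice)
    show "\<exists>x. stable (fst (x :: coloring \<times> nat))"
      by (rule exI[of _ "(\<lambda>_ _. False, 0)"]) (auto simp: stable_def)
  next
    fix x :: "coloring \<times> nat" and i
    assume st: "stable (fst x)"
    obtain h N where x: "x = (h, N)" by force
    \<comment> \<open>If some extension forces membership in \<open>W i\<close> it is taken;
      otherwise the present condition with one more row already forces the opposite.\<close>
    have "\<exists>h' N'. ?Q i h N h' N'"
    proof (cases "\<exists>k\<in>cone h (Suc N). \<exists>M. cone k M \<subseteq> W i")
      case True
      then obtain k M where k: "k \<in> cone h (Suc N)" "cone k M \<subseteq> W i" by blast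
      then have "?Q i h N k (max M (Suc N))"
        by (auto simp: cone_def)
      then show ?thesis by blast
    next
      case False
      with st x have "?Q i h N h (Suc N)" by (auto simp: cone_def)
      then show ?thesis by blast
    qed
    then obtain h' N' where "?Q i h N h' N'" by blast
    then show "\<exists>y. stable (fst y) \<and> ?Q i (fst x) (snd x) (fst y) (snd y)"
      using x cone_stable by (intro exI[of _ "(h', N')"]) auto
  qed
  then obtain s where s: "\<And>i. stable (fst (s i))"
      "\<And>i. ?Q i (fst (s i)) (snd (s i)) (fst (s (Suc i))) (snd (s (Suc i)))" by metis
  define H where "H i = fst (s i)" for i
  define N where "N i = snd (s i)" for i
  have Q: "?Q i (H i) (N i) (H (Suc i)) (N (Suc i))" for i
    using s(2)[of i] by (simp only: H_def N_def)
  have strict: "strict_mono N" using Q by (auto simp: strict_mono_Suc_iff)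
  have Ni: "i \<le> N i" for i using strict by (rule strict_mono_imp_increasing)
  have in_cone: "H j \<in> cone (H i) (N i)" if "i \<le> j" for i j
    using that
  proof (induction j rule: dec_induct)
    case base
    show ?case using s(1)[of i] by (simp add: cone_def H_def)
  next
    case (step j)
    have "H (Suc j) \<in> cone (H j) (N j)" using Q[of j] by blast
    moreover have "N i \<le> N j" using strict step by (simp add: strict_mono_less_eq)
    ultimately show ?case using cone_trans[OF step.IH] by blast
  qed
  \<comment> \<open>Stage \<open>Suc x\<close> has settled row x, because \<open>N\<close> is
    strictly increasing and so \<open>N (Suc x)\<close> exceeds x.\<close>
  define f where "f x = H (Suc x) x" for x
  have f_row: "f x = H i x" if "x < N i" for x i
  proof -
    have "x < N (Suc x)" using Ni[of "Suc x"] by simp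
    then have "H (max (Suc x) i) x = H (Suc x) x" "H (max (Suc x) i) x = H i x"
      using in_cone[of "Suc x" "max (Suc x) i"] in_cone[of i "max (Suc x) i"] that
      by (auto simp: cone_def)
    then show ?thesis by (simp add: f_def)
  qed
  have st: "stable f"
    unfolding stable_def
  proof
    fix x
    show "\<exists>b N. \<forall>u>N. f x u = b" using s(1)[of "Suc x"] by (simp add: stable_def f_def H_def)
  qed
  have ceq: "cone f (N i) = cone (H i) (N i)" for i
    using f_row[of _ i] by (auto simp: cone_def)
  have "(\<exists>N. cone f N \<subseteq> W i) \<or> (\<exists>N. \<forall>h\<in>cone f N. \<forall>M. \<not> cone h M \<subseteq> W i)" for i
    using Q[of i] ceq[of "Suc i"] by metis
  with st show ?thesis by blast
qed

definition lims :: "coloring \<Rightarrow> nat \<Rightarrow> bool \<Rightarrow> bool" where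
  "lims h x l \<longleftrightarrow> (\<exists>N. \<forall>u>N. h x u = l)"

lemma lims_exists: "stable h \<Longrightarrow> \<exists>l. lims h x l"
  by (simp add: stable_def lims_def)

lemma lims_unique: "lims h x l \<Longrightarrow> lims h x l' \<Longrightarrow> l = l'"
  unfolding lims_def by (metis less_add_Suc1 less_add_Suc2)

text \<open>No p-homogeneous set for h has a on its left side and y on its right side.\<close>
definition bad :: "coloring \<Rightarrow> nat \<Rightarrow> nat \<Rightarrow> bool" where
  "bad h a y \<longleftrightarrow> a \<noteq> y \<and> \<not> (\<exists>l. lims h a l \<and> lims h y l \<and> h (min a y) (max a y) = l)"

text \<open>Badness is read off from rows a and y alone, and both lie among the first N
  rows.\<close>

lemma bad_cone:
  assumes "bad h a y" "h' \<in> cone h N" "a < N" "y < N"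
  shows "bad h' a y"
proof -
  have "h' a = h a" "h' y = h y" "h' (min a y) = h (min a y)"
    using assms by (auto simp: cone_def min_def)
  then show ?thesis using assms(1) by (simp add: bad_def lims_def)
qed

text \<open>The square is the part of a coloring that a halting computation can inspect. Unlike
  \<open>cone\<close> it fixes no limit and does not ask for stability.\<close>

definition sq :: "coloring \<Rightarrow> nat \<Rightarrow> coloring set" where
  "sq h M = {h'. \<forall>x<M. \<forall>y<M. h' x y = h x y}"

lemma cone_sq: "h' \<in> sq h M \<Longrightarrow> cone h' M \<subseteq> sq h M"
  by (auto simp: cone_def sq_def)

lemma sq_self: "h \<in> sq h M"
  by (simp add: sq_def)

lemma sq_trans: "h' \<in> sq h M \<Longrightarrow> M \<le> M' \<Longrightarrow> sq h' M' \<subseteq> sq h M"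
  by (auto simp: sq_def)

lemma stable_upd_row: "stable h \<Longrightarrow> stable (h(y := \<lambda>_. c))"
  by (auto simp: stable_def)

lemma stable_upd_pt:
  assumes "stable h" shows "stable (h(a := (h a)(y := c)))"
  unfolding stable_def
proof
  fix x
  from assms obtain b N where "\<forall>u>N. h x u = b" unfolding stable_def by blast
  then have "\<forall>u>max N y. (h(a := (h a)(y := c))) x u = b" by auto
  then show "\<exists>b N. \<forall>u>N. (h(a := (h a)(y := c))) x u = b" by blast
qed

definition row_open :: "coloring set \<Rightarrow> bool" where
  "row_open B \<longleftrightarrow> (\<forall>h\<in>B. \<exists>N. cone h N \<subseteq> B)"

lemma row_openD: "row_open B \<Longrightarrow> h \<in> B \<Longrightarrow> \<exists>N\<ge>M. cone h N \<subseteq> B"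
proof -
  assume "row_open B" "h \<in> B"
  then obtain N where "cone h N \<subseteq> B" unfolding row_open_def by blast
  then have "cone h (max M N) \<subseteq> B" by (auto simp: cone_def)
  then show ?thesis using max.cobounded1 by blast
qed

lemma row_open_cone: "row_open (cone h N)"
  unfolding row_open_def using cone_trans by blast

lemma row_open_Int: "row_open A \<Longrightarrow> row_open B \<Longrightarrow> row_open (A \<inter> B)"
  unfolding row_open_def
proof
  fix h assume A: "\<forall>h\<in>A. \<exists>N. cone h N \<subseteq> A" and B: "\<forall>h\<in>B. \<exists>N. cone h N \<subseteq> B" and "h \<in> A \<inter> B"
  then obtain N M where "cone h N \<subseteq> A" "cone h M \<subseteq> B" by blast
  then have "cone h (max N M) \<subseteq> A \<inter> B" by (auto simp: cone_def)
  then show "\<exists>N. cone h N \<subseteq> A \<inter> B" by blast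
qed

lemma row_open_sq: "row_open {h. h \<in> sq h0 M}"
  unfolding row_open_def using cone_sq by blast

subsection \<open>Persistent elements\<close>

definition mono2 :: "(nat set \<Rightarrow> nat set \<Rightarrow> nat set) \<Rightarrow> bool" where
  "mono2 U \<longleftrightarrow> (\<forall>L L' R R'. L \<subseteq> L' \<longrightarrow> R \<subseteq> R' \<longrightarrow> U L R \<subseteq> U L' R')"

definition pers :: "(nat set \<Rightarrow> nat set \<Rightarrow> nat set) \<Rightarrow> nat set \<Rightarrow> nat set \<Rightarrow> nat set \<Rightarrow> nat set \<Rightarrow> nat \<Rightarrow> bool"
  where "pers U D E X Z y \<longleftrightarrow> (\<forall>X' Z'. X' \<subseteq> X \<longrightarrow> infinite X' \<longrightarrow> Z' \<subseteq> Z \<longrightarrow> infinite Z' \<longrightarrow>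
    y \<in> U (D \<union> X') (E \<union> Z'))"

lemma mono2D: "mono2 U \<Longrightarrow> y \<in> U L R \<Longrightarrow> L \<subseteq> L' \<Longrightarrow> R \<subseteq> R' \<Longrightarrow> y \<in> U L' R'"
  unfolding mono2_def by blast

text \<open>An infinite subset of \<open>X'\<close> meets \<open>X\<close> in an infinite set once
  \<open>X' - X\<close> is finite, and monotonicity of \<open>U\<close> leads back from this
  intersection. Persistence thus ignores finite differences, which makes diagonal constructions on
  reservoirs possible.\<close>

lemma pers_almost_sub:
  assumes "mono2 U" "pers U D E X Z y" "finite (X' - X)" "finite (Z' - Z)"
  shows "pers U D E X' Z' y"
  unfolding pers_def
proof (intro allI impI)
  fix X'' Z'' assume s: "X'' \<subseteq> X'" "infinite X''" "Z'' \<subseteq> Z'" "infinite Z''"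
  have "infinite (X'' \<inter> X)"
  proof
    assume "finite (X'' \<inter> X)"
    moreover have "X'' \<subseteq> (X'' \<inter> X) \<union> (X' - X)" using s by blast
    ultimately show False using assms(3) s(2) by (meson finite_Un finite_subset)
  qed
  moreover have "infinite (Z'' \<inter> Z)"
  proof
    assume "finite (Z'' \<inter> Z)"
    moreover have "Z'' \<subseteq> (Z'' \<inter> Z) \<union> (Z' - Z)" using s by blast
    ultimately show False using assms(4) s(4) by (meson finite_Un finite_subset)
  qed
  ultimately have "y \<in> U (D \<union> X'' \<inter> X) (E \<union> Z'' \<inter> Z)"
    using assms(2) unfolding pers_def by simp
  then show "y \<in> U (D \<union> X'') (E \<union> Z'')" using assms(1) by (rule_tac mono2D) auto
qed

definition clean :: "(nat set \<Rightarrow> nat set \<Rightarrow> nat set) \<Rightarrow> nat \<Rightarrow> nat set \<Rightarrow> nat set \<Rightarrow> nat set \<Rightarrow> nat set \<Rightarrow> bool"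
  where "clean U M D E X Z \<longleftrightarrow> (\<forall>y\<ge>M. \<forall>X' Z'. X' \<subseteq> X \<longrightarrow> infinite X' \<longrightarrow> Z' \<subseteq> Z \<longrightarrow> infinite Z' \<longrightarrow>
    \<not> pers U D E X' Z' y)"

lemma clean_sub: "clean U M D E X Z \<Longrightarrow> X' \<subseteq> X \<Longrightarrow> Z' \<subseteq> Z \<Longrightarrow> clean U M D E X' Z'"
  unfolding clean_def by (meson subset_trans)

text \<open>A number that is not persistent is missed by some thinning, and by monotonicity it stays
  missed under further thinning. So the finitely many numbers below N can be removed one at a
  time.\<close>

lemma clean_kill:
  assumes U: "mono2 U" and cl: "clean U M D E X Z" and inf: "infinite X" "infinite Z"
  shows "\<exists>X' Z'. X' \<subseteq> X \<and> infinite X' \<and> Z' \<subseteq> Z \<and> infinite Z' \<and>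
    (\<forall>y. M \<le> y \<and> y < N \<longrightarrow> y \<notin> U (D \<union> X') (E \<union> Z'))"
proof (induction N)
  case 0
  then show ?case using inf by blast
next
  case (Suc N)
  then obtain X' Z' where 1: "X' \<subseteq> X" "infinite X'" "Z' \<subseteq> Z" "infinite Z'"
    "\<forall>y. M \<le> y \<and> y < N \<longrightarrow> y \<notin> U (D \<union> X') (E \<union> Z')" by blast
  show ?case
  proof (cases "M \<le> N")
    case True
    with cl 1 have "\<not> pers U D E X' Z' N" unfolding clean_def by blast
    then obtain X'' Z'' where 2: "X'' \<subseteq> X'" "infinite X''" "Z'' \<subseteq> Z'" "infinite Z''"
      "N \<notin> U (D \<union> X'') (E \<union> Z'')" unfolding pers_def by blast
    have "y \<notin> U (D \<union> X'') (E \<union> Z'')" if "M \<le> y" "y < Suc N" for y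
    proof
      assume y: "y \<in> U (D \<union> X'') (E \<union> Z'')"
      then have "y \<in> U (D \<union> X') (E \<union> Z')" using 2 by (rule_tac mono2D[OF U]) auto
      then have "y = N" using 1(5) that by (metis less_antisym)
      then show False using 2 y by simp
    qed
    then show ?thesis using 1 2 by (meson subset_trans)
  next
    case False
    then show ?thesis using 1 by (metis less_SucE)
  qed
qed

text \<open>Both sides of this dichotomy are used: richness makes arbitrarily large numbers
  persistent by a single new left element, and its failure gives a bound and reservoirs such that no
  element added from them creates persistence beyond the bound.\<close>

definition rich :: "(nat set \<Rightarrow> nat set \<Rightarrow> nat set) \<Rightarrow> nat set \<Rightarrow> nat set \<Rightarrow> nat set \<Rightarrow> nat set \<Rightarrow> bool"
  where "rich U D E X Z \<longleftrightarrow> (\<forall>M X' Z'. X' \<subseteq> X \<longrightarrow> infinite X' \<longrightarrow> Z' \<subseteq> Z \<longrightarrow> infinite Z' \<longrightarrow>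
    (\<exists>x\<in>X'. \<exists>y\<ge>M. \<exists>X'' Z''. X'' \<subseteq> X' \<and> infinite X'' \<and> Z'' \<subseteq> Z' \<and> infinite Z'' \<and>
      pers U (insert x D) E X'' Z'' y))"

lemma rich_sub:
  assumes r: "rich U D E X Z" and s: "X' \<subseteq> X" "Z' \<subseteq> Z"
  shows "rich U D E X' Z'"
  unfolding rich_def by (intro allI impI, rule r[unfolded rich_def, rule_format]) (use s in auto)

lemma infinite_Int_atLeast: "infinite (A :: nat set) \<Longrightarrow> infinite (A \<inter> {m..})"
proof
  assume "infinite A" "finite (A \<inter> {m..})"
  moreover have "A \<subseteq> (A \<inter> {m..}) \<union> {..<m}" by auto
  ultimately show False by (meson finite_Un finite_lessThan finite_subset)
qed

lemma infinite_pick: "infinite (A :: nat set) \<Longrightarrow> \<exists>x\<in>A. m \<le> x"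
  using infinite_nat_iff_unbounded_le by blast

text \<open>Dependent choice with a prescribed start. The state is split into five components so
  that its users obtain five separate sequences rather than projections of tuples.\<close>

lemma chain5:
  assumes "P a b c d e"
    and "\<And>a b c d e (i :: nat). P a b c d e \<Longrightarrow>
      \<exists>a' b' c' d' e'. P a' b' c' d' e' \<and> Q i a b c d e a' b' c' d' e'"
  shows "\<exists>A B C D E. A 0 = a \<and> B 0 = b \<and> C 0 = c \<and> D 0 = d \<and> E 0 = e \<and>
    (\<forall>i. P (A i) (B i) (C i) (D i) (E i) \<and>
      Q i (A i) (B i) (C i) (D i) (E i) (A (Suc i)) (B (Suc i)) (C (Suc i)) (D (Suc i)) (E (Suc i)))"
proof -
  define P' where "P' t = (case t of (a, b, c, d, e) \<Rightarrow> P a b c d e)" for t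
  define Q' where "Q' i t t' = (case t of (a, b, c, d, e) \<Rightarrow> case t' of (a', b', c', d', e') \<Rightarrow>
    Q i a b c d e a' b' c' d' e')" for i t t'
  have step: "\<exists>t'. P' t' \<and> Q' i t t'" if "P' t" for t and i :: nat
  proof -
    obtain a b c d e where t: "t = (a, b, c, d, e)" by (metis surj_pair)
    with that have "P a b c d e" by (simp add: P'_def)
    from assms(2)[OF this, of i] obtain a' b' c' d' e' where
      "P a' b' c' d' e'" "Q i a b c d e a' b' c' d' e'" by blast
    then show ?thesis by (intro exI[of _ "(a', b', c', d', e')"]) (simp add: t P'_def Q'_def)
  qed
  have "\<exists>s. \<forall>i. (P' (s i) \<and> (i = 0 \<longrightarrow> s i = (a, b, c, d, e))) \<and> Q' i (s i) (s (Suc i))"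
  proof (rule dependent_nat_choice)
    show "\<exists>t. P' t \<and> ((0 :: nat) = 0 \<longrightarrow> t = (a, b, c, d, e))" using assms(1) by (auto simp: P'_def)
    show "\<exists>t'. (P' t' \<and> (Suc n = 0 \<longrightarrow> t' = (a, b, c, d, e))) \<and> Q' n t t'"
      if "P' t \<and> (n = 0 \<longrightarrow> t = (a, b, c, d, e))" for t n
      using step that by simp
  qed
  then obtain s where s: "\<And>i. P' (s i)" "\<And>i. Q' i (s i) (s (Suc i))" "s 0 = (a, b, c, d, e)" by blast
  show ?thesis
    by (intro exI[of _ "\<lambda>i. fst (s i)"] exI[of _ "\<lambda>i. fst (snd (s i))"] exI[of _ "\<lambda>i. fst (snd (snd (s i)))"]
          exI[of _ "\<lambda>i. fst (snd (snd (snd (s i))))"] exI[of _ "\<lambda>i. snd (snd (snd (snd (s i))))"])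
       (use s in \<open>simp add: P'_def Q'_def case_prod_beta\<close>)
qed

text \<open>Richness gives every x reservoirs of its own. In the diagonal sequence all later
  elements come from the reservoirs of the earlier ones, so the ranges are contained in each of
  these up to finitely many elements. Uniformity matters because the x finally used is selected by
  the richness of the task for the other color.\<close>

lemma rich_uniform:
  assumes U: "mono2 U" and r: "rich U D E X Z" and inf: "infinite X" "infinite Z"
  shows "\<exists>X' Z'. X' \<subseteq> X \<and> infinite X' \<and> Z' \<subseteq> Z \<and> infinite Z' \<and>
    (\<forall>x\<in>X'. \<exists>y\<ge>M. pers U (insert x D) E X' Z' y)"
proof -
  let ?I = "\<lambda>x z A B (_ :: unit). x \<in> X \<and> z \<in> Z \<and> A \<subseteq> X \<and> infinite A \<and> B \<subseteq> Z \<and> infinite B \<and>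
     (\<exists>y\<ge>M. pers U (insert x D) E A B y)"
  let ?Q = "\<lambda>(i :: nat) (x :: nat) (z :: nat) A B (_ :: unit) x' z' A' B' (_ :: unit).
     x < x' \<and> z < z' \<and> x' \<in> A \<and> z' \<in> B \<and> A' \<subseteq> A \<and> B' \<subseteq> B"
  have step: "\<exists>x' z' A' B' u'. ?I x' z' A' B' u' \<and> ?Q i x z A B u x' z' A' B' u'"
    if AB: "A \<subseteq> X" "infinite A" "B \<subseteq> Z" "infinite B" for x z :: nat and A B u i
  proof -
    have i: "infinite (A \<inter> {Suc x..})" "infinite (B \<inter> {Suc z..})" 
      using AB infinite_Int_atLeast by blast+
    have s: "A \<inter> {Suc x..} \<subseteq> X" "B \<inter> {Suc z..} \<subseteq> Z" using AB by auto
    from r[unfolded rich_def, rule_format, OF s(1) i(1) s(2) i(2), of M]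
    obtain x' y A' B' where 1: "x' \<in> A \<inter> {Suc x..}" "y \<ge> M" "A' \<subseteq> A \<inter> {Suc x..}" "infinite A'"
      "B' \<subseteq> B \<inter> {Suc z..}" "infinite B'" "pers U (insert x' D) E A' B' y" by blast
    obtain z' where "z' \<in> B'" using infinite_pick[OF 1(6)] by blast
    then have "z' \<in> B" "z < z'" using 1 by auto
    moreover have "x' \<in> A" "x < x'" "A' \<subseteq> A" "B' \<subseteq> B" using 1 by auto
    moreover have "x' \<in> X" "z' \<in> Z" "A' \<subseteq> X" "B' \<subseteq> Z" using calculation AB by auto
    ultimately show ?thesis using 1(2,4,6,7) by blast
  qed
  obtain x0 z0 A0 B0 where "?I x0 z0 A0 B0 ()"
    using step[OF subset_refl inf(1) subset_refl inf(2), of 0 0] by blast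
  then have "\<exists>x z A B u. x 0 = x0 \<and> z 0 = z0 \<and> A 0 = A0 \<and> B 0 = B0 \<and> u 0 = () \<and>
    (\<forall>i. ?I (x i) (z i) (A i) (B i) (u i) \<and> ?Q i (x i) (z i) (A i) (B i) (u i)
      (x (Suc i)) (z (Suc i)) (A (Suc i)) (B (Suc i)) (u (Suc i)))"
  proof (rule chain5[where P = ?I and Q = ?Q])
    show "\<exists>x' z' A' B' u'. ?I x' z' A' B' u' \<and> ?Q i x z A B u x' z' A' B' u'"
      if "?I x z A B u" for x z A B u i
      by (rule step) (use that in blast)+
  qed
  then obtain x z A B u where "\<forall>i. ?I (x i) (z i) (A i) (B i) (u i) \<and> ?Q i (x i) (z i) (A i) (B i) (u i)
      (x (Suc i)) (z (Suc i)) (A (Suc i)) (B (Suc i)) (u (Suc i))"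
    by (elim exE conjE) (rule that)
  note s = conjunct1[OF this[rule_format]] conjunct2[OF this[rule_format]]
  have I: "x i \<in> X" "z i \<in> Z" "\<exists>y\<ge>M. pers U (insert (x i) D) E (A i) (B i) y" for i
    using s(1)[of i] by blast+
  have Q: "x i < x (Suc i)" "z i < z (Suc i)" "x (Suc i) \<in> A i" "z (Suc i) \<in> B i"
    "A (Suc i) \<subseteq> A i" "B (Suc i) \<subseteq> B i" for i
    using s(2)[of i] by blast+
  have sm: "strict_mono x" "strict_mono z" using Q by (auto simp: strict_mono_Suc_iff)
  have anti: "A j \<subseteq> A i" "B j \<subseteq> B i" if "i \<le> j" for i j
    using lift_Suc_antimono_le[of A, OF Q(5) that] lift_Suc_antimono_le[of B, OF Q(6) that] by simp_all
  have fin: "finite (range x - A i)" "finite (range z - B i)" for i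
  proof -
    have "x j \<in> A i" "z j \<in> B i" if "i < j" for j
    proof -
      obtain j' where j: "j = Suc j'" "i \<le> j'" using \<open>i < j\<close> by (cases j) auto
      show "x j \<in> A i" using Q(3)[of j'] anti(1)[OF j(2)] j(1) by blast
      show "z j \<in> B i" using Q(4)[of j'] anti(2)[OF j(2)] j(1) by blast
    qed
    then have "j \<le> i" if "x j \<notin> A i \<or> z j \<notin> B i" for j
      using that linorder_not_less by blast
    then have "range x - A i \<subseteq> x ` {..i}" "range z - B i \<subseteq> z ` {..i}" by auto
    then show "finite (range x - A i)" "finite (range z - B i)"
      by (meson finite_atMost finite_imageI finite_subset)+
  qed
  show ?thesis
  proof (intro exI conjI)
    show "range x \<subseteq> X" "range z \<subseteq> Z" using I by auto
    show "infinite (range x)" "infinite (range z)" 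
      using sm by (simp_all add: range_inj_infinite strict_mono_imp_inj_on)
    show "\<forall>w\<in>range x. \<exists>y\<ge>M. pers U (insert w D) E (range x) (range z) y"
    proof
      fix w assume "w \<in> range x"
      then obtain i where w: "w = x i" by blast
      from I(3)[of i] obtain y where "y \<ge> M" "pers U (insert w D) E (A i) (B i) y"
        unfolding w by blast
      then show "\<exists>y\<ge>M. pers U (insert w D) E (range x) (range z) y"
        using pers_almost_sub[OF U _ fin(1)[of i] fin(2)[of i]] by blast
    qed
  qed
qed

section \<open>Monotone hulls of computations, and fusion of reservoirs\<close>

definition ups :: "(nat set \<Rightarrow> nat set \<Rightarrow> nat set) \<Rightarrow> nat set \<Rightarrow> nat set \<Rightarrow> nat set \<Rightarrow> nat set \<Rightarrow> nat set" where
  "ups G D0 E0 L R = {y. \<exists>D E. finite D \<and> finite E \<and> D \<subseteq> L \<and> E \<subseteq> R \<and> y \<in> G (D0 \<union> D) (E0 \<union> E)}"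

text \<open>An oracle computation also uses the absence of elements and is not monotone itself.
  Quantifying over finite extensions from the reservoirs is what turns it into an operator to which
  persistence applies.\<close>

lemma mono2_ups: "mono2 (ups G D0 E0)"
  unfolding mono2_def
proof (intro allI impI subsetI)
  fix L L' R R' y assume "L \<subseteq> L'" "R \<subseteq> R'" "y \<in> ups G D0 E0 L R"
  moreover from this obtain D E where "finite D" "finite E" "D \<subseteq> L" "E \<subseteq> R" "y \<in> G (D0 \<union> D) (E0 \<union> E)"
    unfolding ups_def by auto
  ultimately have "finite D \<and> finite E \<and> D \<subseteq> L' \<and> E \<subseteq> R' \<and> y \<in> G (D0 \<union> D) (E0 \<union> E)" by auto
  then show "y \<in> ups G D0 E0 L' R'" unfolding ups_def by (intro CollectI exI)
qed

definition fcont :: "(nat set \<Rightarrow> nat set \<Rightarrow> nat set) \<Rightarrow> bool" where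
  "fcont G \<longleftrightarrow> (\<forall>L R a. a \<in> G L R \<longrightarrow> (\<exists>N. \<forall>L' R'. L' \<inter> {..<N} = L \<inter> {..<N} \<longrightarrow>
     R' \<inter> {..<N} = R \<inter> {..<N} \<longrightarrow> a \<in> G L' R'))"

lemma ups_of_limit:
  assumes "fcont G" "y \<in> G (D0 \<union> L) (E0 \<union> R)"
  shows "y \<in> ups G D0 E0 L R"
proof -
  obtain N where "\<forall>L' R'. L' \<inter> {..<N} = (D0 \<union> L) \<inter> {..<N} \<longrightarrow>
     R' \<inter> {..<N} = (E0 \<union> R) \<inter> {..<N} \<longrightarrow> y \<in> G L' R'"
    using assms(1)[unfolded fcont_def, rule_format, OF assms(2)] by (elim exE) (rule that)
  moreover have "(D0 \<union> L \<inter> {..<N}) \<inter> {..<N} = (D0 \<union> L) \<inter> {..<N}" by blast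
  moreover have "(E0 \<union> R \<inter> {..<N}) \<inter> {..<N} = (E0 \<union> R) \<inter> {..<N}" by blast
  ultimately have "y \<in> G (D0 \<union> L \<inter> {..<N}) (E0 \<union> R \<inter> {..<N})" by simp
  then have "finite (L \<inter> {..<N}) \<and> finite (R \<inter> {..<N}) \<and> L \<inter> {..<N} \<subseteq> L \<and> R \<inter> {..<N} \<subseteq> R \<and>
    y \<in> G (D0 \<union> L \<inter> {..<N}) (E0 \<union> R \<inter> {..<N})" by simp
  then show ?thesis unfolding ups_def by (intro CollectI exI)
qed

lemma finite_subset_chain:
  fixes D :: "nat \<Rightarrow> 'a set"
  assumes "finite F" "\<And>i j. i \<le> j \<Longrightarrow> D i \<subseteq> D j" "\<And>x. x \<in> F \<Longrightarrow> \<exists>i. x \<in> D i"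
  shows "\<exists>i. \<forall>j\<ge>i. F \<subseteq> D j"
  using assms(1,3)
proof (induction F)
  case (insert x F)
  then obtain i i' where i: "\<forall>j\<ge>i. F \<subseteq> D j" "x \<in> D i'" by blast
  have "insert x F \<subseteq> D j" if "j \<ge> max i i'" for j
    using i assms(2)[of i' j] that by auto
  then show ?case by blast
qed simp

text \<open>Fusion in the style of Mathias forcing: P is the invariant and K what step i achieves.
  The limit sets lie inside \<open>Ds i \<union> Xs i\<close> and \<open>Es i \<union> Zs i\<close>
  for every i, so a number that a monotone operator misses at one stage is missed in the limit,
  while every finite part of the limit already occurs at a stage.\<close>

lemma fusion:
  fixes P :: "'b set \<Rightarrow> nat set \<Rightarrow> nat set \<Rightarrow> nat set \<Rightarrow> nat set \<Rightarrow> bool"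
    and K :: "nat \<Rightarrow> nat set \<Rightarrow> nat set \<Rightarrow> nat set \<Rightarrow> nat set \<Rightarrow> bool"
  assumes init: "P B D E X Z"
    and step: "\<And>B D E X Z i. P B D E X Z \<Longrightarrow> \<exists>x z B' X' Z'. x \<in> X \<and> z \<in> Z \<and> (\<forall>r\<in>D. r < x) \<and>
      (\<forall>r\<in>E. r < z) \<and> B' \<subseteq> B \<and> X' \<subseteq> X \<and> Z' \<subseteq> Z \<and> P B' (insert x D) (insert z E) X' Z' \<and>
      K i (insert x D) (insert z E) X' Z'"
  obtains X' Z' Bs Ds Es Xs Zs where "X' \<subseteq> X" "infinite X'" "Z' \<subseteq> Z" "infinite Z'"
    "\<And>i. P (Bs i) (Ds i) (Es i) (Xs i) (Zs i)" "\<And>i. Bs i \<subseteq> B"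
    "\<And>i. K i (Ds (Suc i)) (Es (Suc i)) (Xs (Suc i)) (Zs (Suc i))"
    "\<And>i. X' \<subseteq> Ds i \<union> Xs i" "\<And>i. Z' \<subseteq> Es i \<union> Zs i"
    "\<And>F. finite F \<Longrightarrow> F \<subseteq> D \<union> X' \<Longrightarrow> \<exists>i. \<forall>j\<ge>i. F \<subseteq> Ds j"
    "\<And>F. finite F \<Longrightarrow> F \<subseteq> E \<union> Z' \<Longrightarrow> \<exists>i. \<forall>j\<ge>i. F \<subseteq> Es j"
proof -
  let ?R = "\<lambda>i x z B D E X Z B' D' E' X' Z'. x \<in> X \<and> z \<in> Z \<and> (\<forall>r\<in>D. r < x) \<and>
      (\<forall>r\<in>E. r < z) \<and> B' \<subseteq> B \<and> X' \<subseteq> X \<and> Z' \<subseteq> Z \<and> D' = insert x D \<and> E' = insert z E \<and> K i D' E' X' Z'"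
  let ?Q = "\<lambda>i B D E X Z B' D' E' X' Z'. \<exists>x z. ?R i x z B D E X Z B' D' E' X' Z'"
  have "\<exists>Bs Ds Es Xs Zs. Bs 0 = B \<and> Ds 0 = D \<and> Es 0 = E \<and> Xs 0 = X \<and> Zs 0 = Z \<and>
    (\<forall>i. P (Bs i) (Ds i) (Es i) (Xs i) (Zs i) \<and> ?Q i (Bs i) (Ds i) (Es i) (Xs i) (Zs i)
      (Bs (Suc i)) (Ds (Suc i)) (Es (Suc i)) (Xs (Suc i)) (Zs (Suc i)))"
  proof (rule chain5[where P = P and Q = ?Q, OF init])
    fix B D E X Z i assume "P B D E X Z"
    from step[OF this, of i] obtain x z B' X' Z' where
      "x \<in> X" "z \<in> Z" "\<forall>r\<in>D. r < x" "\<forall>r\<in>E. r < z" "B' \<subseteq> B" "X' \<subseteq> X" "Z' \<subseteq> Z"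
      "P B' (insert x D) (insert z E) X' Z'" "K i (insert x D) (insert z E) X' Z'"
      by (elim exE conjE) (rule that)
    then show "\<exists>B' D' E' X' Z'. P B' D' E' X' Z' \<and> ?Q i B D E X Z B' D' E' X' Z'"
      by (intro exI[of _ B'] exI[of _ "insert x D"] exI[of _ "insert z E"] exI[of _ X'] exI[of _ Z']
          exI[of _ x] exI[of _ z] conjI refl)
  qed
  then obtain Bs Ds Es Xs Zs where z0: "Bs 0 = B" "Ds 0 = D" "Es 0 = E" "Xs 0 = X" "Zs 0 = Z" and
    s: "\<forall>i. P (Bs i) (Ds i) (Es i) (Xs i) (Zs i) \<and> ?Q i (Bs i) (Ds i) (Es i) (Xs i) (Zs i)
      (Bs (Suc i)) (Ds (Suc i)) (Es (Suc i)) (Xs (Suc i)) (Zs (Suc i))"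
    by (elim exE conjE) (rule that)
  have P: "P (Bs i) (Ds i) (Es i) (Xs i) (Zs i)" for i by (rule conjunct1[OF s[rule_format]])
  have "\<forall>i. \<exists>p. ?R i (fst p) (snd p) (Bs i) (Ds i) (Es i) (Xs i) (Zs i)
      (Bs (Suc i)) (Ds (Suc i)) (Es (Suc i)) (Xs (Suc i)) (Zs (Suc i))"
  proof
    fix i
    obtain x z where "?R i x z (Bs i) (Ds i) (Es i) (Xs i) (Zs i)
      (Bs (Suc i)) (Ds (Suc i)) (Es (Suc i)) (Xs (Suc i)) (Zs (Suc i))"
      using conjunct2[OF s[rule_format], of i] by (elim exE) (rule that)
    then show "\<exists>p. ?R i (fst p) (snd p) (Bs i) (Ds i) (Es i) (Xs i) (Zs i)
      (Bs (Suc i)) (Ds (Suc i)) (Es (Suc i)) (Xs (Suc i)) (Zs (Suc i))"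
      by (intro exI[of _ "(x, z)"]) (unfold fst_conv snd_conv, assumption)
  qed
  from choice[OF this] obtain p where p: "\<forall>i. ?R i (fst (p i)) (snd (p i)) (Bs i) (Ds i) (Es i) (Xs i) (Zs i)
      (Bs (Suc i)) (Ds (Suc i)) (Es (Suc i)) (Xs (Suc i)) (Zs (Suc i))" by (elim exE) (rule that)
  define x z where "x i = fst (p i)" and "z i = snd (p i)" for i
  have R: "x i \<in> Xs i" "z i \<in> Zs i" "\<forall>r\<in>Ds i. r < x i" "\<forall>r\<in>Es i. r < z i"
    "Bs (Suc i) \<subseteq> Bs i" "Xs (Suc i) \<subseteq> Xs i" "Zs (Suc i) \<subseteq> Zs i"
    "Ds (Suc i) = insert (x i) (Ds i)" "Es (Suc i) = insert (z i) (Es i)"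
    "K i (Ds (Suc i)) (Es (Suc i)) (Xs (Suc i)) (Zs (Suc i))" for i
    using p[rule_format, of i] unfolding x_def z_def by - (elim conjE, assumption)+
  have anti: "Bs j \<subseteq> Bs i" "Xs j \<subseteq> Xs i" "Zs j \<subseteq> Zs i" if "i \<le> j" for i j
    using lift_Suc_antimono_le[of Bs, OF R(5) that] lift_Suc_antimono_le[of Xs, OF R(6) that]
      lift_Suc_antimono_le[of Zs, OF R(7) that] by simp_all
  have mono: "Ds i \<subseteq> Ds j" "Es i \<subseteq> Es j" if "i \<le> j" for i j
    using lift_Suc_mono_le[of Ds i j] lift_Suc_mono_le[of Es i j] R(8,9) that by auto
  have sm: "strict_mono x" "strict_mono z" using R(3,4)[of "Suc _"] R(8,9) by (auto simp: strict_mono_Suc_iff)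
  show ?thesis
  proof (rule that[of "range x" "range z" Bs Ds Es Xs Zs])
    have "x i \<in> X" "z i \<in> Z" for i using R(1,2)[of i] anti(2,3)[OF le0, of i] z0 by blast+
    then show "range x \<subseteq> X" "range z \<subseteq> Z" by blast+
    show "infinite (range x)" "infinite (range z)"
      using sm by (simp_all add: range_inj_infinite strict_mono_imp_inj_on)
    show "P (Bs i) (Ds i) (Es i) (Xs i) (Zs i)" for i by (rule P)
    show "Bs i \<subseteq> B" for i using anti(1)[of 0 i] z0 by simp
    show "K i (Ds (Suc i)) (Es (Suc i)) (Xs (Suc i)) (Zs (Suc i))" for i by (rule R)
    have in_or: "x j \<in> Ds i \<union> Xs i" "z j \<in> Es i \<union> Zs i" for i j
    proof -
      show "x j \<in> Ds i \<union> Xs i" using R(1)[of j] R(8)[of j] anti(2)[of i j] mono(1)[of "Suc j" i]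
        by (cases "i \<le> j") auto
      show "z j \<in> Es i \<union> Zs i" using R(2)[of j] R(9)[of j] anti(3)[of i j] mono(2)[of "Suc j" i]
        by (cases "i \<le> j") auto
    qed
    show "range x \<subseteq> Ds i \<union> Xs i" "range z \<subseteq> Es i \<union> Zs i" for i using in_or by blast+
    show "\<exists>i. \<forall>j\<ge>i. F \<subseteq> Ds j" if "finite F" "F \<subseteq> D \<union> range x" for F
      by (rule finite_subset_chain[OF that(1) mono(1)]) (use that(2) z0(2) R(8) in blast)+
    show "\<exists>i. \<forall>j\<ge>i. F \<subseteq> Es j" if "finite F" "F \<subseteq> E \<union> range z" for F
      by (rule finite_subset_chain[OF that(1) mono(2)]) (use that(2) z0(3) R(9) in blast)+
  qed
qed

text \<open>Numbers below N were excluded while the added elements still belonged to the reservoirs,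
  hence they remain excluded; the numbers from N on are the business of \<open>late\<close>.\<close>

lemma clean_extend:
  assumes U: "mono2 U" and k: "\<And>y. M \<le> y \<Longrightarrow> y < N \<Longrightarrow> y \<notin> U (D \<union> X) (E \<union> Z)"
    and late: "\<And>y X' Z'. N \<le> y \<Longrightarrow> X' \<subseteq> X \<Longrightarrow> infinite X' \<Longrightarrow> Z' \<subseteq> Z \<Longrightarrow> infinite Z' \<Longrightarrow> \<not> pers U D' E' X' Z' y"
    and sub: "D' \<subseteq> D \<union> X" "E' \<subseteq> E \<union> Z"
  shows "clean U M D' E' X Z"
  unfolding clean_def
proof (intro allI impI notI)
  fix y X' Z' assume a: "M \<le> y" "X' \<subseteq> X" "infinite X'" "Z' \<subseteq> Z" "infinite Z'" "pers U D' E' X' Z' y"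
  show False
  proof (cases "N \<le> y")
    case True
    from late[OF this a(2-5)] a(6) show False ..
  next
    case False
    have "y \<in> U (D' \<union> X') (E' \<union> Z')" 
      using a(6)[unfolded pers_def, rule_format, OF order_refl a(3) order_refl a(5)] .
    then have "y \<in> U (D \<union> X) (E \<union> Z)" by (rule mono2D[OF U]) (use sub a in auto)
    with k[OF a(1)] False show False by simp
  qed
qed

lemma above_finite: "finite (A :: nat set) \<Longrightarrow> \<exists>m. \<forall>r\<in>A. r < m"
  by (meson finite_nat_set_iff_bounded)

section \<open>Color requirements, and the setting of a target that is densely avoided\<close>

definition good :: "(coloring \<Rightarrow> nat \<Rightarrow> nat \<Rightarrow> bool \<Rightarrow> bool) \<Rightarrow> bool \<Rightarrow> coloring \<Rightarrow> nat set \<Rightarrow> nat set \<Rightarrow> bool"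
  where "good V b h D E \<longleftrightarrow> (\<forall>x\<in>D. \<exists>m. \<forall>u\<ge>m. \<not> V h x u (\<not> b)) \<and> (\<forall>x\<in>D. \<forall>r\<in>E. \<not> V h x r (\<not> b))"

text \<open>This is \<open>good\<close> forced by finitely many rows, with one bound m for the whole
  cone. The uniform bound makes it an open condition and lets right elements beyond m be added
  without any further choice.\<close>

definition locked :: "(coloring \<Rightarrow> nat \<Rightarrow> nat \<Rightarrow> bool \<Rightarrow> bool) \<Rightarrow> bool \<Rightarrow> coloring \<Rightarrow> nat set \<Rightarrow> nat set \<Rightarrow> bool"
  where "locked V b h D E \<longleftrightarrow> (\<exists>N m. \<forall>h'\<in>cone h N.
    (\<forall>x\<in>D. \<forall>u\<ge>m. \<not> V h' x u (\<not> b)) \<and> (\<forall>x\<in>D. \<forall>r\<in>E. \<not> V h' x r (\<not> b)))"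

definition defeated :: "(nat set \<Rightarrow> nat set \<Rightarrow> nat set) \<Rightarrow> (nat set \<Rightarrow> nat set \<Rightarrow> nat set) \<Rightarrow>
    nat set \<Rightarrow> nat set \<Rightarrow> nat set \<Rightarrow> nat set \<Rightarrow> bool" where
  "defeated G G' D E X Z \<longleftrightarrow> (\<forall>L R. L \<subseteq> X \<longrightarrow> infinite L \<longrightarrow> R \<subseteq> Z \<longrightarrow> infinite R \<longrightarrow>
    finite (G (D \<union> L) (E \<union> R)) \<or> finite (G' (D \<union> L) (E \<union> R)))"

text \<open>What the generic coloring is shown to provide for two given computations, one per color:
  a finite extension of one of them that commits it to a bad pair, or reservoirs from which it can
  no longer produce two infinite sides.\<close>
definition target :: "(coloring \<Rightarrow> nat \<Rightarrow> nat \<Rightarrow> bool \<Rightarrow> bool) \<Rightarrow> (bool \<Rightarrow> nat set \<Rightarrow> nat set \<Rightarrow> nat set) \<Rightarrow>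
    (bool \<Rightarrow> nat set \<Rightarrow> nat set \<Rightarrow> nat set) \<Rightarrow> nat set \<Rightarrow> nat set \<Rightarrow> coloring \<Rightarrow> bool" where
  "target V GL GR X Z h \<longleftrightarrow> (\<exists>b D E. finite D \<and> finite E \<and> D \<subseteq> X \<and> E \<subseteq> Z \<and> good V b h D E \<and>
     ((\<exists>a\<in>GL b D E. \<exists>y\<in>GR b D E. bad h a y) \<or>
      (\<exists>X' Z'. X' \<subseteq> X \<and> infinite X' \<and> Z' \<subseteq> Z \<and> infinite Z' \<and> defeated (GL b) (GR b) D E X' Z')))"

text \<open>The situation to be refuted. \<open>total_dense\<close> and \<open>color_dense\<close>
  reflect that the instance computed from f is total and stable; \<open>avoid\<close> says that
  \<open>target\<close> is nowhere forced below the condition given by the first n rows of f, which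
  genericity would provide if f failed it.\<close>

locale core =
  fixes V :: "coloring \<Rightarrow> nat \<Rightarrow> nat \<Rightarrow> bool \<Rightarrow> bool" and f :: coloring and n :: nat
    and GL GR :: "bool \<Rightarrow> nat set \<Rightarrow> nat set \<Rightarrow> nat set" and X Z :: "nat set"
  assumes stable_f: "stable f"
    and V_less: "\<And>h x u b. V h x u b \<Longrightarrow> x < u"
    and V_det: "\<And>h x u b b'. V h x u b \<Longrightarrow> V h x u b' \<Longrightarrow> b = b'"
    and V_cont: "\<And>h x u b. V h x u b \<Longrightarrow> \<exists>M. \<forall>h'\<in>sq h M. V h' x u b"
    and GL_cont: "\<And>b. fcont (GL b)" and GR_cont: "\<And>b. fcont (GR b)"
    and total_dense: "\<And>h N x u. h \<in> cone f n \<Longrightarrow> x < u \<Longrightarrow> \<exists>h'\<in>cone h N. \<exists>b. V h' x u b"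
    and color_dense: "\<And>h N x. h \<in> cone f n \<Longrightarrow> \<exists>h'\<in>cone h N. \<exists>b. locked V b h' {x} {}"
    and inf_X: "infinite X" and inf_Z: "infinite Z"
    and avoid: "\<And>h N. h \<in> cone f n \<Longrightarrow> \<exists>h'\<in>cone h N. \<not> target V GL GR X Z h'"
begin

abbreviation "C \<equiv> cone f n"
abbreviation "Gd \<equiv> locked V"

lemma C_stable: "h \<in> C \<Longrightarrow> stable h"
  by (rule cone_stable)

lemma GdI: "\<lbrakk>\<And>h' x u. h' \<in> cone h N \<Longrightarrow> x \<in> D \<Longrightarrow> u \<ge> m \<Longrightarrow> \<not> V h' x u (\<not> b);
    \<And>h' x r. h' \<in> cone h N \<Longrightarrow> x \<in> D \<Longrightarrow> r \<in> E \<Longrightarrow> \<not> V h' x r (\<not> b)\<rbrakk> \<Longrightarrow> Gd b h D E"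
  unfolding locked_def by (intro exI[of _ N] exI[of _ m]) blast

lemma GdE:
  assumes "Gd b h D E"
  obtains N m where "\<And>h' x u. h' \<in> cone h N \<Longrightarrow> x \<in> D \<Longrightarrow> u \<ge> m \<Longrightarrow> \<not> V h' x u (\<not> b)"
    "\<And>h' x r. h' \<in> cone h N \<Longrightarrow> x \<in> D \<Longrightarrow> r \<in> E \<Longrightarrow> \<not> V h' x r (\<not> b)"
  using assms unfolding locked_def by blast

lemma Gd_mono: "Gd b h D E \<Longrightarrow> D' \<subseteq> D \<Longrightarrow> E' \<subseteq> E \<Longrightarrow> Gd b h D' E'"
  unfolding locked_def by (meson subsetD)

lemma Gd_empty: "Gd b h {} E"
  unfolding locked_def by simp

lemma Gd_open: assumes "Gd b h D E" shows "\<exists>N. \<forall>h'\<in>cone h N. Gd b h' D E"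
proof -
  from assms obtain N m where "\<forall>h'\<in>cone h N.
    (\<forall>x\<in>D. \<forall>u\<ge>m. \<not> V h' x u (\<not> b)) \<and> (\<forall>x\<in>D. \<forall>r\<in>E. \<not> V h' x r (\<not> b))"
    unfolding locked_def by blast
  then have "\<forall>h'\<in>cone h N. Gd b h' D E" 
    unfolding locked_def using cone_trans[OF _ order_refl] by (meson subsetD)
  then show ?thesis by blast
qed

lemma row_open_Gd: "row_open B \<Longrightarrow> row_open {h \<in> B. Gd b h D E}"
  unfolding row_open_def
proof
  fix h assume B: "\<forall>h\<in>B. \<exists>N. cone h N \<subseteq> B" and h: "h \<in> {h \<in> B. Gd b h D E}"
  then obtain N M where "cone h N \<subseteq> B" "\<forall>h'\<in>cone h M. Gd b h' D E" using Gd_open[of b h D E] by blast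
  then have "cone h (max N M) \<subseteq> {h \<in> B. Gd b h D E}" by (auto simp: cone_def)
  then show "\<exists>N. cone h N \<subseteq> {h \<in> B. Gd b h D E}" by blast
qed

lemma row_open_lims: "row_open B \<Longrightarrow> row_open {h \<in> B. lims h a l}"
  unfolding row_open_def
proof
  fix h assume B: "\<forall>h\<in>B. \<exists>N. cone h N \<subseteq> B" and h: "h \<in> {h \<in> B. lims h a l}"
  then obtain N where "cone h N \<subseteq> B" by blast
  moreover have "lims h' a l" if "h' \<in> cone h (max N (Suc a))" for h'
    using that h by (simp add: cone_def lims_def)
  moreover have "cone h (max N (Suc a)) \<subseteq> cone h N" by (auto simp: cone_def)
  ultimately have "cone h (max N (Suc a)) \<subseteq> {h \<in> B. lims h a l}" by blast
  then show "\<exists>N. cone h N \<subseteq> {h \<in> B. lims h a l}" by blast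
qed

text \<open>V concerns increasing pairs only, so an x at or above all of E meets no requirement
  against E. For this reason new left elements are always taken above the right side.\<close>

lemma Gd_insert:
  assumes "Gd b h D E" "Gd b h {x} {}" "\<And>r. r \<in> E \<Longrightarrow> r \<le> x"
  shows "Gd b h (insert x D) E"
proof -
  from assms(1) obtain N m where 1: "\<And>h' x u. h' \<in> cone h N \<Longrightarrow> x \<in> D \<Longrightarrow> u \<ge> m \<Longrightarrow> \<not> V h' x u (\<not> b)"
    "\<And>h' x r. h' \<in> cone h N \<Longrightarrow> x \<in> D \<Longrightarrow> r \<in> E \<Longrightarrow> \<not> V h' x r (\<not> b)" by (rule GdE) blast
  from assms(2) obtain N' m' where 2: "\<And>h' u. h' \<in> cone h N' \<Longrightarrow> u \<ge> m' \<Longrightarrow> \<not> V h' x u (\<not> b)"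
    by (rule GdE) blast
  have c: "cone h (max N N') \<subseteq> cone h N" "cone h (max N N') \<subseteq> cone h N'" by (auto simp: cone_def)
  show ?thesis
  proof (rule GdI[of h "max N N'" _ "max m m'"])
    fix h' w u assume "h' \<in> cone h (max N N')" "w \<in> insert x D" "u \<ge> max m m'"
    then show "\<not> V h' w u (\<not> b)" using 1(1)[of h' w u] 2[of h' u] c by auto
  next
    fix h' w r assume "h' \<in> cone h (max N N')" "w \<in> insert x D" "r \<in> E"
    then show "\<not> V h' w r (\<not> b)" using 1(2)[of h' w r] assms(3)[of r] V_less[of h' w r] c by fastforce
  qed
qed

text \<open>Beyond m the wrong color is already excluded by the lock. The bounds N and m do not
  depend on z, so they are known before z is chosen.\<close>

lemma Gd_late:
  assumes "Gd b h D E"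
  obtains N m where "\<And>h' z. h' \<in> cone h N \<Longrightarrow> z \<ge> m \<Longrightarrow> Gd b h' D (insert z E)"
proof -
  from assms obtain N m where 1: "\<And>h' x u. h' \<in> cone h N \<Longrightarrow> x \<in> D \<Longrightarrow> u \<ge> m \<Longrightarrow> \<not> V h' x u (\<not> b)"
    "\<And>h' x r. h' \<in> cone h N \<Longrightarrow> x \<in> D \<Longrightarrow> r \<in> E \<Longrightarrow> \<not> V h' x r (\<not> b)" by (rule GdE) blast
  show ?thesis
  proof (rule that[of N m])
    fix h' z assume h: "h' \<in> cone h N" "z \<ge> m"
    have c: "cone h' N \<subseteq> cone h N" using cone_trans[OF h(1)] by simp
    show "Gd b h' D (insert z E)"
      by (rule GdI[of h' N _ m]) (use 1 c h in blast)+
  qed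
qed

lemma Gd_good: "stable h \<Longrightarrow> Gd b h D E \<Longrightarrow> good V b h D E"
  unfolding locked_def good_def using cone_self by blast

text \<open>Both the lock and the badness survive on a cone around h, and that cone contains a
  coloring at which \<open>target\<close> fails.\<close>

lemma no_hit:
  assumes "h \<in> C" "Gd b h D E" "finite D" "finite E" "D \<subseteq> X" "E \<subseteq> Z" "a \<in> GL b D E" "y \<in> GR b D E"
  shows "\<not> bad h a y"
proof
  assume bad: "bad h a y"
  from Gd_open[OF assms(2)] obtain N where N: "\<forall>h'\<in>cone h N. Gd b h' D E" by blast
  obtain h' where h': "h' \<in> cone h (max N (Suc (max a y)))" "\<not> target V GL GR X Z h'"
    using avoid[OF assms(1)] by blast
  have "bad h' a y" using bad h'(1) by (rule bad_cone) auto
  moreover have "h' \<in> cone h N" using h'(1) by (auto simp: cone_def)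
  then have "good V b h' D E" using N Gd_good cone_stable by blast
  ultimately have "target V GL GR X Z h'" unfolding target_def using assms by blast
  with h'(2) show False ..
qed

lemma undefeated:
  assumes "h \<in> C" "Gd b h D E" "finite D" "finite E" "D \<subseteq> X" "E \<subseteq> Z"
    "X' \<subseteq> X" "infinite X'" "Z' \<subseteq> Z" "infinite Z'"
  obtains L R where "L \<subseteq> X'" "infinite L" "R \<subseteq> Z'" "infinite R"
    "infinite (GL b (D \<union> L) (E \<union> R))" "infinite (GR b (D \<union> L) (E \<union> R))"
proof -
  from Gd_open[OF assms(2)] obtain N where N: "\<forall>h'\<in>cone h N. Gd b h' D E" by blast
  obtain h' where h': "h' \<in> cone h N" "\<not> target V GL GR X Z h'"
    using avoid[OF assms(1)] by blast
  have g: "good V b h' D E" using N h'(1) Gd_good cone_stable by blast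
  have "\<not> defeated (GL b) (GR b) D E X' Z'"
  proof
    assume d: "defeated (GL b) (GR b) D E X' Z'"
    have "target V GL GR X Z h'" unfolding target_def
      by (intro exI[of _ b] exI[of _ D] exI[of _ E] conjI disjI2 exI[of _ X'] exI[of _ Z'] assms g d)
    with h'(2) show False ..
  qed
  then show thesis unfolding defeated_def using that by blast
qed

subsection \<open>Worlds\<close>

text \<open>The last four clauses list the refinements that the arguments need: coloring an x,
  fixing the limit of a row, admitting a right element, and making (a,y) bad for all late y. The
  bound \<open>n \<le> a\<close> keeps row a outside the rows fixed by \<open>C\<close>, so that one
  of its entries may be flipped.\<close>

definition world :: "coloring set set \<Rightarrow> bool" where
  "world W \<longleftrightarrow> (\<forall>B\<in>W. B \<noteq> {} \<and> B \<subseteq> C \<and> row_open B \<and>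
     (\<forall>x. \<exists>b. \<exists>B'\<in>W. B' \<subseteq> B \<and> (\<forall>h\<in>B'. Gd b h {x} {})) \<and>
     (\<forall>a. \<exists>l. \<exists>B'\<in>W. B' \<subseteq> B \<and> (\<forall>h\<in>B'. lims h a l)) \<and>
     (\<forall>b D E h z. finite D \<longrightarrow> (\<forall>h\<in>B. Gd b h D E) \<longrightarrow> h \<in> B \<longrightarrow> Gd b h D (insert z E) \<longrightarrow>
        (\<exists>B'\<in>W. B' \<subseteq> B \<and> (\<forall>h\<in>B'. Gd b h D (insert z E)))) \<and>
     (\<forall>a l. n \<le> a \<longrightarrow> (\<forall>h\<in>B. lims h a l) \<longrightarrow> (\<exists>N. \<forall>y\<ge>N. \<exists>B'\<in>W. B' \<subseteq> B \<and> (\<forall>h\<in>B'. bad h a y))))"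

lemma
  assumes "world W" "B \<in> W"
  shows world_ne: "B \<noteq> {}" and world_C: "B \<subseteq> C" and world_row_open: "row_open B"
    and world_split: "\<exists>b. \<exists>B'\<in>W. B' \<subseteq> B \<and> (\<forall>h\<in>B'. Gd b h {x} {})"
    and world_lims: "\<exists>l. \<exists>B'\<in>W. B' \<subseteq> B \<and> (\<forall>h\<in>B'. lims h a l)"
    and world_z: "\<lbrakk>finite D; \<forall>h\<in>B. Gd b h D E; h \<in> B; Gd b h D (insert z E)\<rbrakk> \<Longrightarrow>
        \<exists>B'\<in>W. B' \<subseteq> B \<and> (\<forall>h\<in>B'. Gd b h D (insert z E))"
    and world_bad: "\<lbrakk>n \<le> a; \<forall>h\<in>B. lims h a l\<rbrakk> \<Longrightarrow> \<exists>N. \<forall>y\<ge>N. \<exists>B'\<in>W. B' \<subseteq> B \<and> (\<forall>h\<in>B'. bad h a y)"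
proof -
  note w = assms(1)[unfolded world_def, THEN bspec, OF assms(2)]
  note w' = w[THEN conjunct2, THEN conjunct2, THEN conjunct2]
  show "B \<noteq> {}" by (rule w[THEN conjunct1])
  show "B \<subseteq> C" by (rule w[THEN conjunct2, THEN conjunct1])
  show "row_open B" by (rule w[THEN conjunct2, THEN conjunct2, THEN conjunct1])
  show "\<exists>b. \<exists>B'\<in>W. B' \<subseteq> B \<and> (\<forall>h\<in>B'. Gd b h {x} {})"
    by (rule w'[THEN conjunct1, rule_format])
  show "\<exists>l. \<exists>B'\<in>W. B' \<subseteq> B \<and> (\<forall>h\<in>B'. lims h a l)"
    by (rule w'[THEN conjunct2, THEN conjunct1, rule_format])
  show "\<lbrakk>finite D; \<forall>h\<in>B. Gd b h D E; h \<in> B; Gd b h D (insert z E)\<rbrakk> \<Longrightarrow>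
        \<exists>B'\<in>W. B' \<subseteq> B \<and> (\<forall>h\<in>B'. Gd b h D (insert z E))"
    by (rule w'[THEN conjunct2, THEN conjunct2, THEN conjunct1, rule_format]) auto
  show "\<lbrakk>n \<le> a; \<forall>h\<in>B. lims h a l\<rbrakk> \<Longrightarrow> \<exists>N. \<forall>y\<ge>N. \<exists>B'\<in>W. B' \<subseteq> B \<and> (\<forall>h\<in>B'. bad h a y)"
    by (rule w'[THEN conjunct2, THEN conjunct2, THEN conjunct2, rule_format]) auto
qed

lemma world_restrict:
  assumes "world W" shows "world {B \<in> W. B \<subseteq> B0}"
  unfolding world_def
proof (intro ballI conjI allI impI)
  fix B assume "B \<in> {B \<in> W. B \<subseteq> B0}"
  then have B: "B \<in> W" "B \<subseteq> B0" by auto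
  show "B \<noteq> {}" "B \<subseteq> C" "row_open B" using world_ne world_C world_row_open assms B by blast+
  show "\<exists>b. \<exists>B'\<in>{B \<in> W. B \<subseteq> B0}. B' \<subseteq> B \<and> (\<forall>h\<in>B'. Gd b h {x} {})" for x
    using world_split[OF assms B(1), of x] B(2) by blast
  show "\<exists>l. \<exists>B'\<in>{B \<in> W. B \<subseteq> B0}. B' \<subseteq> B \<and> (\<forall>h\<in>B'. lims h a l)" for a
    using world_lims[OF assms B(1), of a] B(2) by blast
  show "\<exists>B'\<in>{B \<in> W. B \<subseteq> B0}. B' \<subseteq> B \<and> (\<forall>h\<in>B'. Gd b h D (insert z E))"
    if "finite D" "\<forall>h\<in>B. Gd b h D E" "h \<in> B" "Gd b h D (insert z E)" for b D E h z
    using world_z[OF assms B(1) that] B(2) by blast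
  show "\<exists>N. \<forall>y\<ge>N. \<exists>B'\<in>{B \<in> W. B \<subseteq> B0}. B' \<subseteq> B \<and> (\<forall>h\<in>B'. bad h a y)"
    if al: "n \<le> a" "\<forall>h\<in>B. lims h a l" for a l
  proof -
    obtain N where N: "\<forall>y\<ge>N. \<exists>B'\<in>W. B' \<subseteq> B \<and> (\<forall>h\<in>B'. bad h a y)"
      using world_bad[OF assms B(1) al] by blast
    have "\<exists>B'\<in>{B \<in> W. B \<subseteq> B0}. B' \<subseteq> B \<and> (\<forall>h\<in>B'. bad h a y)" if "y \<ge> N" for y
      using N[rule_format, OF that] B(2) by blast
    then show ?thesis by blast
  qed
qed

definition open_world :: "coloring set set" where
  "open_world = {B. B \<noteq> {} \<and> B \<subseteq> C \<and> row_open B}"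

lemma open_worldI: "h \<in> B \<Longrightarrow> B \<subseteq> C \<Longrightarrow> row_open B \<Longrightarrow> B \<in> open_world"
  unfolding open_world_def by auto

lemma world_open_world: "world open_world"
  unfolding world_def
proof (intro ballI conjI allI impI)
  fix B assume "B \<in> open_world"
  then have B: "B \<noteq> {}" "B \<subseteq> C" "row_open B" by (auto simp: open_world_def)
  show "B \<noteq> {}" "B \<subseteq> C" "row_open B" by fact+
  obtain h0 where h0: "h0 \<in> B" using B by blast
  show "\<exists>b. \<exists>B'\<in>open_world. B' \<subseteq> B \<and> (\<forall>h\<in>B'. Gd b h {x} {})" for x
  proof -
    obtain N where "cone h0 N \<subseteq> B" using B(3) h0 unfolding row_open_def by blast
    moreover obtain h b where h: "h \<in> cone h0 N" "Gd b h {x} {}" using color_dense h0 B(2) by blast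
    ultimately have "h \<in> {h \<in> B. Gd b h {x} {}}" by auto
    then have "{h \<in> B. Gd b h {x} {}} \<in> open_world"
      by (rule open_worldI[OF _ _ row_open_Gd[OF B(3)]]) (use B(2) in blast)
    then show ?thesis by (intro exI[of _ b] bexI[of _ "{h \<in> B. Gd b h {x} {}}"]) auto
  qed
  show "\<exists>l. \<exists>B'\<in>open_world. B' \<subseteq> B \<and> (\<forall>h\<in>B'. lims h a l)" for a
  proof -
    obtain l where "lims h0 a l" using lims_exists h0 B(2) C_stable by blast
    then have "h0 \<in> {h \<in> B. lims h a l}" using h0 by simp
    then have "{h \<in> B. lims h a l} \<in> open_world"
      by (rule open_worldI[OF _ _ row_open_lims[OF B(3)]]) (use B(2) in blast)
    then show ?thesis by (intro exI[of _ l] bexI[of _ "{h \<in> B. lims h a l}"]) auto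
  qed
  show "\<exists>B'\<in>open_world. B' \<subseteq> B \<and> (\<forall>h\<in>B'. Gd b h D (insert z E))"
    if "finite D" "\<forall>h\<in>B. Gd b h D E" "h \<in> B" "Gd b h D (insert z E)" for b D E h z
  proof -
    from that have "h \<in> {h \<in> B. Gd b h D (insert z E)}" by simp
    then have "{h \<in> B. Gd b h D (insert z E)} \<in> open_world"
      by (rule open_worldI[OF _ _ row_open_Gd[OF B(3)]]) (use B(2) in blast)
    then show ?thesis by (intro bexI[of _ "{h \<in> B. Gd b h D (insert z E)}"]) auto
  qed
  show "\<exists>N. \<forall>y\<ge>N. \<exists>B'\<in>open_world. B' \<subseteq> B \<and> (\<forall>h\<in>B'. bad h a y)"
    if "n \<le> a" and l: "\<forall>h\<in>B. lims h a l" for a l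
  proof -
    obtain N where N: "cone h0 N \<subseteq> B" using B(3) h0 unfolding row_open_def by blast
    have "\<exists>B'\<in>open_world. B' \<subseteq> B \<and> (\<forall>h\<in>B'. bad h a y)" if y: "y \<ge> max N (Suc a)" for y
    proof -
      \<comment> \<open>Row y lies beyond the N rows that keep \<open>h0\<close> inside B, so its
        limit can be made opposite to that of row a.\<close>
      define h1 where "h1 = h0(y := \<lambda>_. \<not> l)"
      have st: "stable h1" using stable_upd_row h0 B(2) C_stable unfolding h1_def by blast
      have c: "h1 \<in> cone h0 N" using st y by (auto simp: cone_def h1_def)
      have sub: "cone h1 (Suc y) \<subseteq> cone h0 N" using cone_trans[OF c, of "Suc y"] y by simp
      have "bad h a y" if "h \<in> cone h1 (Suc y)" for h
      proof -
        have "lims h a l" using sub N l that by blast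
        moreover have "h y = (\<lambda>_. \<not> l)" using that by (simp add: cone_def h1_def)
        then have "lims h y (\<not> l)" by (simp add: lims_def)
        moreover have "False" if "lims h a l'" "lims h y l'" for l'
          using lims_unique[OF \<open>lims h a l\<close> that(1)] lims_unique[OF \<open>lims h y (\<not> l)\<close> that(2)] by simp
        moreover have "a \<noteq> y" using y by auto
        ultimately show ?thesis unfolding bad_def by blast
      qed
      moreover have "cone h1 (Suc y) \<in> open_world"
        by (rule open_worldI[OF cone_self[OF st] _ row_open_cone]) (use sub N B(2) in blast)
      ultimately show ?thesis using sub N by (intro bexI[of _ "cone h1 (Suc y)"]) auto
    qed
    then show ?thesis by blast
  qed
qed

text \<open>The second world consists of the open sets that stay dense below some finite piece of
  information about a coloring. A property holding on such a set can be restored after any finite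
  tampering with a coloring beyond that piece.\<close>
definition dense_world :: "coloring set set" where
  "dense_world = {B. B \<subseteq> C \<and> row_open B \<and> (\<exists>h M. h \<in> C \<and> B \<subseteq> sq h M \<and>
     (\<forall>h'\<in>C \<inter> sq h M. \<forall>M'. B \<inter> sq h' M' \<noteq> {}))}"

lemma C_dense_world: "C \<in> dense_world"
proof -
  have "f \<in> C" using stable_f by (rule cone_self)
  moreover have "C \<subseteq> sq f 0" by (simp add: sq_def)
  moreover have "C \<inter> sq h' M' \<noteq> {}" if "h' \<in> C" for h' M' using that sq_self by blast
  ultimately show ?thesis using row_open_cone unfolding dense_world_def by blast
qed

lemma dense_world_sub:
  assumes B: "B \<subseteq> C" "row_open B" "B \<subseteq> sq h M" "\<forall>h'\<in>C \<inter> sq h M. \<forall>M'. B \<inter> sq h' M' \<noteq> {}"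
    and h': "h' \<in> C" "h' \<in> sq h M" "M \<le> M'"
  shows "B \<inter> sq h' M' \<in> dense_world"
proof -
  have "row_open (B \<inter> sq h' M')" using row_open_Int[OF B(2) row_open_sq] by simp
  moreover have "B \<inter> sq h' M' \<inter> sq h'' M'' \<noteq> {}" if "h'' \<in> C \<inter> sq h' M'" for h'' M''
  proof -
    have "sq h' M' \<subseteq> sq h M" using sq_trans[OF h'(2,3)] .
    then have "B \<inter> sq h'' (max M' M'') \<noteq> {}" using B(4) that by blast
    moreover have "sq h'' (max M' M'') \<subseteq> sq h'' M''" by (auto simp: sq_def)
    moreover have "sq h'' (max M' M'') \<subseteq> sq h' M'" using that by (intro sq_trans) auto
    ultimately show ?thesis by blast
  qed
  ultimately show ?thesis using B(1) h'(1) unfolding dense_world_def by blast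
qed

lemma dense_world_ne: "B \<in> dense_world \<Longrightarrow> B \<noteq> {}"
  unfolding dense_world_def using sq_self by blast

text \<open>Either \<open>B1\<close> is dense below the square belonging to B, or it misses a
  smaller square. In the second case a member of B found in any finite piece below that smaller
  square can be moved within a cone into \<open>B1 \<union> B2\<close> without leaving the piece, so
  \<open>B2\<close> is dense there.\<close>

lemma dense_world_choose:
  assumes B: "B \<in> dense_world" and op: "row_open B1" "row_open B2" and sub: "B1 \<subseteq> B" "B2 \<subseteq> B"
    and dense: "\<And>h N. h \<in> B \<Longrightarrow> cone h N \<inter> (B1 \<union> B2) \<noteq> {}"
  shows "\<exists>B'\<in>dense_world. B' \<subseteq> B1 \<or> B' \<subseteq> B2"
proof -
  obtain h M where h: "h \<in> C" "B \<subseteq> sq h M" "\<forall>h'\<in>C \<inter> sq h M. \<forall>M'. B \<inter> sq h' M' \<noteq> {}" and BC: "B \<subseteq> C" "row_open B"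
    using B unfolding dense_world_def by blast
  show ?thesis
  proof (cases "\<forall>h'\<in>C \<inter> sq h M. \<forall>M'. B1 \<inter> sq h' M' \<noteq> {}")
    case True
    then have "B1 \<in> dense_world" using op(1) sub(1) BC(1) h(1,2) unfolding dense_world_def by blast
    then show ?thesis by blast
  next
    case False
    then obtain h1 M1' where h1: "h1 \<in> C" "h1 \<in> sq h M" "B1 \<inter> sq h1 M1' = {}" by blast
    define M1 where "M1 = max M M1'"
    have "sq h1 M1 \<subseteq> sq h1 M1'" by (auto simp: sq_def M1_def)
    with h1(3) have e: "B1 \<inter> sq h1 M1 = {}" by blast
    have s1: "sq h1 M1 \<subseteq> sq h M" using sq_trans[OF h1(2), of M1] by (simp add: M1_def)
    have "B2 \<inter> sq h1 M1 \<inter> sq h2 M2 \<noteq> {}" if h2: "h2 \<in> C \<inter> sq h1 M1" for h2 M2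
    proof -
      have a: "sq h2 (max M1 M2) \<subseteq> sq h1 M1" using h2 by (intro sq_trans) auto
      have b: "sq h2 (max M1 M2) \<subseteq> sq h2 M2" by (auto simp: sq_def)
      obtain h3 where h3: "h3 \<in> B" "h3 \<in> sq h2 (max M1 M2)" using h(3) h2 s1 by blast
      obtain h4 where h4: "h4 \<in> cone h3 (max M1 M2)" "h4 \<in> B1 \<union> B2" using dense[OF h3(1)] by blast
      have "h4 \<in> sq h2 (max M1 M2)" using cone_sq[OF h3(2)] h4(1) by blast
      then show ?thesis using a b e h4(2) by blast
    qed
    moreover have "row_open (B2 \<inter> sq h1 M1)" using row_open_Int[OF op(2) row_open_sq] by simp
    ultimately have "B2 \<inter> sq h1 M1 \<in> dense_world" using h1(1) sub(2) BC(1) unfolding dense_world_def by blast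
    then show ?thesis by blast
  qed
qed

lemma dense_world_choose_pred:
  assumes B: "B \<in> dense_world" and op: "\<And>b. row_open {h \<in> B. Q b h}"
    and dense: "\<And>h N. h \<in> B \<Longrightarrow> \<exists>h'\<in>cone h N. h' \<in> B \<and> (\<exists>b. Q b h')"
  shows "\<exists>b :: bool. \<exists>B'\<in>dense_world. B' \<subseteq> B \<and> (\<forall>h\<in>B'. Q b h)"
proof -
  have "\<exists>B'\<in>dense_world. B' \<subseteq> {h \<in> B. Q False h} \<or> B' \<subseteq> {h \<in> B. Q True h}"
  proof (rule dense_world_choose[OF B op op])
    fix h N assume "h \<in> B"
    then obtain h' b where h': "h' \<in> cone h N" "h' \<in> B" "Q b h'" using dense by blast
    then have "h' \<in> {h \<in> B. Q False h} \<union> {h \<in> B. Q True h}" by (cases b) auto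
    with h'(1) show "cone h N \<inter> ({h \<in> B. Q False h} \<union> {h \<in> B. Q True h}) \<noteq> {}" by blast
  qed auto
  then obtain B' where B': "B' \<in> dense_world" "B' \<subseteq> {h \<in> B. Q False h} \<or> B' \<subseteq> {h \<in> B. Q True h}" by blast
  from B'(2) show ?thesis
  proof
    assume "B' \<subseteq> {h \<in> B. Q False h}"
    then show ?thesis using B'(1) by (intro exI[of _ False] bexI[of _ B']) auto
  next
    assume "B' \<subseteq> {h \<in> B. Q True h}"
    then show ?thesis using B'(1) by (intro exI[of _ True] bexI[of _ B']) auto
  qed
qed

text \<open>Convergence is obtained for one x after another; a value once computed rests on a square
  and is therefore kept by all later cones.\<close>

lemma converge_all:
  assumes "finite D"
  shows "h \<in> C \<Longrightarrow> n \<le> N \<Longrightarrow> \<exists>h'\<in>cone h N. \<forall>x\<in>D. x < z \<longrightarrow> (\<exists>b. V h' x z b)"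
  using assms
proof (induction D arbitrary: h N)
  case empty
  then show ?case using cone_self C_stable by blast
next
  case (insert x D)
  have "\<exists>h1\<in>cone h N. \<exists>M. \<forall>h'\<in>cone h1 M. x < z \<longrightarrow> (\<exists>b. V h' x z b)"
  proof (cases "x < z")
    case True
    then obtain h1 b where h1: "h1 \<in> cone h N" "V h1 x z b" using total_dense insert.prems by blast
    with V_cont obtain M where "\<forall>h'\<in>sq h1 M. V h' x z b" by blast
    then show ?thesis using h1 cone_sq[OF sq_self] by blast
  next
    case False
    then show ?thesis using cone_self C_stable insert.prems by blast
  qed
  then obtain h1 M where h1: "h1 \<in> cone h N" "\<And>h'. h'\<in>cone h1 M \<Longrightarrow> x < z \<Longrightarrow> \<exists>b. V h' x z b" by blast
  have "h1 \<in> C" using cone_trans[OF insert.prems(1,2)] h1 by blast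
  moreover have "n \<le> max N M" using insert.prems(2) by simp
  ultimately obtain h2 where h2: "h2 \<in> cone h1 (max N M)" "\<forall>x\<in>D. x < z \<longrightarrow> (\<exists>b. V h2 x z b)"
    using insert.IH[of h1 "max N M"] by blast
  have "h2 \<in> cone h1 M" using h2(1) by (auto simp: cone_def)
  moreover have "h2 \<in> cone h N" using cone_trans[OF h1(1), of "max N M"] h2(1) by auto
  ultimately show ?case using h1(2)[of h2] h2(2) by blast
qed

lemma V_sq_all:
  assumes "finite D" "\<forall>x\<in>D. x < z \<longrightarrow> V h x z b"
  shows "\<exists>M. \<forall>h'\<in>sq h M. \<forall>x\<in>D. x < z \<longrightarrow> V h' x z b"
  using assms
proof (induction D)
  case (insert x D)
  then obtain M where M: "\<forall>h'\<in>sq h M. \<forall>x\<in>D. x < z \<longrightarrow> V h' x z b" by blast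
  obtain M' where M': "x < z \<longrightarrow> (\<forall>h'\<in>sq h M'. V h' x z b)" using V_cont insert.prems by blast
  have "sq h (max M M') \<subseteq> sq h M" "sq h (max M M') \<subseteq> sq h M'" by (auto simp: sq_def)
  then have "\<forall>h'\<in>sq h (max M M'). \<forall>w\<in>insert x D. w < z \<longrightarrow> V h' w z b" using M M' by blast
  then show ?case by blast
qed simp

text \<open>The flipped entries are finite information, and density restores everything else.\<close>
lemma dense_world_flip:
  assumes B: "B \<in> dense_world" and a: "n \<le> a0" "n \<le> a1"
  shows "\<exists>N. \<forall>y0 y1. y0 \<ge> N \<longrightarrow> y1 \<ge> N \<longrightarrow> ((a0, y0) = (a1, y1) \<longrightarrow> c0 = c1) \<longrightarrow>
    (\<exists>B'\<in>dense_world. B' \<subseteq> B \<and> a0 < y0 \<and> a1 < y1 \<and> (\<forall>h\<in>B'. h a0 y0 = c0 \<and> h a1 y1 = c1))"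
proof -
  obtain h M where h: "h \<in> C" "B \<subseteq> sq h M" "\<forall>h'\<in>C \<inter> sq h M. \<forall>M'. B \<inter> sq h' M' \<noteq> {}" and BC: "B \<subseteq> C" "row_open B"
    using B unfolding dense_world_def by blast
  have "\<exists>B'\<in>dense_world. B' \<subseteq> B \<and> a0 < y0 \<and> a1 < y1 \<and> (\<forall>h\<in>B'. h a0 y0 = c0 \<and> h a1 y1 = c1)"
    if y: "y0 \<ge> max M (Suc (max a0 a1))" "y1 \<ge> max M (Suc (max a0 a1))" "(a0, y0) = (a1, y1) \<longrightarrow> c0 = c1" for y0 y1
  proof -
    define h1 where "h1 = h(a0 := (h a0)(y0 := c0))"
    define h2 where "h2 = h1(a1 := (h1 a1)(y1 := c1))"
    have "stable h2" unfolding h2_def h1_def using h(1) C_stable by (intro stable_upd_pt) blast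
    \<comment> \<open>Rows below n are untouched since both \<open>a0\<close> and \<open>a1\<close>
      are at least n, and the square of size M is untouched since both columns are at least
      M.\<close>
    then have c: "h2 \<in> C" using h(1) a by (auto simp: cone_def h2_def h1_def)
    have s: "h2 \<in> sq h M" using y by (auto simp: sq_def h2_def h1_def)
    have v: "h2 a0 y0 = c0" "h2 a1 y1 = c1" using y(3) by (auto simp: h2_def h1_def)
    let ?B = "B \<inter> sq h2 (Suc (max y0 y1))"
    have "?B \<in> dense_world" using dense_world_sub[OF BC h(2,3) c s] y by auto
    moreover have "\<forall>h\<in>?B. h a0 y0 = c0 \<and> h a1 y1 = c1" using v y by (auto simp: sq_def)
    moreover have "a0 < y0" "a1 < y1" using y by auto
    moreover have "?B \<subseteq> B" by (rule Int_lower1)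
    ultimately show ?thesis by (intro bexI[of _ ?B] conjI)
  qed
  then show ?thesis by (intro exI[of _ "max M (Suc (max a0 a1))"] allI impI)
qed

lemma bad_flip: "lims h a l \<Longrightarrow> a < y \<Longrightarrow> h a y = (\<not> l) \<Longrightarrow> bad h a y"
  unfolding bad_def by (auto simp: min_def max_def dest: lims_unique)

lemma world_dense_world: "world dense_world"
  unfolding world_def
proof (intro ballI conjI allI impI)
  fix B assume B: "B \<in> dense_world"
  then have BC: "B \<subseteq> C" "row_open B" by (auto simp: dense_world_def)
  show "B \<noteq> {}" using B by (rule dense_world_ne)
  show "B \<subseteq> C" "row_open B" by fact+
  show "\<exists>b. \<exists>B'\<in>dense_world. B' \<subseteq> B \<and> (\<forall>h\<in>B'. Gd b h {x} {})" for x
  proof (rule dense_world_choose_pred[OF B row_open_Gd[OF BC(2)]])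
    fix h N assume h: "h \<in> B"
    then obtain M where M: "M \<ge> N" "cone h M \<subseteq> B" using row_openD[OF BC(2)] by blast
    have "h \<in> C" using h BC(1) by blast
    from color_dense[OF this, of M x] obtain h' b where h': "h' \<in> cone h M" "Gd b h' {x} {}" by blast
    have "h' \<in> cone h N" using h'(1) M(1) by (auto simp: cone_def)
    moreover have "h' \<in> B" using h'(1) M(2) by blast
    ultimately show "\<exists>h'\<in>cone h N. h' \<in> B \<and> (\<exists>b. Gd b h' {x} {})" using h'(2)
      by (intro bexI[of _ h'] conjI exI[of _ b])
  qed
  show "\<exists>l. \<exists>B'\<in>dense_world. B' \<subseteq> B \<and> (\<forall>h\<in>B'. lims h a l)" for a
  proof (rule dense_world_choose_pred[OF B row_open_lims[OF BC(2)]])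
    fix h N assume h: "h \<in> B"
    then have st: "stable h" using BC C_stable by blast
    then obtain l where "lims h a l" using lims_exists by blast
    then show "\<exists>h'\<in>cone h N. h' \<in> B \<and> (\<exists>l. lims h' a l)" using cone_self[OF st] h
      by (intro bexI[of _ h] conjI exI[of _ l])
  qed
  obtain h M where h: "h \<in> C" "B \<subseteq> sq h M" "\<forall>h'\<in>C \<inter> sq h M. \<forall>M'. B \<inter> sq h' M' \<noteq> {}"
    using B unfolding dense_world_def by blast
  show "\<exists>B'\<in>dense_world. B' \<subseteq> B \<and> (\<forall>h\<in>B'. Gd b h D (insert z E))"
    if D: "finite D" and G: "\<forall>h\<in>B. Gd b h D E" and h1: "h1 \<in> B" "Gd b h1 D (insert z E)" for b D E h1 z
  proof -
    obtain N1 where N1: "\<forall>h'\<in>cone h1 N1. Gd b h' D (insert z E)" using Gd_open[OF h1(2)] by blast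
    obtain N where N: "N \<ge> max n N1" "cone h1 N \<subseteq> B" using row_openD[OF BC(2) h1(1)] by blast
    \<comment> \<open>That no wrong color appears at z on a cone is not finite information, but a
      computed color is. So the values at z are made to converge; the lock forces them to be b, and
      a square around \<open>h2\<close> then excludes the opposite value by determinism of
      V.\<close>
    obtain h2 where h2: "h2 \<in> cone h1 N" "\<forall>x\<in>D. x < z \<longrightarrow> (\<exists>b. V h2 x z b)"
      using converge_all[OF D, of h1 N z] h1(1) BC(1) N(1) by auto
    have "h2 \<in> cone h1 N1" using h2(1) N(1) by (auto simp: cone_def)
    then have "good V b h2 D (insert z E)" using N1 Gd_good cone_stable by blast
    then have "\<forall>x\<in>D. \<not> V h2 x z (\<not> b)" unfolding good_def by blast
    then have nV: "\<not> V h2 x z (\<not> b)" if "x \<in> D" for x using that by blast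
    have "\<forall>x\<in>D. x < z \<longrightarrow> V h2 x z b"
    proof (intro ballI impI)
      fix x assume x: "x \<in> D" "x < z"
      then obtain b' where b': "V h2 x z b'" using h2(2) by blast
      with nV[OF x(1)] have "b' = b" by (cases b; cases b') auto
      with b' show "V h2 x z b" by simp
    qed
    then obtain M2 where M2: "\<forall>h'\<in>sq h2 M2. \<forall>x\<in>D. x < z \<longrightarrow> V h' x z b" using V_sq_all[OF D] by blast
    have h2B: "h2 \<in> B" using h2(1) N(2) by blast
    define M3 where "M3 = max M M2"
    have fw: "B \<inter> sq h2 M3 \<in> dense_world" by (rule dense_world_sub[OF BC h(2,3)]) (use h2B BC h(2) in \<open>auto simp: M3_def\<close>)
    have "Gd b h3 D (insert z E)" if h3: "h3 \<in> B \<inter> sq h2 M3" for h3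
    proof -
      have "Gd b h3 D E" using G h3 by blast
      then obtain N4 m4 where 4: "\<And>h' x u. h' \<in> cone h3 N4 \<Longrightarrow> x \<in> D \<Longrightarrow> u \<ge> m4 \<Longrightarrow> \<not> V h' x u (\<not> b)"
        "\<And>h' x r. h' \<in> cone h3 N4 \<Longrightarrow> x \<in> D \<Longrightarrow> r \<in> E \<Longrightarrow> \<not> V h' x r (\<not> b)" by (rule GdE) blast
      have c: "cone h3 (max N4 M3) \<subseteq> cone h3 N4" by (auto simp: cone_def)
      have c2: "cone h3 (max N4 M3) \<subseteq> sq h2 M2" using h3 by (auto simp: cone_def sq_def M3_def)
      show ?thesis
      proof (rule GdI[of h3 "max N4 M3" _ m4])
        show "\<not> V h' x u (\<not> b)" if "h' \<in> cone h3 (max N4 M3)" "x \<in> D" "m4 \<le> u" for h' x u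
          using that 4(1) c by blast
        show "\<not> V h' x r (\<not> b)" if "h' \<in> cone h3 (max N4 M3)" "x \<in> D" "r \<in> insert z E" for h' x r
        proof (cases "r \<in> E")
          case True
          then show ?thesis using that 4(2) c by blast
        next
          case False
          then have r: "r = z" using that by blast
          show ?thesis
          proof
            assume v: "V h' x r (\<not> b)"
            then have "V h' x z b" using V_less[OF v] M2 c2 that r by blast
            with v r show False using V_det by blast
          qed
        qed
      qed
    qed
    with fw show ?thesis by (intro bexI[of _ "B \<inter> sq h2 M3"]) auto
  qed
  show "\<exists>N. \<forall>y\<ge>N. \<exists>B'\<in>dense_world. B' \<subseteq> B \<and> (\<forall>h\<in>B'. bad h a y)"
    if a: "n \<le> a" and l: "\<forall>h\<in>B. lims h a l" for a l
  proof -
    from dense_world_flip[OF B a a, of "\<not> l" "\<not> l"] obtain N where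
      N0: "\<forall>y0 y1. N \<le> y0 \<longrightarrow> N \<le> y1 \<longrightarrow> ((a, y0) = (a, y1) \<longrightarrow> (\<not> l) = (\<not> l)) \<longrightarrow>
        (\<exists>B'\<in>dense_world. B' \<subseteq> B \<and> a < y0 \<and> a < y1 \<and> (\<forall>h\<in>B'. h a y0 = (\<not> l) \<and> h a y1 = (\<not> l)))"
      by (elim exE) (rule that)
    have N: "\<exists>B'\<in>dense_world. B' \<subseteq> B \<and> a < y \<and> (\<forall>h\<in>B'. h a y = (\<not> l))" if "y \<ge> N" for y
    proof -
      from N0[rule_format, OF that that] obtain B' where "B' \<in> dense_world" "B' \<subseteq> B" "a < y" "\<forall>h\<in>B'. h a y = (\<not> l)"
        by auto
      then show ?thesis by (intro bexI[of _ B'] conjI)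
    qed
    have "\<exists>B'\<in>dense_world. B' \<subseteq> B \<and> (\<forall>h\<in>B'. bad h a y)" if y: "y \<ge> N" for y
    proof -
      from N[OF y] obtain B' where B': "B' \<in> dense_world" "B' \<subseteq> B" "a < y" "\<forall>h\<in>B'. h a y = (\<not> l)" by auto
      have "bad h a y" if "h \<in> B'" for h
        by (rule bad_flip[of h a l]) (use B' l that in blast)+
      with B' show ?thesis by (intro bexI[of _ B'] conjI ballI)
    qed
    then show ?thesis by (intro exI[of _ N] allI impI)
  qed
qed

section \<open>Extending finite conditions inside a world\<close>

definition regular :: "bool \<Rightarrow> coloring set \<Rightarrow> nat set \<Rightarrow> nat set \<Rightarrow> bool" where
  "regular b B D E \<longleftrightarrow> finite D \<and> finite E \<and> (\<forall>h\<in>B. Gd b h D E)"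

text \<open>Availability lets left elements of color b be added forever. If it fails, there are a
  member of W and an infinite set whose elements can only receive the other color below that
  member.\<close>

definition available :: "coloring set set \<Rightarrow> bool \<Rightarrow> nat set \<Rightarrow> bool" where
  "available W b X1 \<longleftrightarrow> (\<forall>B\<in>W. \<forall>X'. X' \<subseteq> X1 \<longrightarrow> infinite X' \<longrightarrow>
     (\<exists>x\<in>X'. \<exists>B'\<in>W. B' \<subseteq> B \<and> (\<forall>h\<in>B'. Gd b h {x} {})))"

lemma regular_sub: "regular b B D E \<Longrightarrow> B' \<subseteq> B \<Longrightarrow> D' \<subseteq> D \<Longrightarrow> E' \<subseteq> E \<Longrightarrow> regular b B' D' E'"
  unfolding regular_def using Gd_mono by (meson finite_subset subsetD)

lemma regular_insert:
  assumes "regular b B D E" "\<And>h. h \<in> B \<Longrightarrow> Gd b h {x} {}" "\<And>r. r \<in> E \<Longrightarrow> r \<le> x"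
  shows "regular b B (insert x D) E"
  unfolding regular_def
proof (intro conjI ballI)
  show "finite (insert x D)" "finite E" using assms(1) by (simp_all add: regular_def)
  fix h assume h: "h \<in> B"
  then have "Gd b h D E" using assms(1) by (simp add: regular_def)
  then show "Gd b h (insert x D) E" using assms(2)[OF h] assms(3) by (rule Gd_insert)
qed

lemma x_step:
  assumes "world W" "available W b X1" "B \<in> W" "regular b B D E" "X' \<subseteq> X1" "infinite X'"
  obtains x B' where "x \<in> X'" "\<forall>r\<in>D \<union> E. r < x" "B' \<in> W" "B' \<subseteq> B" "regular b B' (insert x D) E"
proof -
  have fin: "finite (D \<union> E)" using assms(4) by (simp add: regular_def)
  then obtain m where m: "\<forall>r\<in>D \<union> E. r < m" using above_finite by blast
  have "X' \<inter> {m..} \<subseteq> X1" using assms(5) by blast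
  from assms(2)[unfolded available_def, rule_format, OF assms(3) this infinite_Int_atLeast[OF assms(6)]]
  obtain x B' where x: "x \<in> X' \<inter> {m..}" "B' \<in> W" "B' \<subseteq> B" "\<forall>h\<in>B'. Gd b h {x} {}" by (elim bexE conjE) (rule that)
  have "m \<le> x" using x(1) by simp
  then have less: "\<forall>r\<in>D \<union> E. r < x" using m less_le_trans by blast
  have le: "r \<le> x" if "r \<in> E" for r using less that by (simp add: less_imp_le)
  have "regular b B' (insert x D) E"
    by (rule regular_insert[OF regular_sub[OF assms(4) x(3) order_refl order_refl]]) (use x(4) le in blast)+
  from that[OF _ less x(2,3) this] x(1) show ?thesis by blast
qed

lemma z_step:
  assumes "world W" "B \<in> W" "regular b B D E" "h \<in> B" "Gd b h D (insert z E)"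
  obtains B' where "B' \<in> W" "B' \<subseteq> B" "regular b B' D (insert z E)"
proof -
  have "finite D" "\<forall>h\<in>B. Gd b h D E" "finite E" using assms(3) by (simp_all add: regular_def)
  from world_z[OF assms(1,2) this(1,2) assms(4,5)] this(1,3) show ?thesis
    using that by (auto simp: regular_def)
qed

text \<open>No single member of W has to handle the infinite sets; every pair of finite parts is
  realised on some smaller member. That suffices because an enumeration looks at finite parts
  only.\<close>

lemma seq:
  assumes W: "world W" and av: "available W b X1" and B: "B \<in> W" "regular b B D E"
    and X': "X' \<subseteq> X1" "infinite X'" and Z': "infinite Z'"
  obtains X'' Z'' where "X'' \<subseteq> X'" "infinite X''" "Z'' \<subseteq> Z'" "infinite Z''"
    "\<And>F G. finite F \<Longrightarrow> F \<subseteq> D \<union> X'' \<Longrightarrow> finite G \<Longrightarrow> G \<subseteq> E \<union> Z'' \<Longrightarrow>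
      \<exists>B'\<in>W. B' \<subseteq> B \<and> regular b B' F G"
proof -
  let ?P = "\<lambda>B D E Xc Zc. B \<in> W \<and> regular b B D E \<and> Xc = X' \<and> Zc = Z'"
  have init: "?P B D E X' Z'" using B by simp
  have step: "\<exists>x z B' X'' Z''. x \<in> Xc \<and> z \<in> Zc \<and> (\<forall>r\<in>D. r < x) \<and> (\<forall>r\<in>E. r < z) \<and> B' \<subseteq> B \<and>
      X'' \<subseteq> Xc \<and> Z'' \<subseteq> Zc \<and> ?P B' (insert x D) (insert z E) X'' Z'' \<and> True"
    if p: "?P B D E Xc Zc" for B D E Xc Zc
  proof -
    have e: "B \<in> W" "regular b B D E" "Xc = X'" "Zc = Z'" using p by simp_all
    obtain x B1 where x: "x \<in> X'" "\<forall>r\<in>D \<union> E. r < x" "B1 \<in> W" "B1 \<subseteq> B" "regular b B1 (insert x D) E"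
      by (rule x_step[OF W av e(1,2) X'])
    obtain h where h: "h \<in> B1" using world_ne[OF W x(3)] by blast
    then have "Gd b h (insert x D) E" "finite E" using x(5) by (simp_all add: regular_def)
    then obtain N m where m: "\<And>h' z. h' \<in> cone h N \<Longrightarrow> z \<ge> m \<Longrightarrow> Gd b h' (insert x D) (insert z E)"
      by (elim Gd_late) blast
    obtain m' where m': "\<forall>r\<in>E. r < m'" using above_finite[OF \<open>finite E\<close>] by blast
    obtain z where z: "z \<in> Z'" "max m m' \<le> z" using infinite_pick[OF Z'] by blast
    have "h \<in> cone h N" using h world_C[OF W x(3)] C_stable cone_self by blast
    from m[OF this] z have "Gd b h (insert x D) (insert z E)" by simp
    then obtain B2 where B2: "B2 \<in> W" "B2 \<subseteq> B1" "regular b B2 (insert x D) (insert z E)"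
      using z_step[OF W x(3,5) h] by blast
    have "\<forall>r\<in>E. r < z" using m' z(2) by fastforce
    moreover have "\<forall>r\<in>D. r < x" using x(2) by blast
    moreover have "B2 \<subseteq> B" using B2(2) x(4) by blast
    ultimately show ?thesis using x(1) z(1) e B2
      by (intro exI[of _ x] exI[of _ z] exI[of _ B2] exI[of _ X'] exI[of _ Z'] conjI) simp_all
  qed
  obtain X'' Z'' Bs Ds Es Xs Zs where s: "X'' \<subseteq> X'" "infinite X''" "Z'' \<subseteq> Z'" "infinite Z''"
    "\<And>i :: nat. ?P (Bs i) (Ds i) (Es i) (Xs i) (Zs i)" "\<And>i :: nat. Bs i \<subseteq> B"
    "\<And>F. finite F \<Longrightarrow> F \<subseteq> D \<union> X'' \<Longrightarrow> \<exists>i :: nat. \<forall>j\<ge>i. F \<subseteq> Ds j"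
    "\<And>F. finite F \<Longrightarrow> F \<subseteq> E \<union> Z'' \<Longrightarrow> \<exists>i :: nat. \<forall>j\<ge>i. F \<subseteq> Es j"
    by (rule fusion[where P = ?P and K = "\<lambda>_ _ _ _ _. True", OF init step]) (assumption, (rule that; assumption))
  show ?thesis
  proof (rule that[OF s(1-4)])
    fix F G assume F: "finite F" "F \<subseteq> D \<union> X''" and G: "finite G" "G \<subseteq> E \<union> Z''"
    obtain i where i: "\<forall>j\<ge>i. F \<subseteq> Ds j" using s(7)[OF F] by blast
    obtain i' where i': "\<forall>j\<ge>i'. G \<subseteq> Es j" using s(8)[OF G] by blast
    have "F \<subseteq> Ds (max i i')" "G \<subseteq> Es (max i i')" using i i' by simp_all
    moreover have "regular b (Bs (max i i')) (Ds (max i i')) (Es (max i i'))" using s(5) by blast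
    ultimately have "regular b (Bs (max i i')) F G" using regular_sub by blast
    moreover have "Bs (max i i') \<in> W" using s(5) by blast
    ultimately show "\<exists>B'\<in>W. B' \<subseteq> B \<and> regular b B' F G" using s(6)
      by (intro bexI[of _ "Bs (max i i')"] conjI)
  qed
qed

section \<open>Tasks committed to a left element a, and persistent partners for it\<close>

definition base :: "bool \<Rightarrow> nat set \<Rightarrow> nat set \<Rightarrow> nat \<Rightarrow> nat \<Rightarrow> bool" where
  "base b D0 E0 a k \<longleftrightarrow> finite D0 \<and> finite E0 \<and> D0 \<subseteq> X \<and> E0 \<subseteq> Z \<and> n \<le> a \<and>
     (\<forall>D E. D \<subseteq> {k..} \<longrightarrow> E \<subseteq> {k..} \<longrightarrow> a \<in> GL b (D0 \<union> D) (E0 \<union> E))"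

definition hit :: "bool \<Rightarrow> nat set \<Rightarrow> nat set \<Rightarrow> nat \<Rightarrow> nat \<Rightarrow> nat set \<Rightarrow> nat set \<Rightarrow> nat set \<Rightarrow> nat set \<Rightarrow> nat \<Rightarrow> bool"
  where "hit b D0 E0 a k D E X' Z' y \<longleftrightarrow> base b D0 E0 a k \<and> finite D \<and> finite E \<and>
     D \<subseteq> X \<inter> {k..} \<and> E \<subseteq> Z \<inter> {k..} \<and> X' \<subseteq> X \<inter> {k..} \<and> Z' \<subseteq> Z \<inter> {k..} \<and> infinite X' \<and> infinite Z' \<and>
     pers (ups (GR b) D0 E0) D E X' Z' y"

text \<open>Persistence applied to the reservoirs of \<open>seq\<close> enumerates y from finite
  sets that some \<open>B'\<close> below B realises; a is enumerated there as well because these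
  sets change nothing below k. With (a,y) bad on B this contradicts \<open>no_hit\<close>.\<close>

lemma win:
  assumes W: "world W" and av: "available W b X1" and B: "B \<in> W" "regular b B (D0 \<union> D) (E0 \<union> E)"
    and hit: "hit b D0 E0 a k D E X' Z' y" and X': "X' \<subseteq> X1" and bad: "\<And>h. h \<in> B \<Longrightarrow> bad h a y"
  shows False
proof -
  note hit' = hit[unfolded hit_def]
  have inf: "infinite X'" "infinite Z'" using hit' by simp_all
  obtain X'' Z'' where s: "X'' \<subseteq> X'" "infinite X''" "Z'' \<subseteq> Z'" "infinite Z''"
    and r: "\<And>F G. finite F \<Longrightarrow> F \<subseteq> (D0 \<union> D) \<union> X'' \<Longrightarrow> finite G \<Longrightarrow> G \<subseteq> (E0 \<union> E) \<union> Z'' \<Longrightarrow>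
      \<exists>B'\<in>W. B' \<subseteq> B \<and> regular b B' F G"
    by (rule seq[OF W av B X' inf]) blast
  have "pers (ups (GR b) D0 E0) D E X' Z' y" using hit' by simp
  from this[unfolded pers_def, rule_format, OF s]
  obtain D1 E1 where y: "finite D1" "finite E1" "D1 \<subseteq> D \<union> X''" "E1 \<subseteq> E \<union> Z''" "y \<in> GR b (D0 \<union> D1) (E0 \<union> E1)"
    unfolding ups_def by auto
  have sub: "D \<union> X'' \<subseteq> X \<inter> {k..}" "E \<union> Z'' \<subseteq> Z \<inter> {k..}" "D0 \<subseteq> X" "E0 \<subseteq> Z" "finite D0" "finite E0"
    using hit' s unfolding base_def by auto
  have "D1 \<subseteq> {k..}" "E1 \<subseteq> {k..}" using sub y by auto
  then have a: "a \<in> GL b (D0 \<union> D1) (E0 \<union> E1)" using hit' unfolding base_def by simp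
  have "\<exists>B'\<in>W. B' \<subseteq> B \<and> regular b B' (D0 \<union> D1) (E0 \<union> E1)"
    by (rule r) (use y sub in auto)
  then obtain B' where B': "B' \<in> W" "B' \<subseteq> B" "regular b B' (D0 \<union> D1) (E0 \<union> E1)" by blast
  obtain h where h: "h \<in> B'" using world_ne[OF W B'(1)] by blast
  have "\<not> bad h a y"
  proof (rule no_hit[OF _ _ _ _ _ _ a y(5)])
    show "h \<in> C" using world_C[OF W B'(1)] h by blast
    show "Gd b h (D0 \<union> D1) (E0 \<union> E1)" using B'(3) h by (simp add: regular_def)
  qed (use y sub in auto)
  with bad B'(2) h show False by blast
qed

text \<open>The condition quantifies over colorings, not over members of a world. In this form it
  can be obtained from row-open sets and applied to a coloring produced by flipping entries.\<close>

definition hit_free :: "bool \<Rightarrow> coloring set \<Rightarrow> nat set \<Rightarrow> bool" where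
  "hit_free b A X1 \<longleftrightarrow> (\<forall>h\<in>A. \<forall>D0 E0 a k D E X' Z' y. hit b D0 E0 a k D E X' Z' y \<longrightarrow> X' \<subseteq> X1 \<longrightarrow>
     Gd b h (D0 \<union> D) (E0 \<union> E) \<longrightarrow> \<not> bad h a y)"

lemma hit_free_sub:
  assumes nh: "hit_free b A X1" and s: "X2 \<subseteq> X1"
  shows "hit_free b A X2"
  unfolding hit_free_def
proof (intro ballI allI impI)
  fix h D0 E0 a k D E X' Z' y
  assume h: "h \<in> A" and hit: "hit b D0 E0 a k D E X' Z' y" and X': "X' \<subseteq> X2"
    and g: "Gd b h (D0 \<union> D) (E0 \<union> E)"
  show "\<not> bad h a y"
    by (rule nh[unfolded hit_free_def, rule_format, OF h hit _ g]) (use X' s in blast)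
qed

text \<open>The lock and the badness at h extend to a cone around h. That cone belongs to the
  row-open world, where the available color b lets \<open>win\<close> be applied.\<close>

lemma hit_free_of_available:
  assumes "B1 \<subseteq> C" "row_open B1" and av: "available {B \<in> open_world. B \<subseteq> B1} b X1"
  shows "hit_free b B1 X1"
  unfolding hit_free_def
proof (intro ballI allI impI notI)
  fix h D0 E0 a k D E X' Z' y
  assume h: "h \<in> B1" and hit: "hit b D0 E0 a k D E X' Z' y" and X': "X' \<subseteq> X1"
    and g: "Gd b h (D0 \<union> D) (E0 \<union> E)" and bad: "bad h a y"
  obtain N0 where N0: "\<forall>h'\<in>cone h N0. Gd b h' (D0 \<union> D) (E0 \<union> E)" using Gd_open[OF g] by blast
  obtain N where N: "N \<ge> max N0 (Suc (max a y))" "cone h N \<subseteq> B1" using row_openD[OF assms(2) h] by blast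
  have st: "stable h" using h assms(1) C_stable by blast
  have "cone h N \<subseteq> cone h N0" using N(1) by (auto simp: cone_def)
  moreover have "finite (D0 \<union> D)" "finite (E0 \<union> E)" using hit by (simp_all add: hit_def base_def)
  ultimately have "regular b (cone h N) (D0 \<union> D) (E0 \<union> E)" using N0 unfolding regular_def by blast
  moreover have "cone h N \<in> {B \<in> open_world. B \<subseteq> B1}"
    using open_worldI[OF cone_self[OF st] _ row_open_cone] N(2) assms(1) by blast
  moreover have "bad h' a y" if "h' \<in> cone h N" for h'
    by (rule bad_cone[OF bad that]) (use N(1) in auto)
  ultimately show False using win[OF world_restrict[OF world_open_world] av _ _ hit X'] by blast
qed

text \<open>Beyond the rows that secure the colors used so far, row y is still free, so a persistent
  y there would be turned into a bad partner of a.\<close>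
lemma no_pers:
  assumes nh: "hit_free b A X1" and A: "row_open A" "A \<subseteq> C" and h: "h \<in> A"
  shows "\<exists>N. \<forall>y D0 E0 k D E X' Z'. N \<le> y \<longrightarrow> (\<forall>h'\<in>cone h N0. Gd b h' (D0 \<union> D) (E0 \<union> E)) \<longrightarrow>
     X' \<subseteq> X1 \<longrightarrow> \<not> hit b D0 E0 a k D E X' Z' y"
proof -
  have st: "stable h" using A h C_stable by blast
  then obtain l where l: "lims h a l" using lims_exists by blast
  \<comment> \<open>N depends on h, \<open>N0\<close> and a only, so the exclusion covers conditions
    that are chosen later.\<close>
  obtain N where N: "N \<ge> max N0 (Suc a)" "cone h N \<subseteq> A" using row_openD[OF A(1) h] by blast
  show ?thesis
  proof (intro exI[of _ N] allI impI notI)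
    fix y D0 E0 k D E X' Z'
    assume y: "N \<le> y" and g: "\<forall>h'\<in>cone h N0. Gd b h' (D0 \<union> D) (E0 \<union> E)"
      and X': "X' \<subseteq> X1" and hit: "hit b D0 E0 a k D E X' Z' y"
    define h1 where "h1 = h(y := \<lambda>_. \<not> l)"
    have c: "h1 \<in> cone h N" using stable_upd_row[OF st] y by (auto simp: cone_def h1_def)
    then have c0: "h1 \<in> cone h N0" using N(1) by (auto simp: cone_def)
    have "a \<noteq> y" using N(1) y by auto
    then have la: "lims h1 a l" using l by (simp add: h1_def lims_def)
    have ly: "lims h1 y (\<not> l)" by (simp add: h1_def lims_def)
    have "False" if "lims h1 a l'" "lims h1 y l'" for l'
      using lims_unique[OF la that(1)] lims_unique[OF ly that(2)] by simp
    then have "bad h1 a y" using \<open>a \<noteq> y\<close> unfolding bad_def by blast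
    moreover have "h1 \<in> A" using c N(2) by blast
    ultimately show False using nh[unfolded hit_free_def, rule_format, OF _ hit X' bspec[OF g c0]] by blast
  qed
qed

lemma undefeated_pers:
  assumes h: "h \<in> C" "Gd b h D0 E0" and base: "base b D0 E0 a k"
    and s: "X' \<subseteq> X" "infinite X'" "Z' \<subseteq> Z" "infinite Z'"
  obtains y where "y \<ge> M" "y \<in> ups (GR b) D0 E0 X' Z'"
proof -
  have b: "finite D0" "finite E0" "D0 \<subseteq> X" "E0 \<subseteq> Z" using base by (simp_all add: base_def)
  obtain L R where LR: "L \<subseteq> X'" "R \<subseteq> Z'" "infinite (GR b (D0 \<union> L) (E0 \<union> R))"
    by (rule undefeated[OF h b s])
  then obtain y where y: "y \<in> GR b (D0 \<union> L) (E0 \<union> R)" "y \<ge> M" using infinite_pick by blast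
  have "y \<in> ups (GR b) D0 E0 X' Z'"
    by (rule mono2D[OF mono2_ups ups_of_limit[OF GR_cont y(1)] LR(1,2)])
  with y(2) that show ?thesis by blast
qed

text \<open>If no extension is rich, one can thin out the reservoirs while adding elements so that no
  large number is ever persistent, and finally no large number is enumerated at all.\<close>
lemma not_always_poor:
  assumes W: "world W" and WA: "\<And>B. B \<in> W \<Longrightarrow> B \<subseteq> A" and A: "row_open A" "A \<subseteq> C"
    and av: "available W b X1" and nh: "hit_free b A X1" and base: "base b D0 E0 a k"
    and B0: "B0 \<in> W" "regular b B0 D0 E0"
    and X': "X' \<subseteq> X1" "X' \<subseteq> X \<inter> {k..}" "infinite X'" and Z': "Z' \<subseteq> Z \<inter> {k..}" "infinite Z'"
    and poor: "\<And>B D E X'' Z''. \<lbrakk>B \<in> W; B \<subseteq> B0; D \<subseteq> X \<inter> {k..}; E \<subseteq> Z \<inter> {k..}; finite D; finite E;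
      regular b B (D0 \<union> D) (E0 \<union> E); X'' \<subseteq> X'; infinite X''; Z'' \<subseteq> Z'; infinite Z''\<rbrakk> \<Longrightarrow>
      \<not> rich (ups (GR b) D0 E0) D E X'' Z''"
  shows False
proof -
  define U where "U = ups (GR b) D0 E0"
  have U: "mono2 U" unfolding U_def by (rule mono2_ups)
  have fin0: "finite D0" "finite E0" using base by (simp_all add: base_def)
  obtain h0 where h0: "h0 \<in> B0" using world_ne[OF W B0(1)] by blast
  have h0C: "h0 \<in> C" using world_C[OF W B0(1)] h0 by blast
  have g0: "Gd b h0 D0 E0" using B0(2) h0 by (simp add: regular_def)
  obtain N0 where N0: "\<forall>h'\<in>cone h0 N0. Gd b h' D0 E0" using Gd_open[OF g0] by blast
  have "h0 \<in> A" using WA[OF B0(1)] h0 by blast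
  from no_pers[OF nh A this, of N0 a] obtain M0 where M0: "\<forall>y D0' E0' k D E X' Z'. M0 \<le> y \<longrightarrow>
      (\<forall>h'\<in>cone h0 N0. Gd b h' (D0' \<union> D) (E0' \<union> E)) \<longrightarrow> X' \<subseteq> X1 \<longrightarrow> \<not> hit b D0' E0' a k D E X' Z' y"
    by (elim exE) (rule that)
  have clean0: "clean U M0 {} {} X' Z'"
    unfolding clean_def
  proof (intro allI impI notI)
    fix y X'' Z'' assume a: "M0 \<le> y" "X'' \<subseteq> X'" "infinite X''" "Z'' \<subseteq> Z'" "infinite Z''" "pers U {} {} X'' Z'' y"
    have "hit b D0 E0 a k {} {} X'' Z'' y"
      unfolding hit_def using base a X' Z' by (simp add: U_def) blast
    moreover have "X'' \<subseteq> X1" using a X' by blast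
    moreover have "\<forall>h'\<in>cone h0 N0. Gd b h' (D0 \<union> {}) (E0 \<union> {})" using N0 by simp
    ultimately show False using M0[rule_format, OF a(1), of D0 "{}" E0 "{}" X'' k Z''] by blast
  qed
  let ?P = "\<lambda>B D E Xc Zc. B \<in> W \<and> B \<subseteq> B0 \<and> regular b B (D0 \<union> D) (E0 \<union> E) \<and> D \<subseteq> X \<inter> {k..} \<and> E \<subseteq> Z \<inter> {k..} \<and>
    Xc \<subseteq> X' \<and> infinite Xc \<and> Zc \<subseteq> Z' \<and> infinite Zc \<and> clean U M0 D E Xc Zc"
  let ?K = "\<lambda>i D E Xc Zc. \<forall>y. M0 \<le> y \<and> y < i \<longrightarrow> y \<notin> U (D \<union> Xc) (E \<union> Zc)"
  have init: "?P B0 {} {} X' Z'" using B0 X' Z' clean0 by simp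
  have step: "\<exists>x z B' X'' Z''. x \<in> Xc \<and> z \<in> Zc \<and> (\<forall>r\<in>D. r < x) \<and> (\<forall>r\<in>E. r < z) \<and> B' \<subseteq> B \<and>
      X'' \<subseteq> Xc \<and> Z'' \<subseteq> Zc \<and> ?P B' (insert x D) (insert z E) X'' Z'' \<and> ?K i (insert x D) (insert z E) X'' Z''"
    if p: "?P B D E Xc Zc" for B D E Xc Zc and i :: nat
  proof -
    have B: "B \<in> W" "B \<subseteq> B0" "regular b B (D0 \<union> D) (E0 \<union> E)" and D: "D \<subseteq> X \<inter> {k..}" and E: "E \<subseteq> Z \<inter> {k..}"
      and Xc: "Xc \<subseteq> X'" "infinite Xc" and Zc: "Zc \<subseteq> Z'" "infinite Zc" and cl: "clean U M0 D E Xc Zc"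
      using p by simp_all
    have fin: "finite D" "finite E" using B(3) by (simp_all add: regular_def)
    have "\<not> rich U D E Xc Zc" unfolding U_def by (rule poor[OF B(1,2) D E fin B(3) Xc Zc])
    \<comment> \<open>Failure of richness controls numbers from M on for every x that may be added;
      those below M must be removed before x is picked.\<close>
    then obtain M X2 Z2 where 2: "X2 \<subseteq> Xc" "infinite X2" "Z2 \<subseteq> Zc" "infinite Z2" and
      late: "\<not> (\<exists>x\<in>X2. \<exists>y\<ge>M. \<exists>X3 Z3. X3 \<subseteq> X2 \<and> infinite X3 \<and> Z3 \<subseteq> Z2 \<and> infinite Z3 \<and>
        pers U (insert x D) E X3 Z3 y)"
      unfolding rich_def not_all not_imp by (elim exE conjE) (rule that)
    obtain X3 Z3 where 3: "X3 \<subseteq> X2" "infinite X3" "Z3 \<subseteq> Z2" "infinite Z3"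
      "\<forall>y. M0 \<le> y \<and> y < M \<longrightarrow> y \<notin> U (D \<union> X3) (E \<union> Z3)"
      using clean_kill[OF U clean_sub[OF cl 2(1,3)] 2(2,4), of M] by (elim exE conjE) (rule that)
    have X3: "X3 \<subseteq> X1" "X3 \<subseteq> X'" "Z3 \<subseteq> Z'" using 2 3 X' Xc Zc by blast+
    obtain x B1 where x: "x \<in> X3" "\<forall>r\<in>(D0 \<union> D) \<union> (E0 \<union> E). r < x" "B1 \<in> W" "B1 \<subseteq> B"
      "regular b B1 (insert x (D0 \<union> D)) (E0 \<union> E)"
      by (rule x_step[OF W av B(1,3) X3(1) 3(2)])
    define D1 where "D1 = insert x D"
    have R1: "regular b B1 (D0 \<union> D1) (E0 \<union> E)" using x(5) by (simp add: D1_def)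
    have D1: "D1 \<subseteq> X \<inter> {k..}" "finite D1" using D x(1) X3(2) X'(2) fin by (auto simp: D1_def)
    have cl1: "clean U M0 D1 E X3 Z3"
    proof (rule clean_extend[OF U, where N = M and D = D and E = E])
      show "y \<notin> U (D \<union> X3) (E \<union> Z3)" if "M0 \<le> y" "y < M" for y using 3(5) that by blast
      show "\<not> pers U D1 E X4 Z4 y" if "M \<le> y" "X4 \<subseteq> X3" "infinite X4" "Z4 \<subseteq> Z3" "infinite Z4" for y X4 Z4
      proof
        assume "pers U D1 E X4 Z4 y"
        moreover have "x \<in> X2" "X4 \<subseteq> X2" "Z4 \<subseteq> Z2" using that x(1) 3 by auto
        ultimately have "\<exists>x\<in>X2. \<exists>y\<ge>M. \<exists>X3 Z3. X3 \<subseteq> X2 \<and> infinite X3 \<and> Z3 \<subseteq> Z2 \<and> infinite Z3 \<and>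
        pers U (insert x D) E X3 Z3 y" using that unfolding D1_def
          by (intro bexI[of _ x] exI[of _ y] exI[of _ X4] exI[of _ Z4] conjI)
        with late show False by (rule notE)
      qed
    qed (use x(1) in \<open>auto simp: D1_def\<close>)
    obtain h where h: "h \<in> B1" using world_ne[OF W x(3)] by blast
    have hC: "h \<in> C" using world_C[OF W x(3)] h by blast
    have "Gd b h (D0 \<union> D1) (E0 \<union> E)" using R1 h by (simp add: regular_def)
    then obtain N1 m where m: "\<And>h' z. h' \<in> cone h N1 \<Longrightarrow> z \<ge> m \<Longrightarrow> Gd b h' (D0 \<union> D1) (insert z (E0 \<union> E))"
      by (rule Gd_late) blast
    have "h \<in> A" using WA[OF x(3)] h by blast
    \<comment> \<open>The right element is handled differently: the cone given by \<open>N1\<close>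
      locks the condition for every z from m on, so N is known before z, and the numbers below N can
      be removed while z is still in the reservoir.\<close>
    from no_pers[OF nh A this, of N1 a] obtain N where N: "\<forall>y D0' E0' k D E X' Z'. N \<le> y \<longrightarrow>
        (\<forall>h'\<in>cone h N1. Gd b h' (D0' \<union> D) (E0' \<union> E)) \<longrightarrow> X' \<subseteq> X1 \<longrightarrow> \<not> hit b D0' E0' a k D E X' Z' y"
      by (elim exE) (rule that)
    obtain X4 Z4 where 4: "X4 \<subseteq> X3" "infinite X4" "Z4 \<subseteq> Z3" "infinite Z4"
      "\<forall>y. M0 \<le> y \<and> y < N \<longrightarrow> y \<notin> U (D1 \<union> X4) (E \<union> Z4)"
      using clean_kill[OF U cl1 3(2,4), of N] by (elim exE conjE) (rule that)
    have "finite (E0 \<union> E)" using fin0 fin by simp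
    then obtain m' where m': "\<forall>r\<in>E0 \<union> E. r < m'" using above_finite by blast
    obtain z where z: "z \<in> Z4" "max m m' \<le> z" using infinite_pick[OF 4(4)] by blast
    define E1 where "E1 = insert z E"
    have zE: "insert z (E0 \<union> E) = E0 \<union> E1" by (simp add: E1_def)
    have g1: "\<forall>h'\<in>cone h N1. Gd b h' (D0 \<union> D1) (E0 \<union> E1)"
      using m[of _ z] z(2) unfolding zE by simp
    have E1: "E1 \<subseteq> Z \<inter> {k..}" "finite E1" using E z(1) 4(3) X3(3) Z'(1) fin by (auto simp: E1_def)
    obtain B2 where B2: "B2 \<in> W" "B2 \<subseteq> B1" "regular b B2 (D0 \<union> D1) (E0 \<union> E1)"
      using z_step[OF W x(3) R1 h, of z] bspec[OF g1 cone_self[OF C_stable[OF hC]]] unfolding zE by blast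
    have cl2: "clean U M0 D1 E1 X4 Z4"
    proof (rule clean_extend[OF U, where N = N and D = D1 and E = E])
      show "y \<notin> U (D1 \<union> X4) (E \<union> Z4)" if "M0 \<le> y" "y < N" for y using 4(5) that by blast
      show "\<not> pers U D1 E1 X5 Z5 y" if y: "N \<le> y" "X5 \<subseteq> X4" "infinite X5" "Z5 \<subseteq> Z4" "infinite Z5" for y X5 Z5
      proof
        assume "pers U D1 E1 X5 Z5 y"
        moreover have "X5 \<subseteq> X \<inter> {k..}" "Z5 \<subseteq> Z \<inter> {k..}" "X5 \<subseteq> X1" using y 4 X3 X' Z' by blast+
        ultimately have "hit b D0 E0 a k D1 E1 X5 Z5 y" "X5 \<subseteq> X1"
          unfolding hit_def U_def using base D1 E1 y by blast+
        with N[rule_format, OF y(1), of D0 D1 E0 E1 X5 k Z5] g1 show False by blast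
      qed
    qed (use z(1) in \<open>auto simp: E1_def\<close>)
    obtain X5 Z5 where 5: "X5 \<subseteq> X4" "infinite X5" "Z5 \<subseteq> Z4" "infinite Z5"
      "\<forall>y. M0 \<le> y \<and> y < i \<longrightarrow> y \<notin> U (D1 \<union> X5) (E1 \<union> Z5)"
      using clean_kill[OF U cl2 4(2,4), of i] by (elim exE conjE) (rule that)
    have cl3: "clean U M0 D1 E1 X5 Z5" by (rule clean_sub[OF cl2 5(1,3)])
    have "m' \<le> z" using z(2) by simp
    then have "\<forall>r\<in>E. r < z" using m' less_le_trans by blast
    moreover have "\<forall>r\<in>D. r < x" using x(2) by blast
    moreover have "x \<in> Xc" using x(1) 2(1) 3(1) by blast
    moreover have "z \<in> Zc" using z(1) 2(3) 3(3) 4(3) by blast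
    moreover have "B2 \<subseteq> B" using B2(2) x(4) by blast
    moreover have "B2 \<subseteq> B0" using B2(2) x(4) B(2) by blast
    moreover have "X5 \<subseteq> Xc" "Z5 \<subseteq> Zc" "X5 \<subseteq> X'" "Z5 \<subseteq> Z'" using 2(1,3) 3(1,3) 4(1,3) 5(1,3) Xc(1) Zc(1) by blast+
    ultimately show ?thesis unfolding D1_def[symmetric] E1_def[symmetric] using B2(1,3) D1(1) E1(1) 5(2,4,5) cl3
      by (intro exI[of _ x] exI[of _ z] exI[of _ B2] exI[of _ X5] exI[of _ Z5] conjI) 
        (assumption | simp only: D1_def E1_def)+
  qed
  obtain X'' Z'' Bs Ds Es Xs Zs where s: "X'' \<subseteq> X'" "infinite X''" "Z'' \<subseteq> Z'" "infinite Z''"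
    "\<And>i :: nat. ?K i (Ds (Suc i)) (Es (Suc i)) (Xs (Suc i)) (Zs (Suc i))"
    "\<And>i :: nat. X'' \<subseteq> Ds i \<union> Xs i" "\<And>i :: nat. Z'' \<subseteq> Es i \<union> Zs i"
    by (rule fusion[where P = ?P and K = ?K, OF init step]) (assumption, (rule that; assumption))
  have "X'' \<subseteq> X" "Z'' \<subseteq> Z" using s(1,3) X' Z' by blast+
  then obtain y where y: "y \<ge> M0" "y \<in> U X'' Z''"
    using undefeated_pers[OF h0C g0 base _ s(2) _ s(4), of M0] unfolding U_def by blast
  \<comment> \<open>Step \<open>Suc y\<close> excludes the numbers strictly below its index, hence
    y, and its result is recorded at stage \<open>Suc (Suc y)\<close>.\<close>
  have "y \<in> U (Ds (Suc (Suc y)) \<union> Xs (Suc (Suc y))) (Es (Suc (Suc y)) \<union> Zs (Suc (Suc y)))"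
    by (rule mono2D[OF U y(2) s(6) s(7)])
  with s(5)[of "Suc y"] y(1) show False by simp
qed

text \<open>The reservoirs from \<open>seq\<close> are not defeated, so some infinite subsets of
  them yield infinitely many left outputs, in particular one not below n. Its use cuts out finite
  sets, and \<open>seq\<close> has prepared a member of W for these.\<close>

lemma base_exists:
  assumes W: "world W" and av: "available W b X1" and B: "B \<in> W"
    and X': "X' \<subseteq> X1" "X' \<subseteq> X" "infinite X'" and Z': "Z' \<subseteq> Z" "infinite Z'"
  obtains B' D0 E0 a k l where "B' \<in> W" "B' \<subseteq> B" "base b D0 E0 a k" "regular b B' D0 E0" "\<forall>h\<in>B'. lims h a l"
proof -
  have "regular b B {} {}" by (simp add: regular_def Gd_empty)
  then obtain X'' Z'' where s: "X'' \<subseteq> X'" "infinite X''" "Z'' \<subseteq> Z'" "infinite Z''"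
    and r: "\<And>F G. finite F \<Longrightarrow> F \<subseteq> {} \<union> X'' \<Longrightarrow> finite G \<Longrightarrow> G \<subseteq> {} \<union> Z'' \<Longrightarrow>
      \<exists>B'\<in>W. B' \<subseteq> B \<and> regular b B' F G"
    by (rule seq[OF W av B _ X'(1,3) Z'(2)]) blast
  obtain h where h: "h \<in> B" using world_ne[OF W B] by blast
  then have "h \<in> C" using world_C[OF W B] by blast
  moreover have "X'' \<subseteq> X" "Z'' \<subseteq> Z" using s X' Z' by blast+
  ultimately obtain L R where LR: "L \<subseteq> X''" "R \<subseteq> Z''" "infinite (GL b ({} \<union> L) ({} \<union> R))"
    by (elim undefeated[of h b "{}" "{}" X'' Z'']) (auto simp: Gd_empty s)
  then obtain a where a: "a \<in> GL b L R" "n \<le> a" using infinite_pick[OF LR(3), of n] by auto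
  obtain N where N: "\<forall>L' R'. L' \<inter> {..<N} = L \<inter> {..<N} \<longrightarrow> R' \<inter> {..<N} = R \<inter> {..<N} \<longrightarrow> a \<in> GL b L' R'"
    using GL_cont[of b, unfolded fcont_def, rule_format, OF a(1)] by (elim exE) (rule that)
  define D0 E0 where "D0 = L \<inter> {..<N}" and "E0 = R \<inter> {..<N}"
  have f: "finite D0" "finite E0" "D0 \<subseteq> X''" "E0 \<subseteq> Z''" using LR by (auto simp: D0_def E0_def)
  have st: "a \<in> GL b (D0 \<union> D) (E0 \<union> E)" if "D \<subseteq> {N..}" "E \<subseteq> {N..}" for D E
  proof (rule N[rule_format])
    show "(D0 \<union> D) \<inter> {..<N} = L \<inter> {..<N}" using that by (fastforce simp: D0_def)
    show "(E0 \<union> E) \<inter> {..<N} = R \<inter> {..<N}" using that by (fastforce simp: E0_def)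
  qed
  have base: "base b D0 E0 a N" unfolding base_def
    using f st a(2) \<open>X'' \<subseteq> X\<close> \<open>Z'' \<subseteq> Z\<close> by blast
  have "\<exists>B'\<in>W. B' \<subseteq> B \<and> regular b B' D0 E0" by (rule r) (use f in auto)
  then obtain B1 where B1: "B1 \<in> W" "B1 \<subseteq> B" "regular b B1 D0 E0" by blast
  from world_lims[OF W B1(1), of a] obtain l B2 where B2: "B2 \<in> W" "B2 \<subseteq> B1" "\<forall>h\<in>B2. lims h a l"
    by (elim exE bexE conjE) (rule that)
  show ?thesis
    by (rule that[OF B2(1) _ base regular_sub[OF B1(3) B2(2) order_refl order_refl] B2(3)]) (use B1 B2 in blast)
qed

lemma rich_exists:
  assumes W: "world W" and WA: "\<And>B. B \<in> W \<Longrightarrow> B \<subseteq> A" and A: "row_open A" "A \<subseteq> C"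
    and av: "available W b X1" and nh: "hit_free b A X1" and B: "B \<in> W"
    and X': "X' \<subseteq> X1" "X' \<subseteq> X" "infinite X'" and Z': "Z' \<subseteq> Z" "infinite Z'"
  obtains B' D0 E0 a k D E X'' Z'' l where "B' \<in> W" "B' \<subseteq> B" "base b D0 E0 a k" "\<forall>h\<in>B'. lims h a l"
    "D \<subseteq> X \<inter> {k..}" "E \<subseteq> Z \<inter> {k..}" "finite D" "finite E" "regular b B' (D0 \<union> D) (E0 \<union> E)"
    "X'' \<subseteq> X' \<inter> {k..}" "infinite X''" "Z'' \<subseteq> Z' \<inter> {k..}" "infinite Z''" "rich (ups (GR b) D0 E0) D E X'' Z''"
proof -
  obtain B1 D0 E0 a k l where 1: "B1 \<in> W" "B1 \<subseteq> B" "base b D0 E0 a k" "regular b B1 D0 E0" "\<forall>h\<in>B1. lims h a l"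
    by (rule base_exists[OF W av B X' Z'])
  note res = that
  show ?thesis
  proof (rule ccontr)
    assume no: "\<not> thesis"
    show False
    proof (rule not_always_poor[OF W WA A av nh 1(3,1,4)])
      show "X' \<inter> {k..} \<subseteq> X1" "X' \<inter> {k..} \<subseteq> X \<inter> {k..}" "Z' \<inter> {k..} \<subseteq> Z \<inter> {k..}" using X' Z' by blast+
      show "infinite (X' \<inter> {k..})" "infinite (Z' \<inter> {k..})"
        using infinite_Int_atLeast X'(3) Z'(2) by blast+
      show "\<not> rich (ups (GR b) D0 E0) D E X'' Z''"
        if q: "B' \<in> W" "B' \<subseteq> B1" "D \<subseteq> X \<inter> {k..}" "E \<subseteq> Z \<inter> {k..}" "finite D" "finite E"
          "regular b B' (D0 \<union> D) (E0 \<union> E)" "X'' \<subseteq> X' \<inter> {k..}" "infinite X''" "Z'' \<subseteq> Z' \<inter> {k..}" "infinite Z''"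
        for B' D E X'' Z''
      proof
        assume r: "rich (ups (GR b) D0 E0) D E X'' Z''"
        have s: "B' \<subseteq> B" "\<forall>h\<in>B'. lims h a l" using q(2) 1(2,5) by blast+
        have thesis by (rule res[OF q(1) s(1) 1(3) s(2) q(3-11) r])
        with no show False ..
      qed
    qed
  qed
qed

lemma beyond_rich:
  assumes "rich U D E X' Z'" "infinite X'" "infinite Z'"
  shows "\<exists>x\<in>X'. m \<le> x \<and> (\<exists>y\<ge>M. \<exists>X'' Z''. X'' \<subseteq> X' \<and> infinite X'' \<and> Z'' \<subseteq> Z' \<and> infinite Z'' \<and>
      pers U (insert x D) E X'' Z'' y)"
proof -
  from assms(1)[unfolded rich_def, rule_format, OF Int_lower1 infinite_Int_atLeast[OF assms(2), of m] order_refl assms(3), of M]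
  obtain x y X'' Z'' where 1: "x \<in> X' \<inter> {m..}" "y \<ge> M" "X'' \<subseteq> X' \<inter> {m..}" "infinite X''" "Z'' \<subseteq> Z'" "infinite Z''"
    "pers U (insert x D) E X'' Z'' y" by (elim exE bexE conjE) (rule that)
  have "x \<in> X'" "m \<le> x" "X'' \<subseteq> X'" using 1 by auto
  with 1 show ?thesis by (intro bexI[of _ x] conjI exI[of _ y] exI[of _ X''] exI[of _ Z''])
qed

text \<open>When every x in \<open>X1\<close> can receive color b below any member of W, color and
  badness do not compete: (a,y) is made bad before x is colored, and \<open>win\<close> applies
  afterwards.\<close>

lemma one_color:
  assumes W: "world W" and WA: "\<And>B. B \<in> W \<Longrightarrow> B \<subseteq> A" and A: "row_open A" "A \<subseteq> C"
    and strong: "\<And>B x. B \<in> W \<Longrightarrow> x \<in> X1 \<Longrightarrow> \<exists>B'\<in>W. B' \<subseteq> B \<and> (\<forall>h\<in>B'. Gd b h {x} {})"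
    and X1: "X1 \<subseteq> X" "infinite X1" and nh: "hit_free b A X1" and B: "B \<in> W"
  shows False
proof -
  have av: "available W b X1" unfolding available_def
  proof (intro ballI allI impI)
    fix B X' assume "B \<in> W" "X' \<subseteq> X1" "infinite X'"
    moreover from this obtain x where "x \<in> X'" using infinite_pick by blast
    ultimately show "\<exists>x\<in>X'. \<exists>B'\<in>W. B' \<subseteq> B \<and> (\<forall>h\<in>B'. Gd b h {x} {})"
      using strong[of B x] by (intro bexI[of _ x]) auto
  qed
  obtain B1 D0 E0 a k D E X' Z' l where 1: "B1 \<in> W" "B1 \<subseteq> B" "base b D0 E0 a k" "\<forall>h\<in>B1. lims h a l"
    and 2: "D \<subseteq> X \<inter> {k..}" "E \<subseteq> Z \<inter> {k..}" "finite D" "finite E" "regular b B1 (D0 \<union> D) (E0 \<union> E)"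
    "X' \<subseteq> X1 \<inter> {k..}" "infinite X'" "Z' \<subseteq> Z \<inter> {k..}" "infinite Z'" "rich (ups (GR b) D0 E0) D E X' Z'"
    by (rule rich_exists[OF W WA A av nh B order_refl X1 order_refl inf_Z])
  have a: "n \<le> a" using 1(3) by (simp add: base_def)
  from world_bad[OF W 1(1) a 1(4)] obtain N where N: "\<forall>y\<ge>N. \<exists>B'\<in>W. B' \<subseteq> B1 \<and> (\<forall>h\<in>B'. bad h a y)"
    by (elim exE) (rule that)
  have "finite (E0 \<union> E)" using 2(5) by (simp add: regular_def)
  then obtain m where m: "\<forall>r\<in>E0 \<union> E. r < m" using above_finite by blast
  from beyond_rich[OF 2(10,7,9), of m N] obtain x y X3 Z3 where
    3: "x \<in> X'" "m \<le> x" "N \<le> y" "X3 \<subseteq> X'" "infinite X3" "Z3 \<subseteq> Z'" "infinite Z3"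
    and p: "pers (ups (GR b) D0 E0) (insert x D) E X3 Z3 y" by (elim exE bexE conjE) (rule that)
  from N[rule_format, OF 3(3)] obtain B2 where B2: "B2 \<in> W" "B2 \<subseteq> B1" "\<forall>h\<in>B2. bad h a y"
    by (elim bexE conjE) (rule that)
  have "x \<in> X1" using 3(1) 2(6) by blast
  from strong[OF B2(1) this] obtain B3 where B3: "B3 \<in> W" "B3 \<subseteq> B2" "\<forall>h\<in>B3. Gd b h {x} {}"
    by (elim bexE conjE) (rule that)
  have "regular b B3 (insert x (D0 \<union> D)) (E0 \<union> E)"
  proof (rule regular_insert)
    show "regular b B3 (D0 \<union> D) (E0 \<union> E)" using regular_sub[OF 2(5) _ order_refl order_refl] B2(2) B3(2) by blast
    show "Gd b h {x} {}" if "h \<in> B3" for h using B3(3) that by blast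
    show "r \<le> x" if "r \<in> E0 \<union> E" for r using less_le_trans[OF bspec[OF m that] 3(2)] by simp
  qed
  then have R: "regular b B3 (D0 \<union> insert x D) (E0 \<union> E)" by simp
  have "hit b D0 E0 a k (insert x D) E X3 Z3 y"
    unfolding hit_def
  proof (intro conjI)
    show "insert x D \<subseteq> X \<inter> {k..}" using 2(1,6) 3(1) X1 by blast
    show "X3 \<subseteq> X \<inter> {k..}" "Z3 \<subseteq> Z \<inter> {k..}" using 2(6,8) 3(4,6) X1 by blast+
  qed (use 1(3) 2 3 p in simp_all)
  moreover have "X3 \<subseteq> X1" using 3(4) 2(6) by blast
  ultimately show False using win[OF W av B3(1) R] B2(3) B3(2) by blast
qed

text \<open>Here x is added after a0 and a1 have been given flipped entries in the columns y0 and y1;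
  whichever color x then receives, one of the two tasks is met by a bad pair.\<close>
lemma two_colors:
  assumes av: "\<And>b. available dense_world b X" and nh: "\<And>b. hit_free b C X"
  shows False
proof -
  have A: "\<And>B. B \<in> dense_world \<Longrightarrow> B \<subseteq> C" "row_open C" "C \<subseteq> C" by (auto simp: dense_world_def row_open_cone)
  obtain B1 D0 E0 a0 k0 D E X0 Z0 l0 where 1: "B1 \<in> dense_world" "B1 \<subseteq> C" "base False D0 E0 a0 k0" "\<forall>h\<in>B1. lims h a0 l0"
    and 2: "D \<subseteq> X \<inter> {k0..}" "E \<subseteq> Z \<inter> {k0..}" "finite D" "finite E" "regular False B1 (D0 \<union> D) (E0 \<union> E)"
    "X0 \<subseteq> X \<inter> {k0..}" "infinite X0" "Z0 \<subseteq> Z \<inter> {k0..}" "infinite Z0" "rich (ups (GR False) D0 E0) D E X0 Z0"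
    by (rule rich_exists[OF world_dense_world A av nh C_dense_world order_refl order_refl inf_X order_refl inf_Z])
  have s0: "X0 \<subseteq> X" "Z0 \<subseteq> Z" using 2 by blast+
  obtain B2 D0' E0' a1 k1 D' E' X1 Z1 l1 where 3: "B2 \<in> dense_world" "B2 \<subseteq> B1" "base True D0' E0' a1 k1" "\<forall>h\<in>B2. lims h a1 l1"
    and 4: "D' \<subseteq> X \<inter> {k1..}" "E' \<subseteq> Z \<inter> {k1..}" "finite D'" "finite E'" "regular True B2 (D0' \<union> D') (E0' \<union> E')"
    "X1 \<subseteq> X0 \<inter> {k1..}" "infinite X1" "Z1 \<subseteq> Z0 \<inter> {k1..}" "infinite Z1" "rich (ups (GR True) D0' E0') D' E' X1 Z1"
    by (rule rich_exists[OF world_dense_world A av nh 1(1) s0(1) s0(1) 2(7) s0(2) 2(9)])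
  have a: "n \<le> a0" "n \<le> a1" using 1(3) 3(3) by (simp_all add: base_def)
  from dense_world_flip[OF 3(1) a, of "\<not> l0" "\<not> l1"] obtain N where
    N: "\<forall>y0 y1. N \<le> y0 \<longrightarrow> N \<le> y1 \<longrightarrow> ((a0, y0) = (a1, y1) \<longrightarrow> (\<not> l0) = (\<not> l1)) \<longrightarrow>
        (\<exists>B'\<in>dense_world. B' \<subseteq> B2 \<and> a0 < y0 \<and> a1 < y1 \<and> (\<forall>h\<in>B'. h a0 y0 = (\<not> l0) \<and> h a1 y1 = (\<not> l1)))"
    by (elim exE) (rule that)
  have "rich (ups (GR False) D0 E0) D E X1 Z1" by (rule rich_sub[OF 2(10)]) (use 4 in blast)+
  \<comment> \<open>The task for color False must have a persistent \<open>y0\<close> ready for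
    whichever x the task for color True will pick.\<close>
  from rich_uniform[OF mono2_ups this 4(7,9), of N] obtain X2 Z2 where
    5: "X2 \<subseteq> X1" "infinite X2" "Z2 \<subseteq> Z1" "infinite Z2"
      "\<forall>x\<in>X2. \<exists>y\<ge>N. pers (ups (GR False) D0 E0) (insert x D) E X2 Z2 y"
    by (elim exE conjE) (rule that)
  have "finite ((E0 \<union> E) \<union> (E0' \<union> E'))" using 2(5) 4(5) by (simp add: regular_def)
  from above_finite[OF this] obtain m where m: "\<forall>r\<in>(E0 \<union> E) \<union> (E0' \<union> E'). r < m"
    by (elim exE) (rule that)
  from beyond_rich[OF rich_sub[OF 4(10) 5(1,3)] 5(2,4), of m N] obtain x y1 X3 Z3 where
    6: "x \<in> X2" "m \<le> x" "N \<le> y1" "X3 \<subseteq> X2" "infinite X3" "Z3 \<subseteq> Z2" "infinite Z3"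
    and p1: "pers (ups (GR True) D0' E0') (insert x D') E' X3 Z3 y1" by (elim exE bexE conjE) (rule that)
  from 5(5) 6(1) obtain y0 where y0: "N \<le> y0" and p0: "pers (ups (GR False) D0 E0) (insert x D) E X2 Z2 y0" by blast
  obtain hh where hh: "hh \<in> B2" using dense_world_ne[OF 3(1)] by blast
  \<comment> \<open>Should both flips concern the same entry, they agree: a common member of
    \<open>B2\<close> has both limits on the same row.\<close>
  have same: "(a0, y0) = (a1, y1) \<longrightarrow> (\<not> l0) = (\<not> l1)"
  proof
    assume "(a0, y0) = (a1, y1)"
    moreover have "lims hh a0 l0" "lims hh a1 l1" using hh 1(4) 3(2,4) by blast+
    ultimately show "(\<not> l0) = (\<not> l1)" using lims_unique by auto
  qed
  from N[THEN spec, THEN spec, THEN mp, OF y0, THEN mp, OF 6(3), THEN mp, OF same] obtain B3 where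
    B3: "B3 \<in> dense_world" "B3 \<subseteq> B2" "a0 < y0" "a1 < y1" "\<forall>h\<in>B3. h a0 y0 = (\<not> l0) \<and> h a1 y1 = (\<not> l1)"
    by (elim bexE conjE) (rule that)
  \<comment> \<open>Only now does x receive a color, with both flipped entries already in place and
    all earlier locks and limits still valid on \<open>B3\<close>.\<close>
  from world_split[OF world_dense_world B3(1), of x] obtain b B4 where
    B4: "B4 \<in> dense_world" "B4 \<subseteq> B3" "\<forall>h\<in>B4. Gd b h {x} {}" by (elim exE bexE conjE) (rule that)
  obtain h where h: "h \<in> B4" using dense_world_ne[OF B4(1)] by blast
  have hB: "h \<in> B3" "h \<in> B2" "h \<in> B1" "h \<in> C" using h B4(2) B3(2) 3(2) 1(2) by blast+
  have col: "Gd b h {x} {}" using B4(3) h by blast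
  have less: "r \<le> x" if "r \<in> (E0 \<union> E) \<union> (E0' \<union> E')" for r using less_le_trans[OF bspec[OF m that] 6(2)] by simp
  have f: "h a0 y0 = (\<not> l0)" "h a1 y1 = (\<not> l1)" by (rule bspec[OF B3(5) hB(1), THEN conjunct1] bspec[OF B3(5) hB(1), THEN conjunct2])+
  show False
  proof (cases b)
    case False
    have "Gd False h (D0 \<union> D) (E0 \<union> E)" using 2(5) hB(3) by (simp add: regular_def)
    then have g: "Gd False h (D0 \<union> insert x D) (E0 \<union> E)"
      using Gd_insert[of False h "D0 \<union> D" "E0 \<union> E" x] col False less by simp
    have hit: "hit False D0 E0 a0 k0 (insert x D) E X2 Z2 y0"
      unfolding hit_def
    proof (intro conjI)
      show "insert x D \<subseteq> X \<inter> {k0..}" using 2(1,6) 4(6) 5(1) 6(1) by blast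
      show "X2 \<subseteq> X \<inter> {k0..}" "Z2 \<subseteq> Z \<inter> {k0..}" using 2(6,8) 4(6,8) 5(1,3) by blast+
    qed (use 1(3) 2 5 p0 in simp_all)
    have "X2 \<subseteq> X" using 2(6) 4(6) 5(1) by blast
    moreover have "bad h a0 y0" by (rule bad_flip[of h a0 l0, OF _ B3(3) f(1)]) (use 1(4) hB(3) in blast)
    ultimately show False using nh[unfolded hit_free_def, rule_format, OF hB(4) hit _ g] by blast
  next
    case True
    have "Gd True h (D0' \<union> D') (E0' \<union> E')" using 4(5) hB(2) by (simp add: regular_def)
    then have g: "Gd True h (D0' \<union> insert x D') (E0' \<union> E')"
      using Gd_insert[of True h "D0' \<union> D'" "E0' \<union> E'" x] col True less by simp
    have hit: "hit True D0' E0' a1 k1 (insert x D') E' X3 Z3 y1"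
      unfolding hit_def
    proof (intro conjI)
      show "insert x D' \<subseteq> X \<inter> {k1..}" using 4(1,6) 5(1) 6(1) s0 by blast
      show "X3 \<subseteq> X \<inter> {k1..}" "Z3 \<subseteq> Z \<inter> {k1..}" using 4(6,8) 5(1,3) 6(4,6) s0 by blast+
    qed (use 3(3) 4 6 p1 in simp_all)
    have "X3 \<subseteq> X" using s0 4(6) 5(1) 6(4) by blast
    moreover have "bad h a1 y1" by (rule bad_flip[of h a1 l1, OF _ B3(4) f(2)]) (use 3(4) hB(2) in blast)
    ultimately show False using nh[unfolded hit_free_def, rule_format, OF hB(4) hit _ g] by blast
  qed
qed

section \<open>Case distinction on the colors that stay available\<close>

lemma strong_of_not_available:
  assumes W: "world W" and "\<not> available W b X"
  obtains B1 X1 where "B1 \<in> W" "X1 \<subseteq> X" "infinite X1"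
    "\<And>B x. B \<in> {B \<in> W. B \<subseteq> B1} \<Longrightarrow> x \<in> X1 \<Longrightarrow> \<exists>B'\<in>{B \<in> W. B \<subseteq> B1}. B' \<subseteq> B \<and> (\<forall>h\<in>B'. Gd (\<not> b) h {x} {})"
proof -
  from assms(2) obtain B1 X1 where 1: "B1 \<in> W" "X1 \<subseteq> X" "infinite X1"
    and no: "\<not> (\<exists>x\<in>X1. \<exists>B'\<in>W. B' \<subseteq> B1 \<and> (\<forall>h\<in>B'. Gd b h {x} {}))"
    unfolding available_def by blast
  show ?thesis
  proof (rule that[OF 1])
    fix B x assume "B \<in> {B \<in> W. B \<subseteq> B1}" and x: "x \<in> X1"
    then have B: "B \<in> W" "B \<subseteq> B1" by simp_all
    from world_split[OF W B(1), of x] obtain b' B' where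
      B': "B' \<in> W" "B' \<subseteq> B" "\<forall>h\<in>B'. Gd b' h {x} {}" by (elim exE bexE conjE) (rule that)
    have "b' \<noteq> b"
    proof
      assume "b' = b"
      then have "\<exists>x\<in>X1. \<exists>B'\<in>W. B' \<subseteq> B1 \<and> (\<forall>h\<in>B'. Gd b h {x} {})"
        using B' B x by (intro bexI[of _ x] bexI[of _ B'] conjI) auto
      with no show False ..
    qed
    then have "b' = (\<not> b)" by simp
    with B' B show "\<exists>B'\<in>{B \<in> W. B \<subseteq> B1}. B' \<subseteq> B \<and> (\<forall>h\<in>B'. Gd (\<not> b) h {x} {})"
      by (intro bexI[of _ B'] conjI) auto
  qed
qed

lemma contradiction: False
proof (cases "\<forall>b. available open_world b X")
  case False
  then obtain b where "\<not> available open_world b X" by blast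
  then obtain B1 X1 where B1: "B1 \<in> open_world" and X1: "X1 \<subseteq> X" "infinite X1" and
    st: "\<And>B x. B \<in> {B \<in> open_world. B \<subseteq> B1} \<Longrightarrow> x \<in> X1 \<Longrightarrow> \<exists>B'\<in>{B \<in> open_world. B \<subseteq> B1}. B' \<subseteq> B \<and> (\<forall>h\<in>B'. Gd (\<not> b) h {x} {})"
    by (rule strong_of_not_available[OF world_open_world]) blast
  have o: "row_open B1" "B1 \<subseteq> C" using B1 by (simp_all add: open_world_def)
  have "available {B \<in> open_world. B \<subseteq> B1} (\<not> b) X1" unfolding available_def
  proof (intro ballI allI impI)
    fix B X' assume B: "B \<in> {B \<in> open_world. B \<subseteq> B1}" and X': "X' \<subseteq> X1" "infinite X'"
    then obtain x where "x \<in> X'" using infinite_pick by blast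
    with st[OF B, of x] X' show "\<exists>x\<in>X'. \<exists>B'\<in>{B \<in> open_world. B \<subseteq> B1}. B' \<subseteq> B \<and> (\<forall>h\<in>B'. Gd (\<not> b) h {x} {})"
      by (intro bexI[of _ x]) auto
  qed
  from hit_free_of_available[OF o(2,1) this] show False
    using one_color[OF world_restrict[OF world_open_world] _ o st X1] B1 by blast
next
  case True
  have e: "{B \<in> open_world. B \<subseteq> C} = open_world" by (auto simp: open_world_def)
  have nh: "hit_free b C X" for b
    by (rule hit_free_of_available[OF order_refl row_open_cone]) (use True in \<open>simp add: e\<close>)
  show False
  proof (cases "\<forall>b. available dense_world b X")
    case True
    then show False using two_colors nh by blast
  next
    case False
    then obtain b where "\<not> available dense_world b X" by blast
    then obtain B1 X1 where B1: "B1 \<in> dense_world" and X1: "X1 \<subseteq> X" "infinite X1" and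
      st: "\<And>B x. B \<in> {B \<in> dense_world. B \<subseteq> B1} \<Longrightarrow> x \<in> X1 \<Longrightarrow> \<exists>B'\<in>{B \<in> dense_world. B \<subseteq> B1}. B' \<subseteq> B \<and> (\<forall>h\<in>B'. Gd (\<not> b) h {x} {})"
      by (rule strong_of_not_available[OF world_dense_world]) blast
    have "\<And>B. B \<in> {B \<in> dense_world. B \<subseteq> B1} \<Longrightarrow> B \<subseteq> C" by (auto simp: dense_world_def)
    from one_color[OF world_restrict[OF world_dense_world] this row_open_cone order_refl st X1 hit_free_sub[OF nh X1(1)]] B1
    show False by blast
  qed
qed

end

subsection \<open>Solutions of instances computed by a generic coloring\<close>

definition val :: "recf \<Rightarrow> coloring \<Rightarrow> nat \<Rightarrow> nat \<Rightarrow> bool \<Rightarrow> bool" where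
  "val p h x u b \<longleftrightarrow> x < u \<and> reval (col_code h) p [prod_encode (x, u)] (if b then 1 else 0)"

lemma val_less: "val p h x u b \<Longrightarrow> x < u"
  by (simp add: val_def)

lemma val_det: "val p h x u b \<Longrightarrow> val p h x u b' \<Longrightarrow> b = b'"
  unfolding val_def by (metis reval_det zero_neq_one)

lemma val_cont:
  assumes "val p h x u b" shows "\<exists>M. \<forall>h'\<in>sq h M. val p h' x u b"
proof -
  obtain N where N: "\<forall>c. (\<forall>i<N. c i = col_code h i) \<longrightarrow>
      reval c p [prod_encode (x, u)] (if b then 1 else 0)"
    using assms reval_use unfolding val_def by blast
  have "val p h' x u b" if h': "h' \<in> sq h N" for h'
  proof -
    have "col_code h' i = col_code h i" if "i < N" for i
    proof -
      obtain y z where yz: "prod_decode i = (y, z)" by (cases "prod_decode i")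
      then have "i = prod_encode (y, z)" by (metis prod_decode_inverse)
      \<comment> \<open>A pair code bounds both of its components, so an oracle prefix of length N
        only inspects the square of size N.\<close>
      then have "y < N" "z < N" using le_prod_encode_1[of y z] le_prod_encode_2[of z y] that by simp_all
      then show ?thesis using h' yz by (simp add: col_code_def sq_def)
    qed
    then show ?thesis using N assms by (simp add: val_def)
  qed
  then show ?thesis by blast
qed

text \<open>For an arbitrary index e only answers 1 are recorded; the computation may diverge or
  return other values, and then the number is simply not listed.\<close>

definition left :: "recf \<Rightarrow> nat set \<Rightarrow> nat set" where
  "left e S = {a. reval (chr S) e [2 * a] 1}"

definition right :: "recf \<Rightarrow> nat set \<Rightarrow> nat set" where
  "right e S = {y. reval (chr S) e [2 * y + 1] 1}"

lemma mem_join: "i \<in> join A B \<longleftrightarrow> (if even i then i div 2 \<in> A else i div 2 \<in> B)"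
proof (cases "even i")
  case True
  then obtain j where "i = 2 * j" by (rule evenE)
  then show ?thesis unfolding join_def by (auto, presburger)
next
  case False
  then obtain j where "i = 2 * j + 1" by (rule oddE)
  then show ?thesis unfolding join_def by (auto, presburger)
qed

lemma join_agree:
  assumes "L' \<inter> {..<N} = L \<inter> {..<N}" "R' \<inter> {..<N} = R \<inter> {..<N}" "i < N"
  shows "chr (join L' R') i = chr (join L R) i"
proof -
  have "i div 2 < N" using assms(3) by simp
  then have "i div 2 \<in> L' \<longleftrightarrow> i div 2 \<in> L" "i div 2 \<in> R' \<longleftrightarrow> i div 2 \<in> R" using assms(1,2) by blast+
  then show ?thesis by (simp add: chr_def mem_join)
qed

lemma reval_join_cont:
  assumes "reval (chr (join L R)) e xs y"
  shows "\<exists>N. \<forall>L' R'. L' \<inter> {..<N} = L \<inter> {..<N} \<longrightarrow> R' \<inter> {..<N} = R \<inter> {..<N} \<longrightarrow>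
    reval (chr (join L' R')) e xs y"
proof -
  obtain N where N: "\<forall>c. (\<forall>i<N. c i = chr (join L R) i) \<longrightarrow> reval c e xs y" using reval_use[OF assms] by blast
  have "reval (chr (join L' R')) e xs y" if "L' \<inter> {..<N} = L \<inter> {..<N}" "R' \<inter> {..<N} = R \<inter> {..<N}" for L' R'
    using N join_agree[OF that] by blast
  then show ?thesis by blast
qed

lemma Un_agree: "L' \<inter> {..<N} = L \<inter> {..<N} \<Longrightarrow> (F \<union> L') \<inter> {..<N} = (F \<union> L) \<inter> {..<N}" for N :: nat
  by blast

lemma fcont_left: "fcont (\<lambda>L R. left e (join (F \<union> L) (E \<union> R)))"
  unfolding fcont_def
proof (intro allI impI)
  fix L R a assume "a \<in> left e (join (F \<union> L) (E \<union> R))"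
  then have "reval (chr (join (F \<union> L) (E \<union> R))) e [2 * a] 1" by (simp add: left_def)
  from reval_join_cont[OF this] obtain N where
    N: "\<forall>L' R'. L' \<inter> {..<N} = (F \<union> L) \<inter> {..<N} \<longrightarrow> R' \<inter> {..<N} = (E \<union> R) \<inter> {..<N} \<longrightarrow>
      reval (chr (join L' R')) e [2 * a] 1" by (elim exE) (rule that)
  have "a \<in> left e (join (F \<union> L') (E \<union> R'))"
    if "L' \<inter> {..<N} = L \<inter> {..<N}" "R' \<inter> {..<N} = R \<inter> {..<N}" for L' R'
    using N[rule_format, OF Un_agree[OF that(1)] Un_agree[OF that(2)]] by (simp add: left_def)
  then show "\<exists>N. \<forall>L' R'. L' \<inter> {..<N} = L \<inter> {..<N} \<longrightarrow> R' \<inter> {..<N} = R \<inter> {..<N} \<longrightarrow>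
    a \<in> left e (join (F \<union> L') (E \<union> R'))" by (intro exI[of _ N] allI impI)
qed

lemma fcont_right: "fcont (\<lambda>L R. right e (join (F \<union> L) (E \<union> R)))"
  unfolding fcont_def
proof (intro allI impI)
  fix L R a assume "a \<in> right e (join (F \<union> L) (E \<union> R))"
  then have "reval (chr (join (F \<union> L) (E \<union> R))) e [2 * a + 1] 1" by (simp add: right_def)
  from reval_join_cont[OF this] obtain N where
    N: "\<forall>L' R'. L' \<inter> {..<N} = (F \<union> L) \<inter> {..<N} \<longrightarrow> R' \<inter> {..<N} = (E \<union> R) \<inter> {..<N} \<longrightarrow>
      reval (chr (join L' R')) e [2 * a + 1] 1" by (elim exE) (rule that)
  have "a \<in> right e (join (F \<union> L') (E \<union> R'))"
    if "L' \<inter> {..<N} = L \<inter> {..<N}" "R' \<inter> {..<N} = R \<inter> {..<N}" for L' R'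
    using N[rule_format, OF Un_agree[OF that(1)] Un_agree[OF that(2)]] by (simp add: right_def)
  then show "\<exists>N. \<forall>L' R'. L' \<inter> {..<N} = L \<inter> {..<N} \<longrightarrow> R' \<inter> {..<N} = R \<inter> {..<N} \<longrightarrow>
    a \<in> right e (join (F \<union> L') (E \<union> R'))" by (intro exI[of _ N] allI impI)
qed

section \<open>A countable supply of reservoirs, and the sets that the generic coloring has to
  decide\<close>

definition spoiled :: "recf \<Rightarrow> nat set \<Rightarrow> nat set \<Rightarrow> nat set \<Rightarrow> nat set \<Rightarrow> bool" where
  "spoiled e F E X Z \<longleftrightarrow> defeated (\<lambda>L R. left e (join L R)) (\<lambda>L R. right e (join L R)) F E X Z"

lemma defeated_spoiled:
  "defeated (\<lambda>L R. left e (join (F \<union> L) (E \<union> R))) (\<lambda>L R. right e (join (F \<union> L) (E \<union> R))) D G X Z =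
     spoiled e (F \<union> D) (E \<union> G) X Z"
  by (simp add: spoiled_def defeated_def Un_assoc)

text \<open>Choosing the refined reservoirs by a fixed choice function keeps the family of all reservoirs
  that can occur countable, so that f can be generic with respect to all of them.\<close>
definition refines :: "recf \<times> nat list \<times> nat list \<Rightarrow> nat set \<times> nat set \<Rightarrow> nat set \<times> nat set \<Rightarrow> bool" where
  "refines t XZ XZ' \<longleftrightarrow> fst XZ' \<subseteq> fst XZ \<and> infinite (fst XZ') \<and> snd XZ' \<subseteq> snd XZ \<and> infinite (snd XZ') \<and>
     spoiled (fst t) (set (fst (snd t))) (set (snd (snd t))) (fst XZ') (snd XZ')"

fun res :: "(recf \<times> nat list \<times> nat list) list \<Rightarrow> nat set \<times> nat set" where
  "res [] = (UNIV, UNIV)"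
| "res (t # ts) = (if \<exists>XZ'. refines t (res ts) XZ' then SOME XZ'. refines t (res ts) XZ' else res ts)"

lemma refines_res: "refines t (res ts) XZ' \<Longrightarrow> refines t (res ts) (res (t # ts))"
proof -
  assume r: "refines t (res ts) XZ'"
  then have "res (t # ts) = (SOME XZ'. refines t (res ts) XZ')" by (simp only: res.simps) (meson r)
  with someI[of "refines t (res ts)", OF r] show ?thesis by (simp only:)
qed

lemma infinite_res: "infinite (fst (res ts)) \<and> infinite (snd (res ts))"
proof (induction ts)
  case (Cons t ts)
  show ?case
  proof (cases "\<exists>XZ'. refines t (res ts) XZ'")
    case True
    then obtain XZ' where "refines t (res ts) XZ'" ..
    from refines_res[OF this] show ?thesis unfolding refines_def by blast
  next
    case False
    then have e: "res (t # ts) = res ts" unfolding res.simps by (rule if_not_P)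
    show ?thesis unfolding e by (rule Cons)
  qed
qed simp

definition decides :: "coloring \<Rightarrow> coloring set \<Rightarrow> bool" where
  "decides f W \<longleftrightarrow> (\<exists>N. cone f N \<subseteq> W) \<or> (\<exists>N. \<forall>h\<in>cone f N. \<forall>M. \<not> cone h M \<subseteq> W)"

lemma decides_not_mem:
  assumes "decides f W" "stable f" "f \<notin> W"
  shows "\<exists>N. \<forall>h\<in>cone f N. \<forall>M. \<not> cone h M \<subseteq> W"
  using assms cone_self unfolding decides_def by blast

definition taskL :: "(bool \<Rightarrow> recf \<times> nat list \<times> nat list) \<Rightarrow> bool \<Rightarrow> nat set \<Rightarrow> nat set \<Rightarrow> nat set" where
  "taskL t b L R = left (fst (t b)) (join (set (fst (snd (t b))) \<union> L) (set (snd (snd (t b))) \<union> R))"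

definition taskR :: "(bool \<Rightarrow> recf \<times> nat list \<times> nat list) \<Rightarrow> bool \<Rightarrow> nat set \<Rightarrow> nat set \<Rightarrow> nat set" where
  "taskR t b L R = right (fst (t b)) (join (set (fst (snd (t b))) \<union> L) (set (snd (snd (t b))) \<union> R))"

text \<open>The set for limits collects late occurrences of one color; the next two collect
  colorings below which a value or a color is excluded for good. For the index computing g from f,
  the coloring f lies in neither of those two, so on a cone of f such exclusion is nowhere
  forced.\<close>

definition S_lim :: "recf \<Rightarrow> nat \<Rightarrow> bool \<Rightarrow> nat \<Rightarrow> coloring set" where
  "S_lim p x b m = {h. \<exists>u\<ge>m. val p h x u b}"
definition S_tot :: "recf \<Rightarrow> coloring set" where
  "S_tot p = {h. \<exists>x u N. x < u \<and> (\<forall>h'\<in>cone h N. \<forall>b. \<not> val p h' x u b)}"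
definition S_col :: "recf \<Rightarrow> coloring set" where
  "S_col p = {h. \<exists>x N. \<forall>h'\<in>cone h N. \<forall>b. \<not> locked (val p) b h' {x} {}}"
definition S_target :: "recf \<Rightarrow> recf \<times> nat list \<times> nat list \<Rightarrow> recf \<times> nat list \<times> nat list \<Rightarrow> nat \<Rightarrow>
    (recf \<times> nat list \<times> nat list) list \<Rightarrow> coloring set" where
  "S_target p t0 t1 k s = {h. target (val p) (taskL (\<lambda>b. if b then t1 else t0)) (taskR (\<lambda>b. if b then t1 else t0))
     (fst (res s) \<inter> {k..}) (snd (res s) \<inter> {k..}) h}"

lemma generic_for_all:
  "\<exists>f. stable f \<and> (\<forall>p x b m. decides f (S_lim p x b m)) \<and> (\<forall>p. decides f (S_tot p)) \<and>
     (\<forall>p. decides f (S_col p)) \<and> (\<forall>p t0 t1 k s. decides f (S_target p t0 t1 k s))"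
proof -
  let ?A = "range (\<lambda>(p, x, b, m). S_lim p x b m)" and ?D = "range (\<lambda>(p, t0, t1, k, s). S_target p t0 t1 k s)"
  define S where "S = ?A \<union> range S_tot \<union> range S_col \<union> ?D"
  have "countable S" unfolding S_def by (intro countable_Un countable_image countableI_type)
  have ne: "S \<noteq> {}" by (auto simp: S_def)
  obtain f where f: "stable f" "\<forall>i. decides f (from_nat_into S i)"
    using generic_exists[of "from_nat_into S"] unfolding decides_def by blast
  have d: "decides f W" if "W \<in> S" for W
    using f(2) from_nat_into_surj[OF \<open>countable S\<close> that] by metis
  have "S_lim p x b m \<in> ?A" for p x b m by (rule range_eqI[of _ _ "(p, x, b, m)"]) simp
  moreover have "S_target p t0 t1 k s \<in> ?D" for p t0 t1 k s by (rule range_eqI[of _ _ "(p, t0, t1, k, s)"]) simp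
  ultimately show ?thesis using f(1) d unfolding S_def by (intro exI[of _ f]) simp
qed

text \<open>The right side is infinite, so row a takes the constant color infinitely often and has
  it as limit; row y is treated in the same way by means of the left side.\<close>

lemma p_hom_not_bad:
  assumes "p_hom f Y" "stable f" "2 * a \<in> Y" "2 * y + 1 \<in> Y"
  shows "\<not> bad f a y"
proof
  assume bad: "bad f a y"
  obtain A B c where Y: "Y = join A B" "infinite A" "infinite B"
    and c: "\<forall>x\<in>A. \<forall>y\<in>B. x \<noteq> y \<longrightarrow> f (min x y) (max x y) = c"
    using assms(1) unfolding p_hom_def by blast
  have a: "a \<in> A" "y \<in> B" using assms(3,4) unfolding Y(1) by (simp_all add: mem_join)
  have "lims f a c"
  proof -
    obtain l N where l: "\<forall>u>N. f a u = l" using assms(2) unfolding stable_def by blast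
    obtain u where u: "u \<in> B" "Suc (max a N) \<le> u" using infinite_pick[OF Y(3)] by blast
    have "a < u" "N < u" using u(2) by simp_all
    then have "f (min a u) (max a u) = c" using bspec[OF bspec[OF c a(1)] u(1)] by simp
    then have "f a u = c" using \<open>a < u\<close> by simp
    then have "l = c" using l \<open>N < u\<close> by simp
    with l show ?thesis unfolding lims_def by blast
  qed
  moreover have "lims f y c"
  proof -
    obtain l N where l: "\<forall>u>N. f y u = l" using assms(2) unfolding stable_def by blast
    obtain u where u: "u \<in> A" "Suc (max y N) \<le> u" using infinite_pick[OF Y(2)] by blast
    have "y < u" "N < u" using u(2) by simp_all
    then have "f (min u y) (max u y) = c" using bspec[OF bspec[OF c u(1)] a(2)] by simp
    then have "f y u = c" using \<open>y < u\<close> by simp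
    then have "l = c" using l \<open>N < u\<close> by simp
    with l show ?thesis unfolding lims_def by blast
  qed
  moreover have "a \<noteq> y" using bad by (simp add: bad_def)
  then have "f (min a y) (max a y) = c" using bspec[OF bspec[OF c a(1)] a(2)] by simp
  ultimately have "\<exists>l. lims f a l \<and> lims f y l \<and> f (min a y) (max a y) = l" by (intro exI[of _ c] conjI)
  with bad show False unfolding bad_def by simp
qed

section \<open>The target holds at the generic coloring\<close>

locale generic =
  fixes f g :: coloring and p :: recf
  assumes f: "stable f" and lim: "\<And>x b m. decides f (S_lim p x b m)" and tot: "decides f (S_tot p)"
    and col: "decides f (S_col p)" and tar: "\<And>t0 t1 k s. decides f (S_target p t0 t1 k s)"
    and g: "stable g" and comp: "\<And>x. reval (col_code f) p [x] (col_code g x)"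
begin

lemma val_f: "x < u \<Longrightarrow> val p f x u b \<longleftrightarrow> g x u = b"
proof -
  assume "x < u"
  then have "val p f x u (g x u)" using comp[of "prod_encode (x, u)"] by (simp add: val_def col_code_def)
  then show ?thesis using val_det by blast
qed

lemma not_val_f: "\<not> val p f x u (\<not> b) \<Longrightarrow> x < u \<Longrightarrow> g x u = b"
  using val_f by blast

text \<open>Past the point where g settles at x, f shows no wrong color. Since f decides this, on
  some cone no coloring has a cone of wrong colors; but a single wrong value rests on a square and
  would already give such a cone.\<close>

lemma color_f: "\<exists>b. locked (val p) b f {x} {}"
proof -
  from g obtain b N where b: "\<forall>u>N. g x u = b" unfolding stable_def by blast
  have "f \<notin> S_lim p x (\<not> b) (Suc N)"
  proof
    assume "f \<in> S_lim p x (\<not> b) (Suc N)"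
    then obtain u where u: "u \<ge> Suc N" "val p f x u (\<not> b)" unfolding S_lim_def by blast
    then have "g x u = (\<not> b)" using val_f[OF val_less[OF u(2)]] by simp
    with b u(1) show False by simp
  qed
  from decides_not_mem[OF lim f this] obtain N' where
    N': "\<forall>h\<in>cone f N'. \<forall>M. \<not> cone h M \<subseteq> S_lim p x (\<not> b) (Suc N)" by blast
  have "\<not> val p h x u (\<not> b)" if h: "h \<in> cone f N'" and u: "u \<ge> Suc N" for h u
  proof
    assume "val p h x u (\<not> b)"
    then obtain M where M: "\<forall>h'\<in>sq h M. val p h' x u (\<not> b)" using val_cont by blast
    have "cone h M \<subseteq> S_lim p x (\<not> b) (Suc N)" using M u cone_sq[OF sq_self] unfolding S_lim_def by blast
    with N' h show False by blast
  qed
  then have "locked (val p) b f {x} {}" unfolding locked_def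
    by (intro exI[of _ N'] exI[of _ "Suc N"]) simp
  then show ?thesis ..
qed

text \<open>If \<open>target\<close> failed at f, the decisions made by f would provide all
  assumptions of \<open>core\<close> on a common cone.\<close>

lemma target_f:
  "target (val p) (taskL (\<lambda>b. if b then t1 else t0)) (taskR (\<lambda>b. if b then t1 else t0))
     (fst (res s) \<inter> {k..}) (snd (res s) \<inter> {k..}) f" (is "target ?V ?GL ?GR ?X ?Z f")
proof (rule ccontr)
  assume "\<not> target ?V ?GL ?GR ?X ?Z f"
  then have "f \<notin> S_target p t0 t1 k s" by (simp add: S_target_def)
  from decides_not_mem[OF tar f this] obtain n1 where
    n1: "\<forall>h\<in>cone f n1. \<forall>M. \<not> cone h M \<subseteq> S_target p t0 t1 k s" by blast
  have "f \<notin> S_tot p" using cone_self[OF f] val_f unfolding S_tot_def by blast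
  from decides_not_mem[OF tot f this] obtain n2 where n2: "\<forall>h\<in>cone f n2. \<forall>M. \<not> cone h M \<subseteq> S_tot p" by blast
  have "f \<notin> S_col p" using cone_self[OF f] color_f unfolding S_col_def by blast
  from decides_not_mem[OF col f this] obtain n3 where n3: "\<forall>h\<in>cone f n3. \<forall>M. \<not> cone h M \<subseteq> S_col p" by blast
  define n where "n = max n1 (max n2 n3)"
  have sub: "h \<in> cone f n1" "h \<in> cone f n2" "h \<in> cone f n3" if "h \<in> cone f n" for h
    using that by (auto simp: cone_def n_def)
  have "core ?V f n ?GL ?GR ?X ?Z"
  proof
    show "stable f" by (rule f)
    show "\<And>h x u b. val p h x u b \<Longrightarrow> x < u" by (rule val_less)
    show "\<And>h x u b b'. val p h x u b \<Longrightarrow> val p h x u b' \<Longrightarrow> b = b'" by (rule val_det)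
    show "\<And>h x u b. val p h x u b \<Longrightarrow> \<exists>M. \<forall>h'\<in>sq h M. val p h' x u b" by (rule val_cont)
    show "fcont (?GL b)" "fcont (?GR b)" for b unfolding taskL_def taskR_def by (rule fcont_left fcont_right)+
    show "infinite ?X" "infinite ?Z" using infinite_res infinite_Int_atLeast by blast+
    show "\<exists>h'\<in>cone h N. \<not> target ?V ?GL ?GR ?X ?Z h'" if "h \<in> cone f n" for h N
      using n1 sub(1)[OF that] unfolding S_target_def by blast
    show "\<exists>h'\<in>cone h N. \<exists>b. val p h' x u b" if h: "h \<in> cone f n" and "x < u" for h N x u
    proof (rule ccontr)
      assume no: "\<not> ?thesis"
      have "h' \<in> S_tot p" if "h' \<in> cone h N" for h'
        using no cone_trans[OF that order_refl] \<open>x < u\<close> unfolding S_tot_def by blast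
      with n2 sub(2)[OF h] show False by blast
    qed
    show "\<exists>h'\<in>cone h N. \<exists>b. locked (val p) b h' {x} {}" if h: "h \<in> cone f n" for h N x
    proof (rule ccontr)
      assume no: "\<not> ?thesis"
      have "h' \<in> S_col p" if "h' \<in> cone h N" for h'
        using no cone_trans[OF that order_refl] unfolding S_col_def by blast
      with n3 sub(3)[OF h] show False by blast
    qed
  qed
  then show False by (rule core.contradiction)
qed

section \<open>Construction of a solution of g that computes no solution of f\<close>

definition met :: "recf \<Rightarrow> nat set \<Rightarrow> nat set \<Rightarrow> nat \<Rightarrow> (recf \<times> nat list \<times> nat list) list \<Rightarrow> bool" where
  "met e F E k s \<longleftrightarrow> (\<exists>a y. bad f a y \<and> (\<forall>L R. L \<inter> {..<k} = F \<inter> {..<k} \<longrightarrow> R \<inter> {..<k} = E \<inter> {..<k} \<longrightarrow>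
       a \<in> left e (join L R) \<and> y \<in> right e (join L R))) \<or> spoiled e F E (fst (res s)) (snd (res s))"

text \<open>The last clause places k beyond the points where the rows in F settle. Right elements
  taken from k on are then automatically compatible with the left side; this is the sparseness of
  the right side.\<close>

definition cond :: "bool \<Rightarrow> nat set \<Rightarrow> nat set \<Rightarrow> nat \<Rightarrow> bool" where
  "cond b F E k \<longleftrightarrow> finite F \<and> finite E \<and> F \<subseteq> {..<k} \<and> E \<subseteq> {..<k} \<and>
     (\<forall>x\<in>F. \<forall>r\<in>E. x < r \<longrightarrow> g x r = b) \<and> (\<forall>x\<in>F. \<forall>r\<ge>k. g x r = b)"

text \<open>Old left elements accept G because G starts at k, new left elements lie above all of E,
  and the new bound only has to pass the points where the rows in D settle.\<close>

lemma cond_extend: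
  assumes c: "cond b F E k" and D: "finite D" "D \<subseteq> {k..}" "\<And>x. x \<in> D \<Longrightarrow> lims g x b"
    and G: "finite G" "G \<subseteq> {k..}" "\<And>x r. x \<in> D \<Longrightarrow> r \<in> G \<Longrightarrow> x < r \<Longrightarrow> g x r = b"
  shows "\<exists>m. \<forall>k'\<ge>m. cond b (F \<union> D) (E \<union> G) k'"
proof -
  have "\<forall>x. \<exists>N. x \<in> D \<longrightarrow> (\<forall>u>N. g x u = b)" using D(3) unfolding lims_def by blast
  then obtain N where N: "\<And>x u. x \<in> D \<Longrightarrow> u > N x \<Longrightarrow> g x u = b" by metis
  obtain m where m: "\<forall>r\<in>insert k (F \<union> D \<union> E \<union> G \<union> N ` D). r < m"
    using above_finite[of "insert k (F \<union> D \<union> E \<union> G \<union> N ` D)"] c D(1) G(1) unfolding cond_def by auto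
  have "cond b (F \<union> D) (E \<union> G) k'" if k': "m \<le> k'" for k'
  proof -
    have lt: "r < k'" if "r \<in> insert k (F \<union> D \<union> E \<union> G \<union> N ` D)" for r
      using bspec[OF m that] k' by simp
    have F: "finite F" "finite E" "F \<subseteq> {..<k}" "E \<subseteq> {..<k}" "\<And>x r. x \<in> F \<Longrightarrow> r \<in> E \<Longrightarrow> x < r \<Longrightarrow> g x r = b"
      "\<And>x r. x \<in> F \<Longrightarrow> r \<ge> k \<Longrightarrow> g x r = b" using c unfolding cond_def by blast+
    show ?thesis
      unfolding cond_def
    proof (intro conjI ballI allI impI)
      show "finite (F \<union> D)" "finite (E \<union> G)" using F D G by simp_all
      show "F \<union> D \<subseteq> {..<k'}" "E \<union> G \<subseteq> {..<k'}" using lt by auto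
      show "g x r = b" if "x \<in> F \<union> D" "r \<in> E \<union> G" "x < r" for x r
      proof (cases "x \<in> F")
        case True
        then show ?thesis using F(5,6) that G(2) by fastforce
      next
        case False
        then have x: "x \<in> D" using that by blast
        then have "r \<notin> E" using D(2) F(4) that(3) by fastforce
        then show ?thesis using G(3) x that by blast
      qed
      show "g x r = b" if "x \<in> F \<union> D" "r \<ge> k'" for x r
      proof (cases "x \<in> F")
        case True
        have "k < k'" using lt by simp
        then show ?thesis using F(6)[OF True] that by simp
      next
        case False
        then have x: "x \<in> D" using that by blast
        then have "N x < k'" using lt by simp
        then show ?thesis using N[OF x] that(2) by simp
      qed
    qed
  qed
  then show ?thesis by blast
qed

text \<open>Two conditions with two indices are submitted, one per color, and only one of them is
  served; which color b that is depends on \<open>target\<close> and cannot be chosen.\<close>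

lemma task_step:
  fixes F E :: "bool \<Rightarrow> nat set"
  assumes fin: "\<And>b. finite (F b)" "\<And>b. finite (E b)"
  obtains b D G s' m where "finite D" "finite G" "D \<subseteq> fst (res s) \<inter> {k..}" "G \<subseteq> snd (res s) \<inter> {k..}"
    "\<And>x. x \<in> D \<Longrightarrow> lims g x b" "\<And>x r. x \<in> D \<Longrightarrow> r \<in> G \<Longrightarrow> x < r \<Longrightarrow> g x r = b"
    "fst (res s') \<subseteq> fst (res s)" "snd (res s') \<subseteq> snd (res s)"
    "\<And>k'. m \<le> k' \<Longrightarrow> met (e b) (F b \<union> D) (E b \<union> G) k' s'"
proof -
  have "\<forall>b. \<exists>l. set l = F b" "\<forall>b. \<exists>l. set l = E b" using fin finite_list by blast+
  then obtain lF lE where l: "\<And>b. set (lF b) = F b" "\<And>b. set (lE b) = E b" by metis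
  define t where "t b = (e b, lF b, lE b)" for b
  have tt: "(\<lambda>b. if b then t True else t False) = t" by (rule ext) simp
  let ?X = "fst (res s) \<inter> {k..}" and ?Z = "snd (res s) \<inter> {k..}"
  have tg: "target (val p) (taskL t) (taskR t) ?X ?Z f" using target_f[of "t True" "t False" s k] unfolding tt .
  have tL: "taskL t b = (\<lambda>L R. left (e b) (join (F b \<union> L) (E b \<union> R)))"
    and tR: "taskR t b = (\<lambda>L R. right (e b) (join (F b \<union> L) (E b \<union> R)))" for b
    by (simp_all add: taskL_def taskR_def t_def l fun_eq_iff)
  from tg[unfolded target_def] obtain b D G where
    D: "finite D" "finite G" "D \<subseteq> ?X" "G \<subseteq> ?Z" and good: "good (val p) b f D G" and
    alt: "(\<exists>a\<in>taskL t b D G. \<exists>y\<in>taskR t b D G. bad f a y) \<or>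
      (\<exists>X' Z'. X' \<subseteq> ?X \<and> infinite X' \<and> Z' \<subseteq> ?Z \<and> infinite Z' \<and> defeated (taskL t b) (taskR t b) D G X' Z')"
    by (elim exE conjE) (rule that)
  have lims: "lims g x b" if "x \<in> D" for x
  proof -
    from bspec[OF conjunct1[OF good[unfolded good_def]] that] obtain m where
      m: "\<forall>u\<ge>m. \<not> val p f x u (\<not> b)" by (elim exE) (rule that)
    have "g x u = b" if "u > max m x" for u
      by (rule not_val_f) (use m that in auto)
    then show ?thesis unfolding lims_def by (intro exI[of _ "max m x"] allI impI)
  qed
  have compat: "g x r = b" if "x \<in> D" "r \<in> G" "x < r" for x r
    by (rule not_val_f[OF bspec[OF bspec[OF conjunct2[OF good[unfolded good_def]] that(1)] that(2)] that(3)])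
  have "\<exists>s' m. fst (res s') \<subseteq> fst (res s) \<and> snd (res s') \<subseteq> snd (res s) \<and>
    (\<forall>k'\<ge>m. met (e b) (F b \<union> D) (E b \<union> G) k' s')"
    using alt
  proof
    assume "\<exists>a\<in>taskL t b D G. \<exists>y\<in>taskR t b D G. bad f a y"
    then obtain a y where ay: "a \<in> taskL t b D G" "y \<in> taskR t b D G" "bad f a y" by blast
    from ay(1) have "reval (chr (join (F b \<union> D) (E b \<union> G))) (e b) [2 * a] 1" by (simp add: tL left_def)
    from reval_join_cont[OF this] obtain m1 where m1: "\<forall>L R. L \<inter> {..<m1} = (F b \<union> D) \<inter> {..<m1} \<longrightarrow>
      R \<inter> {..<m1} = (E b \<union> G) \<inter> {..<m1} \<longrightarrow> reval (chr (join L R)) (e b) [2 * a] 1" by (elim exE) (rule that)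
    from ay(2) have "reval (chr (join (F b \<union> D) (E b \<union> G))) (e b) [2 * y + 1] 1" by (simp add: tR right_def)
    from reval_join_cont[OF this] obtain m2 where m2: "\<forall>L R. L \<inter> {..<m2} = (F b \<union> D) \<inter> {..<m2} \<longrightarrow>
      R \<inter> {..<m2} = (E b \<union> G) \<inter> {..<m2} \<longrightarrow> reval (chr (join L R)) (e b) [2 * y + 1] 1" by (elim exE) (rule that)
    have "met (e b) (F b \<union> D) (E b \<union> G) k' s" if k': "max m1 m2 \<le> k'" for k'
      unfolding met_def
    proof (intro disjI1 exI conjI allI impI)
      show "bad f a y" by (rule ay)
      fix L R assume LR: "L \<inter> {..<k'} = (F b \<union> D) \<inter> {..<k'}" "R \<inter> {..<k'} = (E b \<union> G) \<inter> {..<k'}"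
      have lt: "x < k'" if "x < m1 \<or> x < m2" for x using that k' by auto
      have 1: "L \<inter> {..<m1} = (F b \<union> D) \<inter> {..<m1}" "R \<inter> {..<m1} = (E b \<union> G) \<inter> {..<m1}" using LR lt by blast+
      have 2: "L \<inter> {..<m2} = (F b \<union> D) \<inter> {..<m2}" "R \<inter> {..<m2} = (E b \<union> G) \<inter> {..<m2}" using LR lt by blast+
      show "a \<in> left (e b) (join L R)" using m1[rule_format, OF 1] by (simp add: left_def)
      show "y \<in> right (e b) (join L R)" using m2[rule_format, OF 2] by (simp add: right_def)
    qed
    then show ?thesis by (intro exI[of _ s] exI[of _ "max m1 m2"]) blast
  next
    assume "\<exists>X' Z'. X' \<subseteq> ?X \<and> infinite X' \<and> Z' \<subseteq> ?Z \<and> infinite Z' \<and> defeated (taskL t b) (taskR t b) D G X' Z'"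
    then obtain X' Z' where X': "X' \<subseteq> ?X" "infinite X'" "Z' \<subseteq> ?Z" "infinite Z'"
      "spoiled (e b) (F b \<union> D) (E b \<union> G) X' Z'" unfolding tL tR defeated_spoiled by (elim exE conjE) (rule that)
    obtain l1 l2 where l12: "set l1 = F b \<union> D" "set l2 = E b \<union> G"
      using finite_list[of "F b \<union> D"] finite_list[of "E b \<union> G"] fin D by auto
    define t' where "t' = (e b, l1, l2)"
    \<comment> \<open>The reservoirs found here are arbitrary sets. They only witness that a
      refinement exists; the one actually used is the chosen one, so that it remains in the
      countable family.\<close>
    have "refines t' (res s) (X', Z')" using X' by (simp add: refines_def t'_def l12)
    from refines_res[OF this] have r: "refines t' (res s) (res (t' # s))" .
    have t': "fst t' = e b" "set (fst (snd t')) = F b \<union> D" "set (snd (snd t')) = E b \<union> G"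
      by (simp_all add: t'_def l12)
    have "spoiled (e b) (F b \<union> D) (E b \<union> G) (fst (res (t' # s))) (snd (res (t' # s)))"
      using r unfolding refines_def t' by (elim conjE)
    then have "met (e b) (F b \<union> D) (E b \<union> G) k' (t' # s)" for k'
      unfolding met_def by (rule disjI2)
    moreover have "fst (res (t' # s)) \<subseteq> fst (res s)" "snd (res (t' # s)) \<subseteq> snd (res s)"
      using r unfolding refines_def by blast+
    ultimately show ?thesis by (intro exI[of _ "t' # s"] exI[of _ 0]) blast
  qed
  then obtain s' m where "fst (res s') \<subseteq> fst (res s)" "snd (res s') \<subseteq> snd (res s)"
    "\<forall>k'\<ge>m. met (e b) (F b \<union> D) (E b \<union> G) k' s'" by blast
  with D lims compat show ?thesis by (intro that[of D G b s' m]) blast+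
qed

definition solvable :: bool where
  "solvable \<longleftrightarrow> (\<exists>Y. inc_p_hom g Y \<and> \<not> (\<exists>Y'. p_hom f Y' \<and> turing_le (chr Y') (chr Y)))"

definition extends :: "bool \<Rightarrow> (recf \<times> nat list \<times> nat list) list \<Rightarrow> nat set \<Rightarrow> nat set \<Rightarrow> nat \<Rightarrow> recf \<Rightarrow> bool" where
  "extends b s F E k e \<longleftrightarrow> (\<exists>F' E' k' s'. cond b F' E' k' \<and> k \<le> k' \<and> F \<subseteq> F' \<and> F' \<subseteq> F \<union> fst (res s) \<inter> {k..} \<and>
     E \<subseteq> E' \<and> E' \<subseteq> E \<union> snd (res s) \<inter> {k..} \<and> fst (res s') \<subseteq> fst (res s) \<and> snd (res s') \<subseteq> snd (res s) \<and>
     met e F' E' k' s')"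

lemma extendsI:
  assumes "cond b F E k" "finite D" "finite G" "D \<subseteq> fst (res s) \<inter> {k1..}" "G \<subseteq> snd (res s) \<inter> {k1..}" "k \<le> k1"
    "\<And>x. x \<in> D \<Longrightarrow> lims g x b" "\<And>x r. x \<in> D \<Longrightarrow> r \<in> G \<Longrightarrow> x < r \<Longrightarrow> g x r = b"
    "fst (res s') \<subseteq> fst (res s)" "snd (res s') \<subseteq> snd (res s)"
    "\<And>k'. m \<le> k' \<Longrightarrow> met e (F \<union> D) (E \<union> G) k' s'"
  shows "extends b s F E k e"
proof -
  have DG: "D \<subseteq> {k..}" "G \<subseteq> {k..}" using assms(4-6) by auto
  obtain m' where m': "\<forall>k'\<ge>m'. cond b (F \<union> D) (E \<union> G) k'"
    using cond_extend[OF assms(1,2) DG(1) assms(7) assms(3) DG(2) assms(8)] by blast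
  let ?k = "max k (max m m')"
  show ?thesis unfolding extends_def
  proof (intro exI conjI)
    show "cond b (F \<union> D) (E \<union> G) ?k" using m' by simp
    show "met e (F \<union> D) (E \<union> G) ?k s'" by (rule assms(11)) simp
    show "fst (res s') \<subseteq> fst (res s)" "snd (res s') \<subseteq> snd (res s)" by fact+
  qed (use assms(4,5) DG in auto)
qed

text \<open>S describes reservoirs on which color b stays possible. Each round adds one element to
  either side, so that both become infinite, and meets the requirement of the next index; all
  indices are run through by \<open>from_nat\<close>.\<close>

lemma solvable_of_extends:
  assumes s0: "S s0" and c0: "cond b F0 E0 k0"
    and S_inf: "\<And>s. S s \<Longrightarrow> infinite (fst (res s) \<inter> {x. lims g x b})"
    and S_sub: "\<And>s s'. S s \<Longrightarrow> fst (res s') \<subseteq> fst (res s) \<Longrightarrow> snd (res s') \<subseteq> snd (res s) \<Longrightarrow> S s'"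
    and ext: "\<And>s F E k e. S s \<Longrightarrow> cond b F E k \<Longrightarrow> extends b s F E k e"
  shows solvable
proof -
  let ?P = "\<lambda>F E k s (_ :: unit). cond b F E k \<and> S s"
  let ?Q = "\<lambda>(i :: nat) F E k s (_ :: unit) F' E' k' s' (_ :: unit). k \<le> k' \<and> F \<subseteq> F' \<and> F' \<subseteq> F \<union> fst (res s) \<inter> {k..} \<and>
     E \<subseteq> E' \<and> E' \<subseteq> E \<union> snd (res s) \<inter> {k..} \<and> fst (res s') \<subseteq> fst (res s) \<and> snd (res s') \<subseteq> snd (res s) \<and>
     met (from_nat i) F' E' k' s' \<and> (\<exists>x\<in>F'. k \<le> x) \<and> (\<exists>z\<in>E'. k \<le> z)"
  have step: "\<exists>F' E' k' s' u'. ?P F' E' k' s' u' \<and> ?Q i F E k s u F' E' k' s' u'"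
    if P: "?P F E k s u" for F E k s i and u :: unit
  proof -
    have c: "cond b F E k" and S: "S s" using P by blast+
    obtain x where x: "x \<in> fst (res s)" "lims g x b" "k \<le> x" using infinite_pick[OF S_inf[OF S]] by blast
    obtain k1 where k1: "\<forall>k'\<ge>k1. cond b (F \<union> {x}) (E \<union> {}) k'"
      using cond_extend[OF c, of "{x}" "{}"] x by auto
    define k2 where "k2 = max k k1"
    have c2: "cond b (F \<union> {x}) (E \<union> {}) k2" using k1 by (simp add: k2_def)
    have "infinite (snd (res s))" using infinite_res by blast
    from infinite_pick[OF this] obtain z where z: "z \<in> snd (res s)" "k2 \<le> z" by blast
    obtain k3 where k3: "\<forall>k'\<ge>k3. cond b (F \<union> {x} \<union> {}) (E \<union> {} \<union> {z}) k'"
      using cond_extend[OF c2, of "{}" "{z}"] z by auto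
    define k4 where "k4 = max k2 k3"
    have c4: "cond b (insert x F) (insert z E) k4" using k3 by (simp add: k4_def)
    from ext[OF S c4, of "from_nat i"] obtain F' E' k' s' where
      e: "cond b F' E' k'" "k4 \<le> k'" "insert x F \<subseteq> F'" "F' \<subseteq> insert x F \<union> fst (res s) \<inter> {k4..}"
      "insert z E \<subseteq> E'" "E' \<subseteq> insert z E \<union> snd (res s) \<inter> {k4..}"
      "fst (res s') \<subseteq> fst (res s)" "snd (res s') \<subseteq> snd (res s)" "met (from_nat i) F' E' k' s'"
      unfolding extends_def by (elim exE conjE) (rule that)
    have k: "k \<le> k4" "k \<le> k2" by (simp_all add: k4_def k2_def)
    then have "{k4..} \<subseteq> {k..}" by simp
    then have sub: "F' \<subseteq> F \<union> fst (res s) \<inter> {k..}" "E' \<subseteq> E \<union> snd (res s) \<inter> {k..}"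
      using e(4,6) x z k by auto
    have le: "k \<le> k'" "F \<subseteq> F'" "E \<subseteq> E'" "x \<in> F'" "z \<in> E'" "k \<le> z" using e(2,3,5) k z by auto
    have "?P F' E' k' s' ()" using e(1) S_sub[OF S e(7,8)] by blast
    moreover have "?Q i F E k s u F' E' k' s' ()"
    proof (intro conjI le(1-3) sub e(7-9))
      show "\<exists>x\<in>F'. k \<le> x" using x(3) le(4) by blast
      show "\<exists>z\<in>E'. k \<le> z" using le(5,6) by blast
    qed
    ultimately show ?thesis by blast
  qed
  have "\<exists>Fs Es ks ss us. Fs 0 = F0 \<and> Es 0 = E0 \<and> ks 0 = k0 \<and> ss 0 = s0 \<and> us 0 = () \<and>
    (\<forall>i. ?P (Fs i) (Es i) (ks i) (ss i) (us i) \<and> ?Q i (Fs i) (Es i) (ks i) (ss i) (us i)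
      (Fs (Suc i)) (Es (Suc i)) (ks (Suc i)) (ss (Suc i)) (us (Suc i)))"
  proof (rule chain5[where P = ?P and Q = ?Q])
    show "?P F0 E0 k0 s0 ()" using c0 s0 by blast
  qed (rule step)
  then obtain Fs Es ks ss us where "\<forall>i. ?P (Fs i) (Es i) (ks i) (ss i) (us i) \<and> ?Q i (Fs i) (Es i) (ks i) (ss i) (us i)
      (Fs (Suc i)) (Es (Suc i)) (ks (Suc i)) (ss (Suc i)) (us (Suc i))"
    by (elim exE conjE) (rule that)
  note ch = this[rule_format]
  have P: "cond b (Fs i) (Es i) (ks i)" for i using ch[of i] by blast
  have bd: "Fs i \<subseteq> {..<ks i}" "Es i \<subseteq> {..<ks i}" for i using P[of i] unfolding cond_def by blast+
  have Q: "ks i \<le> ks (Suc i)" "Fs i \<subseteq> Fs (Suc i)" "Fs (Suc i) \<subseteq> Fs i \<union> fst (res (ss i)) \<inter> {ks i..}"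
     "Es i \<subseteq> Es (Suc i)" "Es (Suc i) \<subseteq> Es i \<union> snd (res (ss i)) \<inter> {ks i..}"
     "fst (res (ss (Suc i))) \<subseteq> fst (res (ss i))" "snd (res (ss (Suc i))) \<subseteq> snd (res (ss i))"
     "met (from_nat i) (Fs (Suc i)) (Es (Suc i)) (ks (Suc i)) (ss (Suc i))"
     "\<exists>x\<in>Fs (Suc i). ks i \<le> x" "\<exists>z\<in>Es (Suc i). ks i \<le> z" for i
    using conjunct2[OF ch[of i]] by - (elim conjE, assumption)+
  have mono: "ks i \<le> ks j" "Fs i \<subseteq> Fs j" "Es i \<subseteq> Es j" if "i \<le> j" for i j
    using lift_Suc_mono_le[of ks, OF Q(1) that] lift_Suc_mono_le[of Fs, OF Q(2) that]
      lift_Suc_mono_le[of Es, OF Q(4) that] by simp_all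
  have anti: "fst (res (ss j)) \<subseteq> fst (res (ss i))" "snd (res (ss j)) \<subseteq> snd (res (ss i))" if "i \<le> j" for i j
    using lift_Suc_antimono_le[of "\<lambda>i. fst (res (ss i))", OF Q(6) that]
      lift_Suc_antimono_le[of "\<lambda>i. snd (res (ss i))", OF Q(7) that] by simp_all
  have tail: "Fs j \<subseteq> Fs i \<union> fst (res (ss i)) \<inter> {ks i..}" "Es j \<subseteq> Es i \<union> snd (res (ss i)) \<inter> {ks i..}" for i j
  proof -
    have "Fs j \<subseteq> Fs i \<union> fst (res (ss i)) \<inter> {ks i..} \<and> Es j \<subseteq> Es i \<union> snd (res (ss i)) \<inter> {ks i..}"
    proof (cases "i \<le> j")
      case True
      then show ?thesis
      proof (induction j rule: dec_induct)
        case (step j)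
        have "{ks j..} \<subseteq> {ks i..}" using mono(1)[OF step(1)] by simp
        then have "fst (res (ss j)) \<inter> {ks j..} \<subseteq> fst (res (ss i)) \<inter> {ks i..}"
          "snd (res (ss j)) \<inter> {ks j..} \<subseteq> snd (res (ss i)) \<inter> {ks i..}" using anti[OF step(1)] by (intro Int_mono; simp)+
        with step.IH Q(3,5)[of j] show ?case by blast
      qed simp
    next
      case False
      then show ?thesis using mono(2,3)[of j i] by auto
    qed
    then show "Fs j \<subseteq> Fs i \<union> fst (res (ss i)) \<inter> {ks i..}" "Es j \<subseteq> Es i \<union> snd (res (ss i)) \<inter> {ks i..}" by blast+
  qed
  have ks_lt: "ks i < ks (Suc i)" for i using Q(9)[of i] bd(1)[of "Suc i"] by fastforce
  have ks_ge: "i \<le> ks i" for i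
  proof (induction i)
    case (Suc i)
    then show ?case using ks_lt[of i] by simp
  qed simp
  define L where "L = (\<Union>i. Fs i)"
  define R where "R = (\<Union>i. Es i)"
  have infL: "infinite L" unfolding infinite_nat_iff_unbounded_le
  proof
    fix m
    obtain x where "x \<in> Fs (Suc m)" "ks m \<le> x" using Q(9)[of m] by blast
    then show "\<exists>n\<ge>m. n \<in> L" using ks_ge[of m] unfolding L_def by (intro exI[of _ x]) auto
  qed
  have infR: "infinite R" unfolding infinite_nat_iff_unbounded_le
  proof
    fix m
    obtain x where "x \<in> Es (Suc m)" "ks m \<le> x" using Q(10)[of m] by blast
    then show "\<exists>n\<ge>m. n \<in> R" using ks_ge[of m] unfolding R_def by (intro exI[of _ x]) auto
  qed
  have LR: "Fs i \<subseteq> L" "Es i \<subseteq> R" "L \<subseteq> Fs i \<union> fst (res (ss i)) \<inter> {ks i..}" "R \<subseteq> Es i \<union> snd (res (ss i)) \<inter> {ks i..}" for i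
    unfolding L_def R_def using tail by blast+
  have cut: "L \<inter> {..<ks i} = Fs i \<inter> {..<ks i}" "R \<inter> {..<ks i} = Es i \<inter> {..<ks i}" for i
    using LR[of i] by fastforce+
  have "inc_p_hom g (join L R)"
    unfolding inc_p_hom_def
  proof (intro exI conjI ballI impI)
    fix x r assume "x \<in> L" "r \<in> R" "x < r"
    then obtain i j where "x \<in> Fs i" "r \<in> Es j" unfolding L_def R_def by blast
    then have "x \<in> Fs (max i j)" "r \<in> Es (max i j)" using mono(2)[of i "max i j"] mono(3)[of j "max i j"] by auto
    then show "g x r = b" using P[of "max i j"] \<open>x < r\<close> unfolding cond_def by blast
  qed (use infL infR in simp_all)
  moreover have "\<not> (\<exists>Y'. p_hom f Y' \<and> turing_le (chr Y') (chr (join L R)))"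
  proof
    assume "\<exists>Y'. p_hom f Y' \<and> turing_le (chr Y') (chr (join L R))"
    then obtain Y q where Y: "p_hom f Y" and q: "\<And>x. reval (chr (join L R)) q [x] (chr Y x)"
      unfolding turing_le_def by blast
    have mem: "x \<in> Y \<longleftrightarrow> reval (chr (join L R)) q [x] 1" for x
      using reval_det[OF q[of x], of 1] q[of x] by (auto simp: chr_def split: if_splits)
    define i where "i = Suc (to_nat q)"
    have "met q (Fs i) (Es i) (ks i) (ss i)" using Q(8)[of "to_nat q"] by (simp add: i_def)
    then show False unfolding met_def
    proof
      assume "\<exists>a y. bad f a y \<and> (\<forall>L R. L \<inter> {..<ks i} = Fs i \<inter> {..<ks i} \<longrightarrow> R \<inter> {..<ks i} = Es i \<inter> {..<ks i} \<longrightarrow>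
       a \<in> left q (join L R) \<and> y \<in> right q (join L R))"
      then obtain a y where ay: "bad f a y" "a \<in> left q (join L R)" "y \<in> right q (join L R)" using cut[of i] by blast
      then have "2 * a \<in> Y" "2 * y + 1 \<in> Y" unfolding left_def right_def mem by simp_all
      from p_hom_not_bad[OF Y f this] ay(1) show False by simp
    next
      assume sp: "spoiled q (Fs i) (Es i) (fst (res (ss i))) (snd (res (ss i)))"
      let ?L = "L \<inter> {ks i..}" and ?R = "R \<inter> {ks i..}"
      \<comment> \<open>Everything added from the bound \<open>ks i\<close> on comes from reservoirs
        on which one side of the output is always finite, whereas Y has two infinite sides.\<close>
      have sub: "?L \<subseteq> fst (res (ss i))" "?R \<subseteq> snd (res (ss i))" using LR(3,4)[of i] bd[of i] by fastforce+
      have e: "Fs i \<union> ?L = L" "Es i \<union> ?R = R" using LR[of i] by blast+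
      obtain A B where AB: "Y = join A B" "infinite A" "infinite B"
        using Y unfolding p_hom_def by (elim exE conjE) (rule that)
      have "2 * a \<in> Y" if "a \<in> A" for a using that by (simp add: AB(1) mem_join)
      then have "A \<subseteq> left q (join L R)" unfolding left_def mem by blast
      moreover have "2 * y + 1 \<in> Y" if "y \<in> B" for y using that by (simp add: AB(1) mem_join)
      then have "B \<subseteq> right q (join L R)" unfolding right_def mem by blast
      ultimately have "infinite (left q (join L R))" "infinite (right q (join L R))"
        using AB(2,3) finite_subset by blast+
      moreover have "finite (left q (join (Fs i \<union> ?L) (Es i \<union> ?R))) \<or> finite (right q (join (Fs i \<union> ?L) (Es i \<union> ?R)))"
        using sp[unfolded spoiled_def defeated_def, rule_format, OF sub(1) infinite_Int_atLeast[OF infL] sub(2)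
            infinite_Int_atLeast[OF infR]] .
      ultimately show False unfolding e by blast
    qed
  qed
  ultimately show ?thesis unfolding solvable_def by blast
qed

text \<open>The same task is posed for both colors, with reservoirs starting above the finitely many
  left elements of limit \<open>\<not> b\<close>. An answer in the wrong color can then only have an
  empty left part, and such an extension is equally valid for b.\<close>

lemma solvable_one_sided:
  assumes fin: "finite (fst (res s) \<inter> {x. lims g x (\<not> b)})"
  shows solvable
proof (rule solvable_of_extends[of "\<lambda>s'. fst (res s') \<subseteq> fst (res s)" s b "{}" "{}" 0])
  show "cond b {} {} 0" by (simp add: cond_def)
  show "infinite (fst (res s') \<inter> {x. lims g x b})" if sub: "fst (res s') \<subseteq> fst (res s)" for s'
  proof
    assume a: "finite (fst (res s') \<inter> {x. lims g x b})"
    have "lims g x b \<or> lims g x (\<not> b)" for x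
    proof -
      obtain l where "lims g x l" using lims_exists[OF g] by blast
      then show ?thesis by (cases "l = b") auto
    qed
    then have "fst (res s') \<subseteq> (fst (res s') \<inter> {x. lims g x b}) \<union> (fst (res s) \<inter> {x. lims g x (\<not> b)})" using sub by blast
    with a fin have "finite (fst (res s'))" by (meson finite_Un finite_subset)
    with infinite_res show False by blast
  qed
  fix s' F E k e assume sub: "fst (res s') \<subseteq> fst (res s)" and c: "cond b F E k"
  obtain m0 where m0: "\<forall>r\<in>fst (res s) \<inter> {x. lims g x (\<not> b)}. r < m0" using above_finite[OF fin] by blast
  have f2: "finite F" "finite E" using c by (simp_all add: cond_def)
  obtain b' D G s'' m where D: "finite D" "finite G" "D \<subseteq> fst (res s') \<inter> {max k m0..}" "G \<subseteq> snd (res s') \<inter> {max k m0..}"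
    "\<And>x. x \<in> D \<Longrightarrow> lims g x b'" "\<And>x r. x \<in> D \<Longrightarrow> r \<in> G \<Longrightarrow> x < r \<Longrightarrow> g x r = b'"
    "fst (res s'') \<subseteq> fst (res s')" "snd (res s'') \<subseteq> snd (res s')"
    "\<And>k'. m \<le> k' \<Longrightarrow> met e (F \<union> D) (E \<union> G) k' s''"
    by (rule task_step[of "\<lambda>_. F" "\<lambda>_. E" s' "max k m0" "\<lambda>_. e", OF f2]) (rule that; assumption)
  have bb: "b' = b" if "x \<in> D" for x
  proof (rule ccontr)
    assume "b' \<noteq> b"
    then have "b' = (\<not> b)" by simp
    then have "lims g x (\<not> b)" using D(5)[OF that] by simp
    then have "x < m0" using m0 D(3) sub that by blast
    with D(3) that show False by auto
  qed
  show "extends b s' F E k e"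
    by (rule extendsI[OF c D(1-4) max.cobounded1 _ _ D(7-9)]) (use bb D(5,6) in blast)+
qed auto

text \<open>If color False cannot always meet its tasks, one stuck task is kept and paired with each
  task for color True. An answer for False would extend the stuck condition, so every answer is one
  for True.\<close>

lemma solvable_two_sided:
  assumes inf: "\<And>s b. infinite (fst (res s) \<inter> {x. lims g x b})"
  shows solvable
proof (cases "\<forall>s F E k e. cond False F E k \<longrightarrow> extends False s F E k e")
  case True
  show ?thesis
    by (rule solvable_of_extends[of "\<lambda>_. True" "[]" False "{}" "{}" 0]) (use inf True in \<open>auto simp: cond_def\<close>)
next
  case False
  then obtain s0 F0 E0 k0 e0 where c0: "cond False F0 E0 k0" and no: "\<not> extends False s0 F0 E0 k0 e0" by blast
  show ?thesis
  proof (rule solvable_of_extends[of "\<lambda>s. fst (res s) \<subseteq> fst (res s0) \<and> snd (res s) \<subseteq> snd (res s0)" s0 True "{}" "{}" 0])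
    show "cond True {} {} 0" by (simp add: cond_def)
    fix s F E k e assume sub: "fst (res s) \<subseteq> fst (res s0) \<and> snd (res s) \<subseteq> snd (res s0)" and c: "cond True F E k"
    have f2: "finite (if b then F else F0)" "finite (if b then E else E0)" for b
      using c c0 by (simp_all add: cond_def)
    obtain b D G s' m where D: "finite D" "finite G" "D \<subseteq> fst (res s) \<inter> {max k k0..}" "G \<subseteq> snd (res s) \<inter> {max k k0..}"
      "\<And>x. x \<in> D \<Longrightarrow> lims g x b" "\<And>x r. x \<in> D \<Longrightarrow> r \<in> G \<Longrightarrow> x < r \<Longrightarrow> g x r = b"
      "fst (res s') \<subseteq> fst (res s)" "snd (res s') \<subseteq> snd (res s)"
      "\<And>k'. m \<le> k' \<Longrightarrow> met (if b then e else e0) ((if b then F else F0) \<union> D) ((if b then E else E0) \<union> G) k' s'"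
      by (rule task_step[of "\<lambda>b. if b then F else F0" "\<lambda>b. if b then E else E0" s "max k k0" "\<lambda>b. if b then e else e0", OF f2])
        (rule that; assumption)
    show "extends True s F E k e"
    proof (cases b)
      case True
      show ?thesis
        by (rule extendsI[OF c D(1-4) max.cobounded1 _ _ D(7,8), where m = m]) (use D(5,6,9) True in auto)
    next
      case False
      have "extends False s0 F0 E0 k0 e0"
        by (rule extendsI[OF c0 D(1,2) _ _ max.cobounded2[of k0 k], where s' = s' and m = m])
          (use D False sub in auto)
      with no show ?thesis ..
    qed
  qed (use inf in auto)
qed

lemma solvable: solvable
proof (cases "\<exists>s b. finite (fst (res s) \<inter> {x. lims g x (\<not> b)})")
  case True
  then show ?thesis using solvable_one_sided by blast
next
  case False
  have "infinite (fst (res s) \<inter> {x. lims g x b})" for s b using False[unfolded not_ex, rule_format, of s "\<not> b"] by simp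
  then show ?thesis by (rule solvable_two_sided)
qed

end

theorem theorem1p9:
  shows "\<not> sc_le stable p_hom col_code stable inc_p_hom col_code"
proof
  assume sc: "sc_le stable p_hom col_code stable inc_p_hom col_code"
  obtain f where f: "stable f" "\<And>p x b m. decides f (S_lim p x b m)" "\<And>p. decides f (S_tot p)"
     "\<And>p. decides f (S_col p)" "\<And>p t0 t1 k s. decides f (S_target p t0 t1 k s)"
    using generic_for_all by blast
  obtain g where g: "stable g" "turing_le (col_code g) (col_code f)"
    and sol: "\<And>Y. inc_p_hom g Y \<Longrightarrow> \<exists>Y'. p_hom f Y' \<and> turing_le (chr Y') (chr Y)"
    using sc f(1) unfolding sc_le_def by blast
  obtain p where p: "\<And>x. reval (col_code f) p [x] (col_code g x)" using g(2) unfolding turing_le_def by blast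
  interpret generic f g p by standard (use f g p in auto)
  show False using solvable sol unfolding solvable_def by blast
qed

end
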